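(* Let $X\subset Y$ be Banach spaces, let $\Omega\subset\mathbb C$ be a connected open set, and let $$Q:\Omega\times\mathbb C\to\mathcal L(X,Y),\qquad (\alpha,k)\mapsto Q(\alpha,k),$$ be a holomorphic family of Fredholm operators of index $0$. Suppose that there exist a lattice $\Gamma^*\subset\mathbb C$ and families of invertible operators $W_X(\gamma):X\to X$ and $W_Y(\gamma):Y\to Y$, $\gamma\in\Gamma^*$, such that $$Q(\alpha,k+\gamma)=W_Y(\gamma)^{-1}Q(\alpha,k)W_X(\gamma)\qquad\text{for all }\alpha\in\Omega,\ k\in\mathbb C,\ \gamma\in\Gamma^*.$$ Let $m(\alpha,k)$ denote the multiplicity defined in the context. Suppose that for some $\alpha_0\in\Omega$ we have, for every $\alpha\in\Omega$ and every $k\in\mathbb C$, $$m(\alpha,k)\ge m(\alpha_0,k)\quad\text{and}\quad m(\alpha_0,k)\neq\infty .$$ Then there exists a discrete set $\mathcal A\subset\Omega$ such that for all $k\in\mathbb C$ and all $\alpha\in\Omega$ $$m(\alpha,k)=\begin{cases}\infty, & \alpha\in\mathcal A,\\ m(\alpha_0,k), & \alpha\notin\mathcal A.\end{cases}$$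
   Context: A lattice in $\mathbb C$ is a discrete additive subgroup of rank $2$. $\mathcal L(X,Y)$ denotes the bounded linear operators from $X$ to $Y$; invertible means bounded with bounded inverse. Multiplicity. Let $\alpha\in\Omega$. If there is $k_0\in\mathbb C$ with $\ker Q(\alpha,k_0)=\{0\}$, then $\zeta\mapsto Q(\alpha,\zeta)^{-1}$ is a meromorphic family of operators on $\mathbb C$ (by analytic Fredholm theory), and one defines, for $k\in\mathbb C$, $$m(\alpha,k):=\frac1{2\pi i}\operatorname{tr}\oint_{\partial D}Q(\alpha,\zeta)^{-1}\,\partial_\zeta Q(\alpha,\zeta)\,d\zeta ,$$ where the integral is over the positively oriented boundary of a disc $D$ containing $k$ such that $k$ is the only possible pole of $\zeta\mapsto Q(\alpha,\zeta)^{-1}$ in (the closure of) $D$; the integral is a finite rank operator on $X$. Otherwise (if $\ker Q(\alpha,k)\ne\{0\}$ for all $k\in\mathbb C$) one puts $m(\alpha,k):=\infty$ for all $k\in\mathbb C$. *)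

theory Defs
  imports
    "HOL-Complex_Analysis.Complex_Analysis"
    "HOL-Library.Complex_Order"
    "HOL-Library.Extended"
begin

section \<open>Complex Banach spaces\<close>

class complex_normed_vector = real_normed_vector +
  fixes scaleC :: "complex \<Rightarrow> 'a \<Rightarrow> 'a"  (infixr \<open>*\<^sub>C\<close> 75)
  assumes scaleC_add_right: "c *\<^sub>C (x + y) = c *\<^sub>C x + c *\<^sub>C y"
    and scaleC_add_left: "(c + d) *\<^sub>C x = c *\<^sub>C x + d *\<^sub>C x"
    and scaleC_scaleC: "c *\<^sub>C (d *\<^sub>C x) = (c * d) *\<^sub>C x"
    and scaleC_of_real: "complex_of_real r *\<^sub>C x = r *\<^sub>R x"
    and norm_scaleC: "norm (c *\<^sub>C x) = cmod c * norm x"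

class complex_banach = complex_normed_vector + banach

instantiation complex :: complex_banach
begin

definition scaleC_complex :: "complex \<Rightarrow> complex \<Rightarrow> complex" where
  "scaleC_complex c z = c * z"

instance
  by standard (simp_all add: scaleC_complex_def algebra_simps norm_mult scaleR_conv_of_real)

end

global_interpretation complex_vector:
  vector_space "scaleC :: complex \<Rightarrow> 'a \<Rightarrow> 'a :: complex_normed_vector"
proof unfold_locales
  show "1 *\<^sub>C x = x" for x :: 'a
    using scaleC_of_real[of 1 x] by simp
qed (simp_all add: scaleC_add_right scaleC_add_left scaleC_scaleC)

lemma bounded_linear_scaleC: "bounded_linear (\<lambda>x :: 'a :: complex_normed_vector. c *\<^sub>C x)"
proof (rule bounded_linear_intro)
  show "c *\<^sub>C (r *\<^sub>R x) = r *\<^sub>R (c *\<^sub>C x)" for r and x :: 'a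
    by (simp add: scaleC_scaleC mult.commute flip: scaleC_of_real)
  show "norm (c *\<^sub>C x) \<le> norm x * cmod c" for x :: 'a
    by (simp add: norm_scaleC mult.commute)
qed (rule scaleC_add_right)

text \<open>Real-bounded-linear maps into a complex normed space form a complex normed space. The
  operators of interest are those in the complex subspace \<open>cblinfun\<close> below.\<close>

instantiation blinfun :: (real_normed_vector, complex_normed_vector) complex_normed_vector
begin

lift_definition scaleC_blinfun :: "complex \<Rightarrow> 'a \<Rightarrow>\<^sub>L 'b \<Rightarrow> 'a \<Rightarrow>\<^sub>L 'b"
  is "\<lambda>c f x. c *\<^sub>C f x"
  by (rule bounded_linear_compose[OF bounded_linear_scaleC])

instance
proof
  fix c d :: complex and r :: real and f g :: "'a \<Rightarrow>\<^sub>L 'b"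
  show "c *\<^sub>C (f + g) = c *\<^sub>C f + c *\<^sub>C g"
    by transfer (simp add: scaleC_add_right)
  show "(c + d) *\<^sub>C f = c *\<^sub>C f + d *\<^sub>C f"
    by transfer (simp add: scaleC_add_left)
  show "c *\<^sub>C (d *\<^sub>C f) = (c * d) *\<^sub>C f"
    by transfer (simp add: scaleC_scaleC)
  show "complex_of_real r *\<^sub>C f = r *\<^sub>R f"
    by transfer (simp add: scaleC_of_real)
  have le: "norm (e *\<^sub>C h) \<le> cmod e * norm h" for e and h :: "'a \<Rightarrow>\<^sub>L 'b"
  proof (rule norm_blinfun_bound)
    show "norm ((e *\<^sub>C h) x) \<le> cmod e * norm h * norm x" for x
      using mult_left_mono[OF norm_blinfun[of h x], of "cmod e"]
      by (simp add: scaleC_blinfun.rep_eq norm_scaleC mult.assoc)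
  qed simp
  show "norm (c *\<^sub>C f) = cmod c * norm f"
  proof (cases "c = 0")
    case True
    then show ?thesis using le[of c f] by simp
  next
    case False
    have "inverse c *\<^sub>C (c *\<^sub>C f) = f"
      using False
      by (intro blinfun_eqI) (simp add: scaleC_blinfun.rep_eq)
    then have "norm f \<le> cmod (inverse c) * norm (c *\<^sub>C f)"
      using le[of "inverse c" "c *\<^sub>C f"] by simp
    then have "cmod c * norm f \<le> norm (c *\<^sub>C f)"
      using False by (simp add: norm_inverse norm_divide field_simps)
    with le[of c f] show ?thesis by simp
  qed
qed

end

instance blinfun :: (real_normed_vector, complex_banach) complex_banach ..

section \<open>Bounded complex-linear operators\<close>

definition cblinfun :: "('a::complex_normed_vector \<Rightarrow>\<^sub>L 'b::complex_normed_vector) set" where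
  "cblinfun = {T. Vector_Spaces.linear (*\<^sub>C) (*\<^sub>C) (blinfun_apply T)}"

definition op_invertible :: "('a::real_normed_vector \<Rightarrow>\<^sub>L 'b::real_normed_vector) \<Rightarrow> bool" where
  "op_invertible T \<longleftrightarrow> (\<exists>S. S o\<^sub>L T = id_blinfun \<and> T o\<^sub>L S = id_blinfun)"

definition op_inverse ::
    "('a::real_normed_vector \<Rightarrow>\<^sub>L 'b::real_normed_vector) \<Rightarrow> ('b \<Rightarrow>\<^sub>L 'a)" where
  "op_inverse T = (THE S. S o\<^sub>L T = id_blinfun \<and> T o\<^sub>L S = id_blinfun)"

definition op_ker :: "('a::real_normed_vector \<Rightarrow>\<^sub>L 'b::real_normed_vector) \<Rightarrow> 'a set" where
  "op_ker T = {x. blinfun_apply T x = 0}"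

definition finite_cdim :: "'a::complex_normed_vector set \<Rightarrow> bool" where
  "finite_cdim V \<longleftrightarrow> (\<exists>B. finite B \<and> V \<subseteq> complex_vector.span B)"

text \<open>\<open>ccodim V\<close> is the dimension of the quotient of the whole space by \<open>V\<close>, computed as the
  least number of vectors that span the whole space modulo \<open>V\<close>.\<close>

definition finite_ccodim :: "'a::complex_normed_vector set \<Rightarrow> bool" where
  "finite_ccodim V \<longleftrightarrow> (\<exists>B. finite B \<and> complex_vector.span (V \<union> B) = UNIV)"

definition ccodim :: "'a::complex_normed_vector set \<Rightarrow> nat" where
  "ccodim V = (LEAST n. \<exists>B. finite B \<and> card B = n \<and> complex_vector.span (V \<union> B) = UNIV)"

definition fredholm :: "('a::complex_normed_vector \<Rightarrow>\<^sub>L 'b::complex_normed_vector) \<Rightarrow> bool" where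
  "fredholm T \<longleftrightarrow> finite_cdim (op_ker T) \<and> finite_ccodim (range (blinfun_apply T))"

definition fredholm_index ::
    "('a::complex_normed_vector \<Rightarrow>\<^sub>L 'b::complex_normed_vector) \<Rightarrow> int" where
  "fredholm_index T =
     int (complex_vector.dim (op_ker T)) - int (ccodim (range (blinfun_apply T)))"

text \<open>The trace of a finite rank operator: the trace of the endomorphism that it induces on its
  range, in any basis of the range.\<close>

definition op_trace :: "('a::complex_normed_vector \<Rightarrow>\<^sub>L 'a) \<Rightarrow> complex" where
  "op_trace T =
     (let B = (SOME B. finite B \<and> complex_vector.independent B \<and>
                       complex_vector.span B = range (blinfun_apply T))
      in \<Sum>b\<in>B. complex_vector.representation B (blinfun_apply T b) b)"

section \<open>Operator-valued complex analysis\<close>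

text \<open>Holomorphy in two variables is complex Frechet differentiability in the operator norm:
  \<open>\<lambda>h. fst h *\<^sub>C A + snd h *\<^sub>C B\<close> is the general complex-linear map on \<open>\<complex>\<^sup>2\<close>.\<close>

definition holomorphic2_on ::
    "(complex \<times> complex \<Rightarrow> 'a::complex_normed_vector) \<Rightarrow> (complex \<times> complex) set \<Rightarrow> bool" where
  "holomorphic2_on F U \<longleftrightarrow>
     (\<forall>p\<in>U. \<exists>A B. (F has_derivative (\<lambda>h. fst h *\<^sub>C A + snd h *\<^sub>C B)) (at p within U))"

definition cderiv :: "(complex \<Rightarrow> 'a::complex_normed_vector) \<Rightarrow> complex \<Rightarrow> 'a" where
  "cderiv F z = (THE D. (F has_derivative (\<lambda>h. h *\<^sub>C D)) (at z))"

definition vec_contour_integral ::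
    "(real \<Rightarrow> complex) \<Rightarrow> (complex \<Rightarrow> 'a::complex_normed_vector) \<Rightarrow> 'a" where
  "vec_contour_integral g F = integral {0..1} (\<lambda>t. vector_derivative g (at t) *\<^sub>C F (g t))"

section \<open>Lattices\<close>

text \<open>The rank of an additive subgroup of \<open>\<complex>\<close> is the maximal size of a finite subset that is
  linearly independent over the integers.\<close>

lemma module_int_complex: "module (\<lambda>(n::int) (z::complex). of_int n * z)"
  by unfold_locales (simp_all add: algebra_simps)

definition int_independent :: "complex set \<Rightarrow> bool" where
  "int_independent B \<longleftrightarrow> \<not> module.dependent (\<lambda>(n::int) (z::complex). of_int n * z) B"

definition has_int_rank :: "complex set \<Rightarrow> nat \<Rightarrow> bool" where
  "has_int_rank G n \<longleftrightarrow>
     (\<exists>B\<subseteq>G. finite B \<and> card B = n \<and> int_independent B) \<and>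
     (\<forall>B\<subseteq>G. finite B \<and> int_independent B \<longrightarrow> card B \<le> n)"

definition complex_lattice :: "complex set \<Rightarrow> bool" where
  "complex_lattice G \<longleftrightarrow>
     0 \<in> G \<and> (\<forall>x\<in>G. \<forall>y\<in>G. x + y \<in> G) \<and> (\<forall>x\<in>G. - x \<in> G) \<and> discrete G \<and> has_int_rank G 2"

section \<open>Multiplicity\<close>

text \<open>For a holomorphic family of operators, a point at which the inverse is undefined is never a
  removable singularity of the inverse, so the possible poles of the inverse are exactly the points
  of non-invertibility. The disc need not be centred at \<open>k\<close>.\<close>

definition isolating_disc ::
    "(complex \<Rightarrow> ('a::real_normed_vector \<Rightarrow>\<^sub>L 'b::real_normed_vector)) \<Rightarrow> complex \<Rightarrow>
     complex \<times> real \<Rightarrow> bool" where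
  "isolating_disc P k = (\<lambda>(c, r). k \<in> ball c r \<and> (\<forall>\<zeta>\<in>cball c r - {k}. op_invertible (P \<zeta>)))"

text \<open>The value of the integral does not depend on the chosen disc. The multiplicity is kept as
  the complex number given by the trace; the order on \<open>complex\<close> from \<open>Complex_Order\<close> is the usual
  one on numbers with equal imaginary parts, and \<open>Pinf\<close> is the value infinity.\<close>

definition multiplicity_at ::
    "(complex \<times> complex \<Rightarrow> ('a::complex_normed_vector \<Rightarrow>\<^sub>L 'b::complex_normed_vector)) \<Rightarrow>
     complex \<Rightarrow> complex \<Rightarrow> complex extended" where
  "multiplicity_at Q \<alpha> k =
     (if \<exists>k\<^sub>0. op_ker (Q (\<alpha>, k\<^sub>0)) = {0}
      then let P = (\<lambda>\<zeta>. Q (\<alpha>, \<zeta>)); (c, r) = (SOME D. isolating_disc P k D)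
           in Fin (1 / (2 * of_real pi * \<i>) *
                op_trace (vec_contour_integral (circlepath c r)
                  (\<lambda>\<zeta>. op_inverse (P \<zeta>) o\<^sub>L cderiv P \<zeta>)))
      else Pinf)"

end

theory Submission
  imports Defs "Jordan_Normal_Form.Determinant"
begin

text \<open>
  Near every point the family is \<open>Q = E - F\<close> with \<open>E\<close> invertible and \<open>F = (\<Sum>i<n. f i \<otimes> y i)\<close> of
  finite rank, and then \<open>Q\<close> is invertible exactly where the scalar function
  \<open>d = det (\<delta>\<^sub>i\<^sub>j - f i (E\<inverse> (y j)))\<close> does not vanish. The Woodbury formula for \<open>Q\<inverse>\<close> and Jacobi's
  formula for \<open>d'\<close> give \<open>tr (\<ointegral> Q\<inverse> Q') = \<ointegral> d' / d\<close>, so that the multiplicity at \<open>k\<close> is the order of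
  the zero of \<open>d(\<alpha>, \<cdot>)\<close> at \<open>k\<close>. By Rouche's theorem the sum of the multiplicities over a small
  disc is locally constant in \<open>\<alpha>\<close>. Where the multiplicities at \<open>\<alpha>\<close> are the minimal ones, none of
  them can move or split, and since the lattice is cocompact the multiplicities stay minimal in a
  neighbourhood of \<open>\<alpha>\<close>. As the condition of having minimal multiplicities is also closed, it holds
  on the complement of the set \<open>A\<close> of all \<open>\<alpha>\<close> for which \<open>Q(\<alpha>, \<cdot>)\<close> is nowhere invertible. This
  complement is connected, because \<open>A\<close> is contained in the zero set of functions
  \<open>d(\<cdot>, k\<^sub>0)\<close> that do not vanish identically.
\<close>

subsection \<open>Bounded functionals\<close>

text \<open>The trace cannot be taken under the integral:
  \<open>op_inverse (P z) o\<^sub>L cderiv P z\<close> is in general not of finite rank. The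
  Woodbury formula splits it into a part holomorphic near \<open>k\<close>, which contributes no
  residue, and finitely many terms \<open>\<phi> i z x *\<^sub>C G z (y i)\<close> with a possible
  pole at \<open>k\<close>. Cutting the Taylor series of \<open>G z (y i)\<close> at the order of
  the pole exhibits the integral as a finite sum of rank one operators, and only then does the trace
  become a sum of scalar residues. Scalar complex analysis reaches Banach space values through
  bounded complex-linear functionals, which separate points by a Hahn-Banach argument. The local
  form \<open>E - F\<close> relies on the bounded inverse theorem, since \<open>E\<close> is at
  first only known to be bijective. The lattice makes a statement that is local in \<open>k\<close>
  global: the neighbourhood of a parameter on which nothing changes depends on \<open>k\<close>, and
  only finitely many such neighbourhoods, enough for a compact set of representatives, can be
  intersected.\<close>

definition sublinear :: "('a::real_vector \<Rightarrow> real) \<Rightarrow> bool" where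
  "sublinear p \<longleftrightarrow> (\<forall>x y. p (x + y) \<le> p x + p y) \<and> (\<forall>t>0. \<forall>x. p (t *\<^sub>R x) \<le> t * p x)"

text \<open>Homogeneity is required only as an inequality; applied to \<open>t\<close> and to
  \<open>inverse t\<close> it becomes an equality. At \<open>t = 0\<close>, subadditivity gives
  \<open>p 0 \<ge> 0\<close> and scaling by \<open>1/2\<close> gives
  \<open>p 0 \<le> 0\<close>.\<close>

lemma sublinear_scale:
  assumes "sublinear p" "t \<ge> 0"
  shows "p (t *\<^sub>R x) = t * p x"
proof (cases "t = 0")
  case True
  have "p (0 + 0) \<le> p 0 + p 0"
    using assms(1) unfolding sublinear_def by blast
  moreover have "p ((1/2) *\<^sub>R 0) \<le> (1/2) * p 0"
    using conjunct2[OF assms(1)[unfolded sublinear_def], rule_format, of "1/2" 0] by simp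
  ultimately have "p 0 = 0" by simp
  then show ?thesis using True by simp
next
  case False
  then have t: "t > 0" using assms(2) by simp
  have "p (inverse t *\<^sub>R (t *\<^sub>R x)) \<le> inverse t * p (t *\<^sub>R x)"
    using assms(1) t by (auto simp: sublinear_def simp del: scaleR_scaleR)
  then have "t * p x \<le> p (t *\<^sub>R x)"
    using t by (simp add: field_simps)
  moreover have "p (t *\<^sub>R x) \<le> t * p x"
    using assms(1) t by (auto simp: sublinear_def)
  ultimately show ?thesis by simp
qed

lemma sublinear_zero: "sublinear p \<Longrightarrow> p 0 = 0"
  using sublinear_scale[of p 0 0] by simp

lemma sublinear_minus: "sublinear p \<Longrightarrow> - p (- x) \<le> p x"
  using sublinear_zero[of p] unfolding sublinear_def by (metis add.right_inverse le_minus_iff minus_le_iff add_le_cancel_left diff_ge_0_iff_ge diff_minus_eq_add)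

lemma sublinear_norm: "sublinear norm"
  by (auto simp: sublinear_def norm_triangle_ineq)

text \<open>This is what makes a minimal functional additive: if \<open>q = p\<close>, the last
  bound reads \<open>p x + p y \<le> p (x + y)\<close>. The witness is the infimum of
  \<open>p (x + t *\<^sub>R y) - t * p y\<close> over \<open>t \<ge> 0\<close>, and
  \<open>t = 0\<close> and \<open>t = 1\<close> give the two bounds.\<close>

lemma sublinear_decrease:
  fixes p :: "'a::real_vector \<Rightarrow> real"
  assumes p: "sublinear p"
  obtains q where "sublinear q" "\<And>x. q x \<le> p x" "\<And>x. q x \<le> p (x + y) - p y"
proof -
  define S where "S x = (\<lambda>t. p (x + t *\<^sub>R y) - t * p y) ` {0..}" for x
  define q where "q x = Inf (S x)" for x
  have sub: "p (a + b) \<le> p a + p b" for a b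
    using p by (simp add: sublinear_def)
  have lower: "- p (- x) \<le> p (x + t *\<^sub>R y) - t * p y" if "t \<ge> 0" for x t
    using sub[of "x + t *\<^sub>R y" "- x"] sublinear_scale[OF p that, of y] by simp
  have ne: "S x \<noteq> {}" for x by (auto simp: S_def)
  have bdd: "bdd_below (S x)" for x
    unfolding S_def using lower by (intro bdd_belowI2) auto
  have qle: "q x \<le> p (x + t *\<^sub>R y) - t * p y" if "t \<ge> 0" for x t
    unfolding q_def by (rule cInf_lower[OF _ bdd]) (use that in \<open>auto simp: S_def\<close>)
  have qge: "c \<le> q x" if "\<And>t. t \<ge> 0 \<Longrightarrow> c \<le> p (x + t *\<^sub>R y) - t * p y" for c x
    unfolding q_def by (rule cInf_greatest[OF ne]) (use that in \<open>auto simp: S_def\<close>)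
  show ?thesis
  proof
    show "sublinear q"
      unfolding sublinear_def
    proof (intro conjI allI impI)
      fix a b
      have 1: "q (a + b) \<le> (p (a + s *\<^sub>R y) - s * p y) + (p (b + t *\<^sub>R y) - t * p y)"
        if "s \<ge> 0" "t \<ge> 0" for s t
        using qle[of "s + t" "a + b"] sub[of "a + s *\<^sub>R y" "b + t *\<^sub>R y"] that
        by (simp add: algebra_simps)
      have "q (a + b) - (p (b + t *\<^sub>R y) - t * p y) \<le> q a" if "t \<ge> 0" for t
        by (rule qge) (use 1 that in fastforce)
      then have "q (a + b) - q a \<le> q b"
        by (intro qge) fastforce
      then show "q (a + b) \<le> q a + q b" by simp
    next
      fix t :: real and x assume t: "t > 0"
      have "inverse t * q (t *\<^sub>R x) \<le> q x"
      proof (rule qge)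
        fix s :: real assume s: "s \<ge> 0"
        have "q (t *\<^sub>R x) \<le> p (t *\<^sub>R x + (t * s) *\<^sub>R y) - (t * s) * p y"
          using s t by (intro qle) auto
        also have "t *\<^sub>R x + (t * s) *\<^sub>R y = t *\<^sub>R (x + s *\<^sub>R y)"
          by (simp add: algebra_simps)
        also have "p \<dots> = t * p (x + s *\<^sub>R y)"
          using t by (intro sublinear_scale p) auto
        finally show "inverse t * q (t *\<^sub>R x) \<le> p (x + s *\<^sub>R y) - s * p y"
          using t by (simp add: field_simps)
      qed
      then show "q (t *\<^sub>R x) \<le> t * q x"
        using t by (simp add: field_simps)
    qed
    show "q x \<le> p x" for x using qle[of 0 x] by simp
    show "q x \<le> p (x + y) - p y" for x using qle[of 1 x] by simp
  qed
qed

text \<open>Zorn's lemma gives a minimal sublinear functional below the norm, and minimality forces it to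
  be linear.\<close>

lemma real_norming_functional:
  fixes v :: "'a::real_normed_vector"
  obtains f :: "'a \<Rightarrow> real" where "linear f" "\<And>x. \<bar>f x\<bar> \<le> norm x" "f v = norm v"
proof -
  \<comment> \<open>The condition at \<open>- v\<close> is inherited by smaller functionals; for a
    linear one it says \<open>norm v \<le> p v\<close>, so that the norm is attained at
    \<open>v\<close>.\<close>
  define A where "A = {p. sublinear p \<and> (\<forall>x. p x \<le> norm x) \<and> p (- v) \<le> - norm v}"
  \<comment> \<open>The order is reversed, so that the maximal element from Zorn's lemma is a
    minimal functional.\<close>
  define P where "P = (\<lambda>(p :: 'a \<Rightarrow> real) q. \<forall>x. q x \<le> p x)"
  obtain p0 :: "'a \<Rightarrow> real" where p0: "sublinear p0" "\<And>x. p0 x \<le> norm x"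
      "\<And>x. p0 x \<le> norm (x + v) - norm v"
    using sublinear_decrease[OF sublinear_norm, of v] by blast
  have "p0 \<in> A"
    using p0(1,2) p0(3)[of "- v"] by (auto simp: A_def)
  have po: "partial_order_on A (relation_of P A)"
    by (rule partial_order_on_relation_ofI) (auto simp: P_def fun_eq_iff intro: order_trans antisym)
  have "\<exists>m\<in>A. \<forall>a\<in>A. P m a \<longrightarrow> a = m"
  proof (rule predicate_Zorn[OF po])
    fix C assume C: "C \<in> Chains (relation_of P A)"
    show "\<exists>u\<in>A. \<forall>a\<in>C. P a u"
    proof (cases "C = {}")
      case True then show ?thesis using \<open>p0 \<in> A\<close> by auto
    next
      case False
      have CA: "p \<in> A" if "p \<in> C" for p
        using C that by (auto simp: Chains_def relation_of_def)
      have chain: "(\<forall>x. p x \<le> q x) \<or> (\<forall>x. q x \<le> p x)" if "p \<in> C" "q \<in> C" for p q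
        using C that by (auto simp: Chains_def relation_of_def P_def)
      define u where "u x = (INF p\<in>C. p x)" for x
      have bdd: "bdd_below ((\<lambda>p. p x) ` C)" for x
      proof (rule bdd_belowI2)
        fix p assume "p \<in> C"
        then have "sublinear p" "p (- x) \<le> norm (- x)" using CA unfolding A_def by blast+
        then show "- norm x \<le> p x" using sublinear_minus[of p x] by simp
      qed
      have ule: "u x \<le> p x" if "p \<in> C" for p x
        unfolding u_def by (rule cINF_lower[OF bdd that])
      have uge: "c \<le> u x" if "\<And>p. p \<in> C \<Longrightarrow> c \<le> p x" for c x
        unfolding u_def by (rule cINF_greatest[OF False that])
      have "sublinear u"
        unfolding sublinear_def
      proof (intro conjI allI impI)
        fix a b
        \<comment> \<open>Of two comparable functionals the smaller one can be used at both
          points.\<close>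
        have 1: "u (a + b) \<le> p a + q b" if "p \<in> C" "q \<in> C" for p q
        proof -
          have "sublinear p" "sublinear q" using that CA by (auto simp: A_def)
          then have "p (a + b) \<le> p a + p b" "q (a + b) \<le> q a + q b"
            by (auto simp: sublinear_def)
          moreover have "u (a + b) \<le> p (a + b)" "u (a + b) \<le> q (a + b)"
            using ule that by auto
          moreover have "p b \<le> q b \<or> q a \<le> p a" using chain[OF that] by auto
          ultimately show ?thesis by linarith
        qed
        have "u (a + b) - q b \<le> u a" if "q \<in> C" for q
          by (rule uge) (use 1 that in fastforce)
        then have "u (a + b) - u a \<le> u b"
          by (intro uge) fastforce
        then show "u (a + b) \<le> u a + u b" by simp
      next
        fix t :: real and x assume t: "t > 0"
        have "inverse t * u (t *\<^sub>R x) \<le> u x"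
        proof (rule uge)
          fix p assume p: "p \<in> C"
          have "u (t *\<^sub>R x) \<le> p (t *\<^sub>R x)" using ule p by auto
          also have "\<dots> \<le> t * p x" using CA[OF p] t by (auto simp: A_def sublinear_def)
          finally show "inverse t * u (t *\<^sub>R x) \<le> p x"
            using t by (simp add: field_simps)
        qed
        then show "u (t *\<^sub>R x) \<le> t * u x"
          using t by (simp add: field_simps)
      qed
      moreover obtain p where "p \<in> C" using False by auto
      ultimately have "u \<in> A"
        using ule[OF \<open>p \<in> C\<close>] CA[OF \<open>p \<in> C\<close>] by (force simp: A_def intro: order_trans)
      then show ?thesis using ule by (auto simp: P_def)
    qed
  qed
  then obtain f where f: "sublinear f" "\<And>x. f x \<le> norm x" "f (- v) \<le> - norm v"
    and min: "\<And>a. a \<in> A \<Longrightarrow> (\<And>x. a x \<le> f x) \<Longrightarrow> a = f"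
    by (auto simp: A_def P_def)
  have add: "f (x + y) = f x + f y" for x y
  proof -
    obtain q where q: "sublinear q" "\<And>x. q x \<le> f x" "\<And>x. q x \<le> f (x + y) - f y"
      using sublinear_decrease[OF f(1), of y] by blast
    have "q = f"
      using q(1) f(2,3) order_trans[OF q(2)] by (intro min q(2)) (auto simp: A_def)
    then have "f x + f y \<le> f (x + y)" using q(3)[of x] by simp
    moreover have "f (x + y) \<le> f x + f y" using f(1) by (auto simp: sublinear_def)
    ultimately show ?thesis by simp
  qed
  have neg: "f (- x) = - f x" for x
    using add[of x "- x"] sublinear_zero[OF f(1)] by simp
  show ?thesis
  proof
    show "linear f"
    proof (rule linearI)
      show "f (t *\<^sub>R x) = t *\<^sub>R f x" for t x
      proof (cases "t \<ge> 0")
        case False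
        then have "f ((- t) *\<^sub>R x) = - t * f x" by (intro sublinear_scale f) auto
        then show ?thesis using neg[of "t *\<^sub>R x"] by simp
      qed (use sublinear_scale[OF f(1)] in auto)
    qed (rule add)
    show "\<bar>f x\<bar> \<le> norm x" for x
      using f(2)[of x] f(2)[of "- x"] neg[of x] by auto
    show "f v = norm v" using neg[of v] f(2)[of v] f(3) by auto
  qed
qed

section \<open>Complex-linear functionals that norm a vector\<close>

lemma cblinfunI:
  assumes "\<And>c x. blinfun_apply T (c *\<^sub>C x) = c *\<^sub>C blinfun_apply T x"
  shows "T \<in> cblinfun"
  unfolding cblinfun_def
  by (simp, unfold_locales) (simp_all add: blinfun.add_right assms)

lemma cblinfun_scaleC: "T \<in> cblinfun \<Longrightarrow> blinfun_apply T (c *\<^sub>C x) = c *\<^sub>C blinfun_apply T x"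
  unfolding cblinfun_def Vector_Spaces.linear_def by (auto simp: module_hom.scale)

text \<open>A complex-linear functional is recovered from its real part \<open>g\<close> as
  \<open>g x - \<i> * g (\<i> *\<^sub>C x)\<close>. The factor 2 arises from estimating the two
  summands separately; norming up to a constant suffices for the later estimates.\<close>

lemma complex_norming_functional:
  fixes v :: "'a::complex_normed_vector"
  obtains f :: "'a \<Rightarrow>\<^sub>L complex" where "f \<in> cblinfun" "\<And>x. cmod (f x) \<le> 2 * norm x" "norm v \<le> cmod (f v)"
proof -
  obtain g :: "'a \<Rightarrow> real" where g: "linear g" "\<And>x. \<bar>g x\<bar> \<le> norm x" "g v = norm v"
    using real_norming_functional by blast
  define h where "h x = complex_of_real (g x) - \<i> * complex_of_real (g (\<i> *\<^sub>C x))" for x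
  have radd: "g (x + y) = g x + g y" and rscale: "g (r *\<^sub>R x) = r * g x" for x y r
    using g(1) by (auto simp: linear_add linear_scale)
  have bound: "cmod (h x) \<le> 2 * norm x" for x
  proof -
    have "cmod (h x) \<le> cmod (complex_of_real (g x)) + cmod (\<i> * complex_of_real (g (\<i> *\<^sub>C x)))"
      unfolding h_def by (rule norm_triangle_ineq4)
    also have "\<dots> \<le> norm x + norm (\<i> *\<^sub>C x)"
      using g(2)[of x] g(2)[of "\<i> *\<^sub>C x"] by (simp add: norm_mult)
    finally show ?thesis by (simp add: norm_scaleC)
  qed
  have hadd: "h (x + y) = h x + h y" for x y
    by (simp add: h_def radd scaleC_add_right algebra_simps)
  have hreal: "h (complex_of_real r *\<^sub>C x) = complex_of_real r * h x" for r x
  proof -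
    have "\<i> *\<^sub>C (r *\<^sub>R x) = r *\<^sub>R (\<i> *\<^sub>C x)"
      by (simp add: scaleC_scaleC mult.commute flip: scaleC_of_real)
    then show ?thesis by (simp add: h_def scaleC_of_real rscale algebra_simps)
  qed
  have hi: "h (\<i> *\<^sub>C x) = \<i> * h x" for x
  proof -
    have "\<i> *\<^sub>C (\<i> *\<^sub>C x) = complex_of_real (- 1) *\<^sub>C x" by (simp add: scaleC_scaleC)
    then have "g (\<i> *\<^sub>C (\<i> *\<^sub>C x)) = - g x"
      using rscale[of "-1" x] by (simp only: scaleC_of_real)
    then show ?thesis by (simp add: h_def algebra_simps)
  qed
  have hscale: "h (c *\<^sub>C x) = c * h x" for c x
  proof -
    have "c *\<^sub>C x = complex_of_real (Re c) *\<^sub>C x + complex_of_real (Im c) *\<^sub>C (\<i> *\<^sub>C x)"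
      by (subst (1) complex_eq[of c]) (simp only: scaleC_add_left scaleC_scaleC mult.commute)
    then have "h (c *\<^sub>C x) = complex_of_real (Re c) * h x + complex_of_real (Im c) * (\<i> * h x)"
      by (simp only: hadd hreal hi)
    also have "\<dots> = (complex_of_real (Re c) + \<i> * complex_of_real (Im c)) * h x"
      by (simp add: algebra_simps)
    also have "\<dots> = c * h x"
      by (simp flip: complex_eq)
    finally show ?thesis .
  qed
  have "bounded_linear h"
  proof (rule bounded_linear_intro)
    show "h (r *\<^sub>R x) = r *\<^sub>R h x" for r x
      using hreal[of r x] by (simp add: scaleC_of_real scaleR_conv_of_real)
    show "norm (h x) \<le> norm x * 2" for x using bound[of x] by simp
  qed (rule hadd)
  then have ap: "blinfun_apply (Blinfun h) = h" by (rule bounded_linear_Blinfun_apply)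
  show ?thesis
  proof
    show "Blinfun h \<in> cblinfun"
      by (rule cblinfunI) (simp add: ap hscale scaleC_complex_def)
    show "cmod (Blinfun h x) \<le> 2 * norm x" for x by (simp add: ap bound)
    have "Re (h v) = norm v" by (simp add: h_def g(3))
    then show "norm v \<le> cmod (Blinfun h v)" using complex_Re_le_cmod[of "h v"] by (simp add: ap)
  qed
qed

lemma functional_separates:
  fixes v w :: "'a::complex_normed_vector"
  assumes "\<And>f :: 'a \<Rightarrow>\<^sub>L complex. f \<in> cblinfun \<Longrightarrow> f v = f w"
  shows "v = w"
proof -
  obtain f :: "'a \<Rightarrow>\<^sub>L complex" where "f \<in> cblinfun" "norm (v - w) \<le> cmod (f (v - w))"
    using complex_norming_functional by blast
  then show ?thesis using assms[of f] by (simp add: blinfun.diff_right)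
qed

subsection \<open>Invertible operators\<close>

lemma op_inverse_unique:
  assumes "S o\<^sub>L T = id_blinfun" "T o\<^sub>L S = id_blinfun"
  shows "op_inverse T = S"
  unfolding op_inverse_def
proof (rule the_equality)
  fix S' assume "S' o\<^sub>L T = id_blinfun \<and> T o\<^sub>L S' = id_blinfun"
  then have "S' (T (S y)) = S y" and "T (S y) = y" for y
    using assms(2) by (metis blinfun_apply_blinfun_compose blinfun_apply_id_blinfun)+
  then show "S' = S" by (metis blinfun_eqI)
qed (use assms in auto)

lemma op_invertible_inverse:
  assumes "op_invertible T"
  shows "op_inverse T o\<^sub>L T = id_blinfun" "T o\<^sub>L op_inverse T = id_blinfun"
proof -
  obtain S where S: "S o\<^sub>L T = id_blinfun" "T o\<^sub>L S = id_blinfun"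
    using assms by (auto simp: op_invertible_def)
  then show "op_inverse T o\<^sub>L T = id_blinfun" "T o\<^sub>L op_inverse T = id_blinfun"
    by (simp_all add: op_inverse_unique[OF S])
qed

lemma op_inverse_apply:
  assumes "op_invertible T"
  shows "op_inverse T (T x) = x" "T (op_inverse T y) = y"
  using op_invertible_inverse[OF assms] by (metis blinfun_apply_blinfun_compose blinfun_apply_id_blinfun id_apply)+

lemma op_invertibleI:
  fixes T :: "'a::real_normed_vector \<Rightarrow>\<^sub>L 'b::real_normed_vector"
  assumes "bij (blinfun_apply T)" and "\<And>x. norm x \<le> K * norm (T x)"
  shows "op_invertible T"
proof -
  define g where "g = inv_into UNIV (blinfun_apply T)"
  have Tg: "T (g y) = y" for y
    unfolding g_def using assms(1) by (simp add: bij_is_surj surj_f_inv_f)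
  have gT: "g (T x) = x" for x
    unfolding g_def using assms(1) by (simp add: bij_is_inj)
  have "bounded_linear g"
  proof (rule bounded_linear_intro)
    show "g (x + y) = g x + g y" for x y
      using gT[of "g x + g y"] by (simp add: blinfun.add_right Tg)
    show "g (r *\<^sub>R x) = r *\<^sub>R g x" for r x
      using gT[of "r *\<^sub>R g x"] by (simp add: blinfun.scaleR_right Tg)
    show "norm (g x) \<le> norm x * K" for x
      using assms(2)[of "g x"] by (simp add: Tg mult.commute)
  qed
  then have ap: "blinfun_apply (Blinfun g) = g" by (rule bounded_linear_Blinfun_apply)
  show ?thesis
    unfolding op_invertible_def
    by (rule exI[of _ "Blinfun g"]) (auto intro!: blinfun_eqI simp: ap Tg gT)
qed

text \<open>The Baire half of the open mapping theorem: some closed image of an integer ball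
  contains a ball around a point \<open>y0\<close>, and differences of approximate preimages move
  the centre from \<open>y0\<close> to the origin.\<close>

lemma surj_approx_preimage:
  fixes T :: "'a::real_normed_vector \<Rightarrow>\<^sub>L 'b::banach"
  assumes "surj (blinfun_apply T)"
  obtains K where "K > 0" "\<And>y \<delta>. \<delta> > 0 \<Longrightarrow> \<exists>x. norm x \<le> K * norm y \<and> norm (T x - y) < \<delta>"
proof -
  define B where "B n = closure (blinfun_apply T ` cball 0 (real n))" for n :: nat
  have "\<exists>n. interior (B n) \<noteq> {}"
  proof (rule ccontr)
    assume no: "\<not> ?thesis"
    have "euclidean interior_of \<Union>(range B) = {}"
    proof (rule Baire_category_alt)
      show "completely_metrizable_space (euclidean :: 'b topology) \<or> locally_compact_space (euclidean :: 'b topology) \<and> regular_space (euclidean :: 'b topology)"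
        using completely_metrizable_space_euclidean by blast
      show "closedin euclidean S \<and> euclidean interior_of S = {}" if "S \<in> range B" for S
        using that no by (auto simp: B_def)
    qed auto
    moreover have "\<Union>(range B) = UNIV"
    proof -
      have "\<exists>n. y \<in> B n" for y
      proof -
        obtain x where x: "T x = y" using assms by (metis surjD)
        obtain n :: nat where "norm x \<le> real n" using real_arch_simple by blast
        then have "y \<in> blinfun_apply T ` cball 0 (real n)" using x by auto
        then show ?thesis
          using closure_subset[of "blinfun_apply T ` cball 0 (real n)"] by (auto simp: B_def)
      qed
      then show ?thesis by auto
    qed
    ultimately show False by simp
  qed
  then obtain n y0 where "y0 \<in> interior (B n)" by blast
  then obtain e where e: "e > 0" "ball y0 e \<subseteq> B n"
    by (meson mem_interior)
  have close: "\<exists>u. norm u \<le> real n \<and> norm (T u - z) < \<delta>" if "norm (z - y0) < e" "\<delta> > 0" for z \<delta>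
  proof -
    have "z \<in> B n" using e that by (auto simp: dist_norm norm_minus_commute)
    then show ?thesis using that(2) unfolding B_def closure_approachable
      by (force simp: dist_norm)
  qed
  \<comment> \<open>The scaling below produces \<open>4 * n / e\<close>; the additional 1 keeps
    \<open>K\<close> positive when \<open>n = 0\<close>.\<close>
  define K where "K = (4 * real n + 1) / e"
  have K: "K > 0" unfolding K_def using e(1) by (intro divide_pos_pos) auto
  show ?thesis
  proof
    fix y and \<delta> :: real assume \<delta>: "\<delta> > 0"
    show "\<exists>x. norm x \<le> K * norm y \<and> norm (T x - y) < \<delta>"
    proof (cases "y = 0")
      case True then show ?thesis using \<delta> by (intro exI[of _ 0]) auto
    next
      case False
      \<comment> \<open>Scales \<open>y\<close> to norm \<open>e / 2\<close>, inside the ball around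
        \<open>y0\<close> after translation.\<close>
      define s where "s = e / (2 * norm y)"
      have s: "s > 0" using False e(1) by (simp add: s_def)
      have "norm (s *\<^sub>R y) < e" using False e(1) by (simp add: s_def)
      then obtain u where u: "norm u \<le> real n" "norm (T u - (y0 + s *\<^sub>R y)) < s * \<delta> / 2"
        using close[of "y0 + s *\<^sub>R y" "s * \<delta> / 2"] s \<delta> by auto
      obtain w where w: "norm w \<le> real n" "norm (T w - y0) < s * \<delta> / 2"
        using close[of y0 "s * \<delta> / 2"] s \<delta> e by auto
      define x where "x = inverse s *\<^sub>R (u - w)"
      have "norm x \<le> inverse s * (2 * real n)"
        unfolding x_def using norm_triangle_ineq4[of u w] u(1) w(1) s
        by (auto intro!: mult_left_mono)
      also have "\<dots> \<le> K * norm y"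
        using e(1) by (simp add: s_def K_def divide_simps algebra_simps)
      finally have 1: "norm x \<le> K * norm y" .
      have "T x - y = inverse s *\<^sub>R ((T u - (y0 + s *\<^sub>R y)) - (T w - y0))"
        using s by (simp add: x_def blinfun.scaleR_right blinfun.diff_right algebra_simps)
      also have "norm \<dots> \<le> inverse s * (norm (T u - (y0 + s *\<^sub>R y)) + norm (T w - y0))"
        unfolding norm_scaleR using s by (intro mult_mono norm_triangle_ineq4) auto
      also have "\<dots> < inverse s * (s * \<delta>)"
        using s u(2) w(2) by (intro mult_strict_left_mono) auto
      also have "inverse s * (s * \<delta>) = \<delta>" using s by (simp add: field_simps)
      finally have "norm (T x - y) < \<delta>" .
      then show ?thesis using 1 by blast
    qed
  qed (rule K)
qed

text \<open>Successive approximation: \<open>r k\<close> is the part of \<open>y\<close> not yet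
  reached and \<open>z k\<close> the next correction, and the tolerance halves at each stage. The
  corrections are dominated by a geometric series of sum \<open>2 * K * norm y\<close>; completeness
  of the domain gives their sum, and injectivity identifies it with \<open>x\<close>.\<close>

lemma bounded_inverse_theorem:
  fixes T :: "'a::banach \<Rightarrow>\<^sub>L 'b::banach"
  assumes "bij (blinfun_apply T)"
  shows "op_invertible T"
proof -
  obtain K where K: "K > 0" "\<And>y \<delta>. \<delta> > 0 \<Longrightarrow> \<exists>x. norm x \<le> K * norm y \<and> norm (T x - y) < \<delta>"
    using surj_approx_preimage[OF bij_is_surj[OF assms]] by blast
  define X where "X y \<delta> = (SOME x. norm x \<le> K * norm y \<and> norm (T x - y) < \<delta>)" for y \<delta>
  have X: "norm (X y \<delta>) \<le> K * norm y \<and> norm (T (X y \<delta>) - y) < \<delta>" if "\<delta> > 0" for y \<delta>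
    unfolding X_def by (rule someI_ex) (rule K(2)[OF that])
  have "norm x \<le> 2 * K * norm (T x)" for x
  proof (cases "T x = 0")
    case True
    then have "x = 0" using assms by (metis bij_is_inj blinfun.zero_right injD)
    then show ?thesis by simp
  next
    case False
    define y where "y = T x"
    define r where "r = rec_nat y (\<lambda>k r. r - T (X r (norm y / 2 ^ Suc k)))"
    define z where "z k = X (r k) (norm y / 2 ^ Suc k)" for k
    have r0: "r 0 = y" and rS: "r (Suc k) = r k - T (z k)" for k
      by (simp_all add: r_def z_def)
    have y: "norm y > 0" using False by (simp add: y_def)
    have rn: "norm (r k) \<le> norm y / 2 ^ k" for k
    proof (cases k)
      case (Suc j)
      then show ?thesis
        using X[of "norm y / 2 ^ Suc j" "r j"] y by (simp add: rS z_def norm_minus_commute)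
    qed (simp add: r0)
    have zn: "norm (z k) \<le> K * norm y * (1/2) ^ k" for k
    proof -
      have "norm (z k) \<le> K * norm (r k)"
        unfolding z_def using X[of "norm y / 2 ^ Suc k" "r k"] y by simp
      also have "\<dots> \<le> K * (norm y / 2 ^ k)" using rn K by (intro mult_left_mono) auto
      finally show ?thesis by (simp add: power_divide)
    qed
    have geo: "(\<lambda>k. K * norm y * (1/2) ^ k) sums (K * norm y * 2)"
      using geometric_sums[of "1/2::real"] by (intro sums_mult) simp
    have sz: "summable (\<lambda>k. norm (z k))"
      by (rule summable_comparison_test'[OF sums_summable[OF geo]]) (simp add: zn)
    have "(\<Sum>k<n. T (z k)) = y - r n" for n
      by (induction n) (simp_all add: r0 rS)
    moreover have "(\<lambda>n. y - r n) \<longlonglongrightarrow> y - 0"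
    proof (intro tendsto_diff tendsto_const)
      have "(\<lambda>k. norm y / 2 ^ k) \<longlonglongrightarrow> 0" by (rule LIMSEQ_divide_realpow_zero) simp
      then show "r \<longlonglongrightarrow> 0" by (rule Lim_null_comparison[rotated]) (simp add: rn)
    qed
    ultimately have "(\<lambda>k. T (z k)) sums y" by (simp add: sums_def)
    moreover have "(\<lambda>k. T (z k)) sums T (suminf z)"
      by (rule bounded_linear.sums[OF blinfun.bounded_linear_right summable_sums[OF summable_norm_cancel[OF sz]]])
    ultimately have "T (suminf z) = T x" by (metis sums_unique2 y_def)
    then have "x = suminf z" using assms by (metis bij_is_inj injD)
    then have "norm x \<le> (\<Sum>k. norm (z k))" using summable_norm[OF sz] by simp
    also have "\<dots> \<le> K * norm y * 2"
      using suminf_le[OF zn sz sums_summable[OF geo]] sums_unique[OF geo] by simp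
    finally show ?thesis by (simp add: y_def mult_ac)
  qed
  then show ?thesis by (rule op_invertibleI[OF assms])
qed

text \<open>Solving \<open>H x = y\<close> amounts to finding a fixed point of
  \<open>\<lambda>x. G y - G ((H - E) x)\<close>, a contraction with factor \<open>q\<close> on a
  complete space. The same estimate bounds \<open>norm x\<close> by a multiple of
  \<open>norm (H x)\<close>, which gives injectivity and a bounded inverse.\<close>

lemma op_invertible_near:
  fixes E H :: "'a::banach \<Rightarrow>\<^sub>L 'b::real_normed_vector"
  assumes "op_invertible E" and "norm (H - E) * norm (op_inverse E) < 1"
  shows "op_invertible H"
proof -
  define G where "G = op_inverse E"
  define q where "q = norm (H - E) * norm G"
  have q: "q < 1" "q \<ge> 0" using assms(2) by (simp_all add: q_def G_def)
  have bound: "norm (G ((H - E) x)) \<le> q * norm x" for x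
  proof -
    have "norm (G ((H - E) x)) \<le> norm G * (norm (H - E) * norm x)"
      by (intro order_trans[OF norm_blinfun] mult_left_mono norm_blinfun) auto
    then show ?thesis by (simp add: q_def mult_ac)
  qed
  have GH: "G (H x) = x + G ((H - E) x)" for x
    using op_inverse_apply(1)[OF assms(1)] by (simp add: G_def blinfun.diff_left blinfun.diff_right)
  have surj: "\<exists>x. H x = y" for y
  proof -
    have "\<exists>!x. G y - G ((H - E) x) = x"
    proof (rule banach_fix_type[OF q(2,1)], intro allI)
      show "dist (G y - G ((H - E) x)) (G y - G ((H - E) x')) \<le> q * dist x x'" for x x'
        using bound[of "x' - x"] by (simp add: dist_norm blinfun.diff_right norm_minus_commute)
    qed
    then obtain x where "G y - G ((H - E) x) = x" by blast
    then have "G (H x) = G y" using GH[of x] by (simp add: algebra_simps)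
    then have "H x = y" using op_inverse_apply(2)[OF assms(1)] by (metis G_def)
    then show ?thesis ..
  qed
  have lower: "norm x \<le> (norm G / (1 - q)) * norm (H x)" for x
  proof -
    have "norm x \<le> norm (G (H x)) + norm (G ((H - E) x))"
      using GH[of x] norm_triangle_ineq4[of "G (H x)" "G ((H - E) x)"] by simp
    also have "\<dots> \<le> norm G * norm (H x) + q * norm x"
      using norm_blinfun[of G "H x"] bound[of x] by simp
    finally show ?thesis using q by (simp add: field_simps)
  qed
  have "inj (blinfun_apply H)"
  proof (rule injI)
    fix x x' assume "H x = H x'"
    then have "norm (x - x') \<le> 0" using lower[of "x - x'"] by (simp add: blinfun.diff_right)
    then show "x = x'" by simp
  qed
  moreover have "surj (blinfun_apply H)" using surj by (metis surjI)
  ultimately have "bij (blinfun_apply H)" by (simp add: bij_def)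
  then show ?thesis using lower by (rule op_invertibleI)
qed

lemma eventually_op_invertible:
  fixes E :: "'t \<Rightarrow> 'a::banach \<Rightarrow>\<^sub>L 'b::real_normed_vector"
  assumes "(E \<longlongrightarrow> E0) F" and "op_invertible E0"
  shows "eventually (\<lambda>t. op_invertible (E t)) F"
proof -
  have "((\<lambda>t. norm (E t - E0) * norm (op_inverse E0)) \<longlongrightarrow> norm (E0 - E0) * norm (op_inverse E0)) F"
    by (intro tendsto_intros assms)
  then have "eventually (\<lambda>t. norm (E t - E0) * norm (op_inverse E0) < 1) F"
    by (rule order_tendstoD) simp
  then show ?thesis
    by eventually_elim (rule op_invertible_near[OF assms(2)])
qed

text \<open>The resolvent identity, from which both the continuity and the derivative of inversion
  are obtained.\<close>

lemma op_inverse_diff: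
  assumes "op_invertible E" and "op_invertible H"
  shows "op_inverse H - op_inverse E = - (op_inverse H o\<^sub>L (H - E) o\<^sub>L op_inverse E)"
  by (rule blinfun_eqI)
     (simp add: blinfun.diff_left blinfun.diff_right blinfun.minus_left op_inverse_apply[OF assms(1)] op_inverse_apply[OF assms(2)])

text \<open>The resolvent identity bounds the difference of the inverses by a multiple of
  \<open>norm H\<close>, which is not yet under control. Once the perturbation factor is below
  \<open>1/2\<close>, the same bound can be absorbed and yields
  \<open>norm H \<le> 2 * norm G\<close>.\<close>

lemma tendsto_op_inverse:
  fixes E :: "'t \<Rightarrow> 'a::banach \<Rightarrow>\<^sub>L 'b::real_normed_vector"
  assumes "(E \<longlongrightarrow> E0) F" and "op_invertible E0"
  shows "((\<lambda>t. op_inverse (E t)) \<longlongrightarrow> op_inverse E0) F"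
proof -
  define G where "G = op_inverse E0"
  have lim: "((\<lambda>t. norm (E t - E0) * norm G) \<longlongrightarrow> norm (E0 - E0) * norm G) F"
    by (intro tendsto_intros assms)
  have half: "eventually (\<lambda>t. norm (E t - E0) * norm G < 1/2) F"
    by (rule order_tendstoD(2)[OF lim]) simp
  have "eventually (\<lambda>t. norm (op_inverse (E t) - G) \<le> 2 * norm G * (norm (E t - E0) * norm G)) F"
    using half eventually_op_invertible[OF assms]
  proof eventually_elim
    case (elim t)
    define H where "H = op_inverse (E t)"
    define d where "d = norm (E t - E0) * norm G"
    have le: "norm (H - G) \<le> norm H * d"
    proof -
      have "norm (H - G) = norm (H o\<^sub>L (E t - E0) o\<^sub>L G)"
        using op_inverse_diff[OF assms(2) elim(2)] by (simp add: H_def G_def)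
      also have "\<dots> \<le> norm (H o\<^sub>L (E t - E0)) * norm G" by (rule norm_blinfun_compose)
      also have "\<dots> \<le> (norm H * norm (E t - E0)) * norm G"
        by (intro mult_right_mono norm_blinfun_compose) auto
      finally show ?thesis by (simp add: d_def mult.assoc)
    qed
    have "norm H \<le> norm G + norm (H - G)"
      using norm_triangle_ineq[of G "H - G"] by simp
    also have "\<dots> \<le> norm G + norm H * (1/2)"
      using le elim(1) mult_left_mono[of d "1/2" "norm H"] by (simp add: d_def)
    finally have "norm H \<le> 2 * norm G" by simp
    then have "norm H * d \<le> 2 * norm G * d"
      by (intro mult_right_mono) (auto simp: d_def)
    then show ?case using le by (simp add: H_def d_def)
  qed
  moreover
  have "((\<lambda>t. 2 * norm G * (norm (E t - E0) * norm G)) \<longlongrightarrow> 2 * norm G * (norm (E0 - E0) * norm G)) F"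
    by (intro tendsto_mult[OF tendsto_const] lim)
  then have "((\<lambda>t. 2 * norm G * (norm (E t - E0) * norm G)) \<longlongrightarrow> 0) F"
    by simp
  ultimately have "((\<lambda>t. op_inverse (E t) - G) \<longlongrightarrow> 0) F"
    by (rule Lim_null_comparison)
  then show ?thesis unfolding G_def by (rule LIM_zero_cancel)
qed

lemma cblinfun_op_inverse:
  assumes "op_invertible T" "T \<in> cblinfun"
  shows "op_inverse T \<in> cblinfun"
proof (rule cblinfunI)
  fix c x
  have "T (op_inverse T (c *\<^sub>C x)) = T (c *\<^sub>C op_inverse T x)"
    by (simp add: op_inverse_apply[OF assms(1)] cblinfun_scaleC[OF assms(2)])
  then show "op_inverse T (c *\<^sub>C x) = c *\<^sub>C op_inverse T x"
    by (metis op_inverse_apply(1)[OF assms(1)])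
qed

subsection \<open>Fredholm operators of index 0\<close>

lemma bounded_bilinear_scaleC:
  "bounded_bilinear (\<lambda>c (x :: 'a::complex_normed_vector). c *\<^sub>C x)"
proof
  have sc: "complex_of_real r *\<^sub>C (x :: 'a) = r *\<^sub>R x" for r x by (rule scaleC_of_real)
  show "(r *\<^sub>R c) *\<^sub>C x = r *\<^sub>R c *\<^sub>C x" for r c and x :: 'a
    by (simp only: scaleR_conv_of_real sc[symmetric] scaleC_scaleC)
  show "c *\<^sub>C r *\<^sub>R x = r *\<^sub>R c *\<^sub>C x" for r c and x :: 'a
    by (simp only: sc[symmetric] scaleC_scaleC mult.commute)
  show "\<exists>K. \<forall>c (x :: 'a). norm (c *\<^sub>C x) \<le> norm c * norm x * K"
    by (rule exI[of _ 1]) (simp add: norm_scaleC)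
qed (simp_all add: scaleC_add_left scaleC_add_right)

interpretation scaleC: bounded_bilinear "\<lambda>c (x :: 'a::complex_normed_vector). c *\<^sub>C x"
  by (rule bounded_bilinear_scaleC)

lemma scaleC_sum_left: "(\<Sum>i\<in>A. c i) *\<^sub>C x = (\<Sum>i\<in>A. c i *\<^sub>C x)"
  by (rule scaleC.sum_left)

lemma scaleC_sum_right: "c *\<^sub>C (\<Sum>i\<in>A. x i) = (\<Sum>i\<in>A. c *\<^sub>C x i)"
  by (rule scaleC.sum_right)

lemma cblinfun_0: "0 \<in> cblinfun"
  by (rule cblinfunI) simp

lemma cblinfun_add: "S \<in> cblinfun \<Longrightarrow> T \<in> cblinfun \<Longrightarrow> S + T \<in> cblinfun"
  by (rule cblinfunI) (simp add: blinfun.add_left cblinfun_scaleC scaleC_add_right)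

lemma cblinfun_diff: "S \<in> cblinfun \<Longrightarrow> T \<in> cblinfun \<Longrightarrow> S - T \<in> cblinfun"
  by (rule cblinfunI) (simp add: blinfun.diff_left cblinfun_scaleC scaleC.diff_right)

lemma cblinfun_scaleC_left: "T \<in> cblinfun \<Longrightarrow> c *\<^sub>C T \<in> cblinfun"
  by (rule cblinfunI) (simp add: scaleC_blinfun.rep_eq cblinfun_scaleC scaleC_scaleC mult.commute)

lemma cblinfun_sum: "(\<And>i. i \<in> A \<Longrightarrow> T i \<in> cblinfun) \<Longrightarrow> (\<Sum>i\<in>A. T i) \<in> cblinfun"
  by (induction A rule: infinite_finite_induct) (auto intro: cblinfun_add cblinfun_0)

lemma cblinfun_compose: "S \<in> cblinfun \<Longrightarrow> T \<in> cblinfun \<Longrightarrow> S o\<^sub>L T \<in> cblinfun"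
  by (rule cblinfunI) (simp add: cblinfun_scaleC)

lift_definition rank_one :: "('a::real_normed_vector \<Rightarrow>\<^sub>L complex) \<Rightarrow> 'b::complex_normed_vector \<Rightarrow> 'a \<Rightarrow>\<^sub>L 'b"
  is "\<lambda>f y x. f x *\<^sub>C y"
  by (rule bounded_linear_compose[OF scaleC.bounded_linear_left])

lemma cblinfun_rank_one: "f \<in> cblinfun \<Longrightarrow> rank_one f y \<in> cblinfun"
  by (rule cblinfunI) (simp add: rank_one.rep_eq cblinfun_scaleC scaleC_complex_def scaleC_scaleC)

text \<open>Biorthogonalisation by induction. \<open>w'\<close> is the part of the new vector
  invisible to the old functionals, and \<open>g\<close> is a functional not vanishing on it;
  \<open>h\<close> is \<open>g\<close> corrected to vanish on \<open>B\<close> and normalised to 1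
  at \<open>w\<close>. The old functionals are then corrected by multiples of \<open>h\<close> to
  vanish at \<open>w\<close>.\<close>

lemma dual_system:
  fixes B :: "'a::complex_normed_vector set"
  assumes "finite B" "complex_vector.independent B"
  obtains f :: "'a \<Rightarrow> 'a \<Rightarrow>\<^sub>L complex"
  where "\<And>b. b \<in> B \<Longrightarrow> f b \<in> cblinfun"
    and "\<And>b c. b \<in> B \<Longrightarrow> c \<in> B \<Longrightarrow> f b c = (if b = c then 1 else 0)"
proof -
  have "\<exists>f. \<forall>b\<in>B. (f b :: 'a \<Rightarrow>\<^sub>L complex) \<in> cblinfun \<and> (\<forall>c\<in>B. f b c = (if b = c then 1 else 0))"
    using assms
  proof (induction B rule: finite_induct)
    case (insert w B)
    then have "complex_vector.independent B" and w: "w \<notin> complex_vector.span B"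
      by (simp_all add: complex_vector.independent_insert)
    then obtain f :: "'a \<Rightarrow> 'a \<Rightarrow>\<^sub>L complex" where f: "\<And>b. b \<in> B \<Longrightarrow> f b \<in> cblinfun"
      "\<And>b c. b \<in> B \<Longrightarrow> c \<in> B \<Longrightarrow> f b c = (if b = c then 1 else 0)"
      using insert.IH by metis
    define w' where "w' = w - (\<Sum>b\<in>B. f b w *\<^sub>C b)"
    have "(\<Sum>b\<in>B. f b w *\<^sub>C b) \<in> complex_vector.span B"
      by (intro complex_vector.span_sum complex_vector.span_scale complex_vector.span_base)
    then have "w' \<noteq> 0" using w by (auto simp: w'_def)
    obtain g :: "'a \<Rightarrow>\<^sub>L complex" where g: "g \<in> cblinfun" "norm w' \<le> cmod (g w')"
      using complex_norming_functional by metis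
    have gw: "g w' \<noteq> 0" using g(2) \<open>w' \<noteq> 0\<close> by auto
    define h where "h = inverse (g w') *\<^sub>C (g - (\<Sum>b\<in>B. g b *\<^sub>C f b))"
    have h: "h \<in> cblinfun"
      unfolding h_def using f(1) g(1) by (intro cblinfun_scaleC_left cblinfun_diff cblinfun_sum)
    have hap: "h x = (g x - (\<Sum>b\<in>B. g b * f b x)) / g w'" for x
      by (simp add: h_def scaleC_blinfun.rep_eq blinfun.diff_left blinfun.sum_left scaleC_complex_def divide_inverse mult.commute)
    have hB: "h c = 0" if "c \<in> B" for c
    proof -
      have "(\<Sum>b\<in>B. g b * f b c) = (\<Sum>b\<in>B. if b = c then g b else 0)"
        by (rule sum.cong) (use that f(2) in auto)
      then show ?thesis using that insert.hyps(1) by (simp add: hap)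
    qed
    have "g w' = g w - (\<Sum>b\<in>B. g b * f b w)"
      by (simp add: w'_def blinfun.diff_right blinfun.sum_right cblinfun_scaleC[OF g(1)] scaleC_complex_def mult.commute)
    then have hw: "h w = 1" using gw by (simp add: hap)
    define f' where "f' = (\<lambda>b. if b = w then h else f b - f b w *\<^sub>C h)"
    have "f' b \<in> cblinfun" if "b \<in> insert w B" for b
      using that f(1) h by (auto simp: f'_def intro!: cblinfun_diff cblinfun_scaleC_left)
    moreover have "f' b c = (if b = c then 1 else 0)" if "b \<in> insert w B" "c \<in> insert w B" for b c
      using that insert.hyps(2) f(2) hB hw
      by (auto simp: f'_def blinfun.diff_left scaleC_blinfun.rep_eq scaleC_complex_def)
    ultimately show ?case by blast
  qed auto
  then show ?thesis using that by metis
qed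

text \<open>Index 0 means that a basis of the kernel and a minimal set spanning a complement of the
  range have equally many elements. Functionals dual to the kernel basis, paired with the complement
  vectors, map the kernel onto the complement. The resulting bijectivity is pure algebra;
  boundedness of the inverse comes from the bounded inverse theorem.\<close>

lemma fredholm_invertible_perturbation:
  fixes T :: "'a::complex_banach \<Rightarrow>\<^sub>L 'b::complex_banach"
  assumes T: "T \<in> cblinfun" and fr: "fredholm T" and ind: "fredholm_index T = 0"
  obtains n and f :: "nat \<Rightarrow> 'a \<Rightarrow>\<^sub>L complex" and y :: "nat \<Rightarrow> 'b"
  where "\<And>i. i < n \<Longrightarrow> f i \<in> cblinfun" "op_invertible (T + (\<Sum>i<n. rank_one (f i) (y i)))"
proof -
  define R where "R = range (blinfun_apply T)"
  have subR: "complex_vector.subspace R"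
  proof (rule complex_vector.subspaceI)
    show "0 \<in> R" unfolding R_def by (metis blinfun.zero_right rangeI)
    show "u + v \<in> R" if "u \<in> R" "v \<in> R" for u v
      using that unfolding R_def by (metis (mono_tags) blinfun.add_right imageE rangeI)
    show "c *\<^sub>C u \<in> R" if "u \<in> R" for c u
      using that unfolding R_def by (metis (mono_tags) cblinfun_scaleC[OF T] imageE rangeI)
  qed
  have spanR: "complex_vector.span R = R"
    using subR by (simp add: complex_vector.span_eq_iff)
  obtain B where B: "B \<subseteq> op_ker T" "complex_vector.independent B"
      "op_ker T \<subseteq> complex_vector.span B" "card B = complex_vector.dim (op_ker T)"
    by (rule complex_vector.basis_exists[of "op_ker T"])
  obtain B0 where B0: "finite B0" "op_ker T \<subseteq> complex_vector.span B0"
    using fr by (auto simp: fredholm_def finite_cdim_def)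
  have finB: "finite B"
    using complex_vector.independent_span_bound[OF B0(1) B(2)] B(1) B0(2) by blast
  define P where "P n \<longleftrightarrow> (\<exists>C. finite C \<and> card C = n \<and> complex_vector.span (R \<union> C) = UNIV)" for n
  have cc: "ccodim R = Least P" by (simp add: ccodim_def P_def[abs_def])
  have "\<exists>n. P n" using fr by (auto simp: fredholm_def finite_ccodim_def P_def R_def)
  then have "P (ccodim R)" unfolding cc by (metis LeastI)
  moreover have "ccodim R = card B"
    using ind B(4) by (simp add: fredholm_index_def R_def)
  ultimately obtain C where C: "finite C" "card C = card B" "complex_vector.span (R \<union> C) = UNIV"
    by (auto simp: P_def)
  \<comment> \<open>\<open>C\<close> is independent modulo \<open>R\<close> because its cardinality
    is the least possible one: a vector with a nonzero coefficient could be left out.\<close>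
  have indep: "a c = 0" if "(\<Sum>c\<in>C. a c *\<^sub>C c) \<in> R" "c \<in> C" for a c
  proof (rule ccontr)
    assume ac: "a c \<noteq> 0"
    define S where "S = complex_vector.span (R \<union> (C - {c}))"
    have RS: "R \<subseteq> S" "C - {c} \<subseteq> S" 
      using complex_vector.span_superset[of "R \<union> (C - {c})"] by (auto simp: S_def)
    have "(\<Sum>c\<in>C. a c *\<^sub>C c) = a c *\<^sub>C c + (\<Sum>c\<in>C - {c}. a c *\<^sub>C c)"
      using C(1) that(2) by (simp add: sum.remove)
    moreover have "(\<Sum>c\<in>C - {c}. a c *\<^sub>C c) \<in> S"
      unfolding S_def by (intro complex_vector.span_sum complex_vector.span_scale complex_vector.span_base) auto
    moreover have "(\<Sum>c\<in>C. a c *\<^sub>C c) \<in> S" using that(1) RS(1) by blast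
    ultimately have "a c *\<^sub>C c \<in> S"
      using complex_vector.span_diff[of "\<Sum>c\<in>C. a c *\<^sub>C c" "R \<union> (C - {c})" "\<Sum>c\<in>C - {c}. a c *\<^sub>C c"]
      by (simp add: S_def)
    then have "inverse (a c) *\<^sub>C (a c *\<^sub>C c) \<in> S"
      unfolding S_def by (rule complex_vector.span_scale)
    then have "c \<in> S" using ac by (simp add: scaleC_scaleC)
    then have "R \<union> C \<subseteq> S" using RS by blast
    then have "complex_vector.span (R \<union> C) \<subseteq> S"
      unfolding S_def by (intro complex_vector.span_minimal complex_vector.subspace_span)
    then have "complex_vector.span (R \<union> (C - {c})) = UNIV" using C(3) by (auto simp: S_def)
    then have "P (card (C - {c}))" unfolding P_def using C(1) by (intro exI[of _ "C - {c}"]) simp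
    then have "ccodim R \<le> card (C - {c})" unfolding cc by (rule Least_le)
    then show False using \<open>ccodim R = card B\<close> C(1,2) that(2) by (metis card_Diff1_less not_le)
  qed
  obtain h where h: "bij_betw h {..<card B} B"
    using finB by (metis bij_betw_from_nat_into_finite)
  obtain h' where h': "bij_betw h' {..<card B} C"
    using C(1,2) by (metis bij_betw_from_nat_into_finite)
  obtain F :: "'a \<Rightarrow> 'a \<Rightarrow>\<^sub>L complex" where F: "\<And>b. b \<in> B \<Longrightarrow> F b \<in> cblinfun"
      "\<And>b c. b \<in> B \<Longrightarrow> c \<in> B \<Longrightarrow> F b c = (if b = c then 1 else 0)"
    using dual_system[OF finB B(2)] by blast
  define n f where "n = card B" and "f i = F (h i)" for i
  have hB: "h i \<in> B" if "i < n" for i using h that by (auto simp: bij_betw_def n_def)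
  have fd: "f i (h j) = (if i = j then 1 else 0)" if "i < n" "j < n" for i j
    using that F(2)[OF hB hB] h by (auto simp: f_def bij_betw_def inj_on_def n_def)
  define H where "H = T + (\<Sum>i<n. rank_one (f i) (h' i))"
  have H: "H x = T x + (\<Sum>i<n. f i x *\<^sub>C h' i)" for x
    by (simp add: H_def blinfun.add_left blinfun.sum_left rank_one.rep_eq)
  have spanB: "\<exists>a. x = (\<Sum>i<n. a i *\<^sub>C h i)" if x: "x \<in> op_ker T" for x
  proof -
    obtain u where "x = (\<Sum>b\<in>B. u b *\<^sub>C b)"
      using B(3) x unfolding complex_vector.span_finite[OF finB] by blast
    also have "\<dots> = (\<Sum>i<n. u (h i) *\<^sub>C h i)"
      unfolding n_def by (rule sum.reindex_bij_betw[OF h, symmetric])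
    finally show ?thesis by (rule exI[of _ "\<lambda>i. u (h i)"])
  qed
  \<comment> \<open>If \<open>H x = 0\<close>, the added sum lies in the range of \<open>T\<close>,
    so independence modulo \<open>R\<close> kills every \<open>f i x\<close>. Then \<open>x\<close>
    lies in the kernel, where the \<open>f i\<close> are the coordinates.\<close>
  have "x = 0" if "H x = 0" for x
  proof -
    define g where "g = inv_into {..<n} h'"
    have g: "g (h' i) = i" if "i < n" for i
      unfolding g_def n_def using h' that by (simp add: bij_betw_def inv_into_f_f n_def)
    have "(\<Sum>i<n. f i x *\<^sub>C h' i) = (\<Sum>i<n. f (g (h' i)) x *\<^sub>C h' i)"
      by (rule sum.cong) (use g in auto)
    also have "\<dots> = (\<Sum>c\<in>C. f (g c) x *\<^sub>C c)"
      unfolding n_def by (rule sum.reindex_bij_betw[OF h'])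
    finally have eq: "(\<Sum>i<n. f i x *\<^sub>C h' i) = (\<Sum>c\<in>C. f (g c) x *\<^sub>C c)" .
    have "(\<Sum>i<n. f i x *\<^sub>C h' i) = T (- x)"
      using that unfolding H by (simp add: blinfun.minus_right eq_neg_iff_add_eq_0 add.commute)
    then have "(\<Sum>c\<in>C. f (g c) x *\<^sub>C c) \<in> R" unfolding eq R_def by simp
    then have "f (g c) x = 0" if "c \<in> C" for c using indep[of "\<lambda>c. f (g c) x", OF _ that] by simp
    then have fx: "f i x = 0" if "i < n" for i
      using that g[OF that] h' by (metis bij_betwE lessThan_iff n_def)
    then have "T x = 0" using that by (simp add: H)
    then obtain a where a: "x = (\<Sum>i<n. a i *\<^sub>C h i)" using spanB by (auto simp: op_ker_def)
    have "a j = 0" if "j < n" for j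
    proof -
      have "f j x = (\<Sum>i<n. a i * f j (h i))"
        using F(1) hB that by (simp add: a f_def blinfun.sum_right cblinfun_scaleC scaleC_complex_def)
      also have "\<dots> = (\<Sum>i<n. if i = j then a i else 0)"
        by (rule sum.cong) (use fd that in auto)
      finally show ?thesis using that fx by simp
    qed
    then show "x = 0" by (simp add: a)
  qed
  then have "inj (blinfun_apply H)"
    by (metis (no_types) blinfun.diff_right eq_iff_diff_eq_0 injI)
  moreover have "\<exists>x. H x = y" for y
  proof -
    have "y \<in> complex_vector.span (R \<union> C)" using C(3) by simp
    then obtain r s where "y = r + s" "r \<in> R" "s \<in> complex_vector.span C"
      unfolding complex_vector.span_Un spanR by auto
    then obtain z u where "y = T z + (\<Sum>c\<in>C. u c *\<^sub>C c)"
      by (auto simp: complex_vector.span_finite[OF C(1)] R_def)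
    also have "(\<Sum>c\<in>C. u c *\<^sub>C c) = (\<Sum>i<n. u (h' i) *\<^sub>C h' i)"
      unfolding n_def by (rule sum.reindex_bij_betw[OF h', symmetric])
    finally have y: "y = T z + (\<Sum>i<n. u (h' i) *\<^sub>C h' i)" .
    \<comment> \<open>The correction by kernel vectors leaves \<open>T z\<close> unchanged and moves
      the value of \<open>f j\<close> from \<open>f j z\<close> to the prescribed coefficient
      \<open>u (h' j)\<close>.\<close>
    define x where "x = z + (\<Sum>i<n. (u (h' i) - f i z) *\<^sub>C h i)"
    have "T (h i) = 0" if "i < n" for i using hB[OF that] B(1) by (auto simp: op_ker_def)
    then have "T x = T z"
      by (simp add: x_def blinfun.add_right blinfun.sum_right cblinfun_scaleC[OF T])
    moreover have "f j x = u (h' j)" if "j < n" for j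
    proof -
      have "f j x = f j z + (\<Sum>i<n. (u (h' i) - f i z) * f j (h i))"
        using F(1) hB that by (simp add: x_def f_def blinfun.add_right blinfun.sum_right cblinfun_scaleC scaleC_complex_def)
      also have "(\<Sum>i<n. (u (h' i) - f i z) * f j (h i)) = (\<Sum>i<n. if i = j then u (h' i) - f i z else 0)"
        by (rule sum.cong) (use fd that in auto)
      finally show ?thesis using that by simp
    qed
    ultimately have "H x = y" by (simp add: H y)
    then show ?thesis ..
  qed
  ultimately have "bij (blinfun_apply H)" by (metis bij_def surjI)
  then have "op_invertible H" by (rule bounded_inverse_theorem)
  then show ?thesis
    using that[of n f h'] F(1) hB by (simp add: H_def f_def)
qed

subsection \<open>Holomorphic functions with values in a Banach space\<close>

text \<open>In quotient form, limits can be taken through operator composition and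
  evaluation.\<close>

lemma has_cderiv_iff_quotient:
  fixes F :: "complex \<Rightarrow> 'a::complex_normed_vector"
  shows "(F has_derivative (\<lambda>h. h *\<^sub>C D)) (at z) \<longleftrightarrow>
    ((\<lambda>h. inverse h *\<^sub>C (F (z + h) - F z)) \<longlongrightarrow> D) (at 0)"
proof -
  have "(F has_derivative (\<lambda>h. h *\<^sub>C D)) (at z) \<longleftrightarrow>
      (\<lambda>h. norm (F (z + h) - F z - h *\<^sub>C D) / norm h) \<midarrow>0\<rightarrow> 0"
    by (simp add: has_derivative_at scaleC.bounded_linear_left)
  also have "\<dots> \<longleftrightarrow> (\<lambda>h. norm (inverse h *\<^sub>C (F (z + h) - F z) - D)) \<midarrow>0\<rightarrow> 0"
  proof (rule Lim_cong_within)
    fix h :: complex assume "h \<noteq> 0"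
    then have "inverse h *\<^sub>C (F (z + h) - F z) - D = inverse h *\<^sub>C (F (z + h) - F z - h *\<^sub>C D)"
      by (simp add: scaleC.diff_right)
    then show "norm (F (z + h) - F z - h *\<^sub>C D) / norm h = norm (inverse h *\<^sub>C (F (z + h) - F z) - D)"
      by (simp add: norm_scaleC norm_inverse divide_inverse mult.commute)
  qed auto
  also have "\<dots> \<longleftrightarrow> ((\<lambda>h. inverse h *\<^sub>C (F (z + h) - F z)) \<longlongrightarrow> D) (at 0)"
    by (simp only: tendsto_norm_zero_iff LIM_zero_iff)
  finally show ?thesis .
qed

lemma cderiv_unique:
  assumes "(F has_derivative (\<lambda>h. h *\<^sub>C D)) (at z)"
  shows "cderiv F z = D"
  unfolding cderiv_def
proof (rule the_equality)
  fix D' assume "(F has_derivative (\<lambda>h. h *\<^sub>C D')) (at z)"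
  then have "(\<lambda>h. h *\<^sub>C D') = (\<lambda>h. h *\<^sub>C D)" by (rule has_derivative_unique[OF _ assms])
  then have "1 *\<^sub>C D' = 1 *\<^sub>C D" by (rule fun_cong)
  then show "D' = D" by simp
qed (rule assms)

text \<open>The derivative is the one in the full plane even if \<open>U\<close> is not open, so
  that restriction to a subset never changes \<open>cderiv\<close>.\<close>

definition vector_holomorphic_on ::
    "(complex \<Rightarrow> 'a::complex_normed_vector) \<Rightarrow> complex set \<Rightarrow> bool" where
  "vector_holomorphic_on F U \<longleftrightarrow> (\<forall>z\<in>U. (F has_derivative (\<lambda>h. h *\<^sub>C cderiv F z)) (at z))"

lemma vector_holomorphic_onI:
  "(\<And>z. z \<in> U \<Longrightarrow> \<exists>D. (F has_derivative (\<lambda>h. h *\<^sub>C D)) (at z)) \<Longrightarrow> vector_holomorphic_on F U"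
  unfolding vector_holomorphic_on_def using cderiv_unique by metis

lemma vector_holomorphic_on_subset:
  "vector_holomorphic_on F U \<Longrightarrow> V \<subseteq> U \<Longrightarrow> vector_holomorphic_on F V"
  by (auto simp: vector_holomorphic_on_def)

lemma vector_holomorphic_on_imp_continuous_on:
  "vector_holomorphic_on F U \<Longrightarrow> continuous_on U F"
  by (intro continuous_at_imp_continuous_on)
     (auto simp: vector_holomorphic_on_def dest: has_derivative_continuous)

text \<open>\<open>L\<close> is a function rather than a \<open>blinfun\<close> because it stands
  both for functionals on vectors and for matrix elements of operators, which send \<open>S\<close>
  to \<open>f (S x)\<close>.\<close>

lemma has_field_derivative_functional:
  assumes F: "(F has_derivative (\<lambda>h. h *\<^sub>C D)) (at z)"
    and L: "bounded_linear L" "\<And>c x. L (c *\<^sub>C x) = c * L x"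
  shows "((\<lambda>w. L (F w)) has_field_derivative L D) (at z)"
  using bounded_linear.has_derivative[OF L(1) F]
  by (simp add: has_field_derivative_def L(2) mult_commute_abs)

lemma vector_holomorphic_on_functional:
  assumes "vector_holomorphic_on F U" "bounded_linear L" "\<And>c x. L (c *\<^sub>C x) = c * L x"
  shows "(\<lambda>w. L (F w)) holomorphic_on U"
  unfolding holomorphic_on_def field_differentiable_def
proof
  fix z assume "z \<in> U"
  then have "((\<lambda>w. L (F w)) has_field_derivative L (cderiv F z)) (at z)"
    using assms(1) by (intro has_field_derivative_functional assms(2,3)) (simp add: vector_holomorphic_on_def)
  then show "\<exists>D. ((\<lambda>w. L (F w)) has_field_derivative D) (at z within U)"
    by (blast intro: has_field_derivative_at_within)
qed

lemma cblinfun_scale_mult: "L \<in> cblinfun \<Longrightarrow> blinfun_apply L (c *\<^sub>C x) = c * blinfun_apply L x"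
  by (simp add: cblinfun_scaleC scaleC_complex_def)

lemma vector_holomorphic_on_cblinfun:
  "vector_holomorphic_on F U \<Longrightarrow> L \<in> cblinfun \<Longrightarrow> (\<lambda>w. blinfun_apply L (F w)) holomorphic_on U"
  by (rule vector_holomorphic_on_functional[OF _ blinfun.bounded_linear_right cblinfun_scale_mult])

lemma vec_contour_integral_functional:
  fixes F :: "complex \<Rightarrow> 'a::complex_banach"
  assumes F: "continuous_on (path_image (circlepath c r)) F"
    and L: "bounded_linear L" "\<And>c x. L (c *\<^sub>C x) = c * L x"
  shows "L (vec_contour_integral (circlepath c r) F) = contour_integral (circlepath c r) (\<lambda>z. L (F z))"
proof -
  let ?h = "\<lambda>t. vector_derivative (circlepath c r) (at t) *\<^sub>C F (circlepath c r t)"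
  have "continuous_on {0..1} (\<lambda>t. F (circlepath c r t))"
    using F unfolding path_image_def
    by (rule continuous_on_compose2) (auto simp: circlepath_def part_circlepath_def linepath_def intro!: continuous_intros)
  moreover have "continuous_on {0..1} (\<lambda>t. vector_derivative (circlepath c r) (at t))"
    unfolding vector_derivative_circlepath by (intro continuous_intros)
  ultimately have "continuous_on {0..1} ?h"
    by (rule scaleC.continuous_on[rotated])
  then have "?h integrable_on {0..1}"
    by (rule integrable_continuous_real)
  then have "L (integral {0..1} ?h) = integral {0..1} (L \<circ> ?h)"
    by (rule integral_linear[OF _ L(1), symmetric])
  then show ?thesis
    by (simp add: vec_contour_integral_def contour_integral_integral o_def L(2) mult.commute)
qed

text \<open>The bound depends on \<open>g\<close> only through \<open>B\<close>, so it holds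
  uniformly for all functionals of a bounded set composed with one vector-valued function. A disc of
  radius \<open>R/4\<close> about a point of \<open>cball z (R/4)\<close> stays in
  \<open>cball z (R/2)\<close>, where \<open>B\<close> is available for Cauchy's inequality. The
  order \<open>p\<close> allows the same bound to be used for derivatives.\<close>

lemma deriv_Taylor_bound:
  fixes g :: "complex \<Rightarrow> complex"
  assumes g: "g holomorphic_on ball z R" and R: "R > 0"
    and B: "\<And>w. w \<in> cball z (R/2) \<Longrightarrow> cmod (g w) \<le> B" and w: "w \<in> cball z (R/4)"
  shows "cmod ((deriv ^^ p) g w - (\<Sum>i<N. (deriv ^^ (p + i)) g z * (w - z) ^ i / fact i))
     \<le> fact (p + N) * B / (R/4) ^ (p + N) * cmod (w - z) ^ N"
proof -
  have Cau: "cmod ((deriv ^^ m) g x) \<le> fact m * B / (R/4) ^ m" if "x \<in> cball z (R/4)" for x m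
  proof (rule Cauchy_inequality)
    have "cball x (R/4) \<subseteq> cball z (R/2)"
    proof
      fix y assume "y \<in> cball x (R/4)"
      then show "y \<in> cball z (R/2)" using that dist_triangle[of z y x] by simp
    qed
    then have sub: "cball x (R/4) \<subseteq> ball z R" and sub': "cball x (R/4) \<subseteq> cball z (R/2)"
      using R by auto
    show "g holomorphic_on ball x (R/4)" 
      using g sub by (meson ball_subset_cball holomorphic_on_subset subset_trans)
    show "continuous_on (cball x (R/4)) g"
      using g sub by (meson holomorphic_on_imp_continuous_on holomorphic_on_subset)
    show "cmod (g y) \<le> B" if "cmod (x - y) = R/4" for y
      using sub' that by (intro B) (auto simp: dist_norm)
  qed (use R in auto)
  show ?thesis
  proof (cases N)
    case 0
    then show ?thesis using Cau[OF w, of p] by simp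
  next
    case (Suc n)
    have "cmod ((deriv ^^ (p + 0)) g w - (\<Sum>i\<le>n. (deriv ^^ (p + i)) g z * (w - z) ^ i / fact i))
        \<le> (fact (p + N) * B / (R/4) ^ (p + N)) * cmod (w - z) ^ Suc n / fact n"
    proof (rule complex_Taylor)
      show "((deriv ^^ (p + i)) g has_field_derivative (deriv ^^ (p + Suc i)) g x) (at x within cball z (R/4))"
        if "x \<in> cball z (R/4)" for i x
      proof -
        have "(deriv ^^ (p + i)) g holomorphic_on ball z R"
          by (intro holomorphic_higher_deriv g) auto
        moreover have "x \<in> ball z R" using that R by auto
        ultimately show ?thesis
          using holomorphic_derivI[of "(deriv ^^ (p + i)) g" "ball z R" x]
          by (auto intro: has_field_derivative_at_within)
      qed
      show "cmod ((deriv ^^ (p + Suc n)) g x) \<le> fact (p + N) * B / (R/4) ^ (p + N)"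
        if "x \<in> cball z (R/4)" for x
        using Cau[OF that, of "p + N"] Suc by simp
    qed (use w R in auto)
    also have "\<dots> \<le> (fact (p + N) * B / (R/4) ^ (p + N)) * cmod (w - z) ^ N"
    proof -
      have "cmod (g z) \<le> B" using R by (intro B) auto
      then have "0 \<le> B" using norm_ge_zero[of "g z"] by linarith
      then have "0 \<le> (fact (p + N) * B / (R/4) ^ (p + N)) * cmod (w - z) ^ N" using R by simp
      moreover have "x / fact n \<le> x" if "0 \<le> x" for x :: real
        using that fact_ge_1[of n, where ?'a = real] by (simp add: divide_le_eq mult_le_cancel_left1)
      ultimately show ?thesis unfolding Suc by blast
    qed
    finally show ?thesis by (simp add: Suc lessThan_Suc_atMost)
  qed
qed

text \<open>Cauchy's integral formula with vector values supplies one vector \<open>a m\<close> that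
  serves all functionals at once, which is what turns the scalar Taylor coefficients into a
  vector-valued one.\<close>

lemma vector_Taylor_coefficients:
  fixes F :: "complex \<Rightarrow> 'a::complex_banach"
  assumes F: "vector_holomorphic_on F (ball z R)" and R: "R > 0"
  obtains a :: "nat \<Rightarrow> 'a" where "\<And>L m. L \<in> cblinfun \<Longrightarrow> (deriv ^^ m) (\<lambda>w. blinfun_apply L (F w)) z = fact m * blinfun_apply L (a m)"
proof
  define I where "I m = vec_contour_integral (circlepath z (R/2)) (\<lambda>u. (1 / (u - z) ^ Suc m) *\<^sub>C F u)" for m
  define a where "a m = (1 / (2 * pi * \<i>)) *\<^sub>C I m" for m
  fix L :: "'a \<Rightarrow>\<^sub>L complex" and m assume L: "L \<in> cblinfun"
  have sub: "cball z (R/2) \<subseteq> ball z R" using R by auto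
  have hol: "(\<lambda>w. blinfun_apply L (F w)) holomorphic_on ball z R"
    by (rule vector_holomorphic_on_cblinfun[OF F L])
  have cont: "continuous_on (path_image (circlepath z (R/2))) (\<lambda>u. (1 / (u - z) ^ Suc m) *\<^sub>C F u)"
  proof (intro scaleC.continuous_on continuous_intros)
    show "continuous_on (path_image (circlepath z (R/2))) F"
      using vector_holomorphic_on_imp_continuous_on[OF F] sub R
      by (rule_tac continuous_on_subset) (auto simp: sphere_def)
  qed (use R in \<open>auto simp: sphere_def\<close>)
  have "blinfun_apply L (I m) = contour_integral (circlepath z (R/2)) (\<lambda>u. blinfun_apply L ((1 / (u - z) ^ Suc m) *\<^sub>C F u))"
    unfolding I_def by (rule vec_contour_integral_functional[OF cont blinfun.bounded_linear_right cblinfun_scale_mult[OF L]])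
  also have "\<dots> = contour_integral (circlepath z (R/2)) (\<lambda>u. blinfun_apply L (F u) / (u - z) ^ Suc m)"
    by (simp add: cblinfun_scale_mult[OF L])
  finally have "blinfun_apply L (I m) = \<dots>" .
  moreover have "(deriv ^^ m) (\<lambda>w. blinfun_apply L (F w)) z = (fact m) / (2 * pi * \<i>) * contour_integral (circlepath z (R/2)) (\<lambda>u. blinfun_apply L (F u) / (u - z) ^ Suc m)"
  proof (rule Cauchy_higher_derivative_integral_circlepath(2))
    show "continuous_on (cball z (R/2)) (\<lambda>w. blinfun_apply L (F w))"
      using hol sub by (meson holomorphic_on_imp_continuous_on holomorphic_on_subset)
    show "(\<lambda>w. blinfun_apply L (F w)) holomorphic_on ball z (R/2)"
      using hol by (rule holomorphic_on_subset) (use R in auto)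
  qed (use R in auto)
  ultimately show "(deriv ^^ m) (\<lambda>w. blinfun_apply L (F w)) z = fact m * blinfun_apply L (a m)"
    by (simp add: a_def cblinfun_scale_mult[OF L])
qed

text \<open>The normalisation by 2 is that of \<open>complex_norming_functional\<close>; one bound
  \<open>B\<close> covers all functionals so normalised.\<close>

lemma functional_bound:
  fixes F :: "complex \<Rightarrow> 'a::complex_banach"
  assumes F: "vector_holomorphic_on F (ball z R)" and R: "R > 0"
  obtains B where "\<And>L w. (\<And>x. cmod (blinfun_apply L x) \<le> 2 * norm x) \<Longrightarrow> w \<in> cball z (R/2) \<Longrightarrow> cmod (blinfun_apply L (F w)) \<le> B"
proof -
  have "continuous_on (cball z (R/2)) F"
    using vector_holomorphic_on_imp_continuous_on[OF F] by (rule continuous_on_subset) (use R in auto)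
  then have "compact (F ` cball z (R/2))" by (intro compact_continuous_image compact_cball)
  then obtain M where "\<And>w. w \<in> cball z (R/2) \<Longrightarrow> norm (F w) \<le> M"
    by (meson bounded_iff compact_imp_bounded imageI)
  then show ?thesis by (intro that[of "2 * M"]) (meson mult_left_mono order_trans zero_le_numeral)
qed

text \<open>The functional is chosen to norm the remainder at the given \<open>w\<close>. It varies
  with \<open>w\<close>, but the scalar bound is the same for all of them, so the constant
  \<open>C\<close> does not.\<close>

lemma vector_Taylor:
  fixes F :: "complex \<Rightarrow> 'a::complex_banach"
  assumes F: "vector_holomorphic_on F U" "open U" "z \<in> U"
  obtains a and C r :: real where "r > 0" "ball z r \<subseteq> U"
    "\<And>w. w \<in> ball z r \<Longrightarrow> norm (F w - (\<Sum>m<N. (w - z) ^ m *\<^sub>C a m)) \<le> C * cmod (w - z) ^ N"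
proof -
  obtain R where R: "R > 0" "ball z R \<subseteq> U" using F(2,3) open_contains_ball by blast
  have FR: "vector_holomorphic_on F (ball z R)" by (rule vector_holomorphic_on_subset[OF F(1) R(2)])
  obtain a :: "nat \<Rightarrow> 'a" where a: "\<And>L m. L \<in> cblinfun \<Longrightarrow> (deriv ^^ m) (\<lambda>w. blinfun_apply L (F w)) z = fact m * blinfun_apply L (a m)"
    using vector_Taylor_coefficients[OF FR R(1)] by blast
  obtain B where B: "\<And>L w. (\<And>x. cmod (blinfun_apply L x) \<le> 2 * norm x) \<Longrightarrow> w \<in> cball z (R/2) \<Longrightarrow> cmod (blinfun_apply L (F w)) \<le> B"
    using functional_bound[OF FR R(1)] by blast
  show ?thesis
  proof (rule that[of "R/4"])
    show "ball z (R/4) \<subseteq> U" using R by (auto simp: subset_iff)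
    fix w assume w: "w \<in> ball z (R/4)"
    define v where "v = F w - (\<Sum>m<N. (w - z) ^ m *\<^sub>C a m)"
    obtain L :: "'a \<Rightarrow>\<^sub>L complex" where L: "L \<in> cblinfun" "\<And>x. cmod (blinfun_apply L x) \<le> 2 * norm x" "norm v \<le> cmod (blinfun_apply L v)"
      using complex_norming_functional by blast
    have "blinfun_apply L v = (deriv ^^ 0) (\<lambda>w. blinfun_apply L (F w)) w - (\<Sum>i<N. (deriv ^^ (0 + i)) (\<lambda>w. blinfun_apply L (F w)) z * (w - z) ^ i / fact i)"
      by (simp add: v_def blinfun.diff_right blinfun.sum_right cblinfun_scale_mult[OF L(1)] a[OF L(1)] mult.commute)
    also have "cmod \<dots> \<le> fact (0 + N) * B / (R/4) ^ (0 + N) * cmod (w - z) ^ N"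
      by (rule deriv_Taylor_bound[OF vector_holomorphic_on_cblinfun[OF FR L(1)] R(1) B[OF L(2)]]) (use w in auto)
    finally show "norm (F w - (\<Sum>m<N. (w - z) ^ m *\<^sub>C a m)) \<le> fact (0 + N) * B / (R/4) ^ (0 + N) * cmod (w - z) ^ N"
      using L(3) unfolding v_def by (rule order_trans[rotated])
  qed (use R in auto)
qed

lemma has_cderiv_quadratic:
  fixes G :: "complex \<Rightarrow> 'a::complex_normed_vector"
  assumes "r > 0" "\<And>w. w \<in> ball z r \<Longrightarrow> norm (G w - G z - (w - z) *\<^sub>C D) \<le> C * cmod (w - z) ^ 2"
  shows "(G has_derivative (\<lambda>h. h *\<^sub>C D)) (at z)"
  unfolding has_derivative_at
proof (intro conjI scaleC.bounded_linear_left)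
  have "((\<lambda>h. C * cmod h) \<longlongrightarrow> C * cmod 0) (at 0)" by (intro tendsto_intros)
  then have 1: "((\<lambda>h. C * cmod h) \<longlongrightarrow> 0) (at 0)" by simp
  have "eventually (\<lambda>h::complex. h \<in> ball 0 r - {0}) (at 0)"
    using assms(1) by (intro eventually_at_in_open) auto
  then have "eventually (\<lambda>h. norm (norm (G (z + h) - G z - h *\<^sub>C D) / norm h) \<le> C * cmod h) (at 0)"
  proof eventually_elim
    case (elim h)
    then have "norm (G (z + h) - G z - h *\<^sub>C D) \<le> C * cmod h ^ 2"
      using assms(2)[of "z + h"] by (simp add: dist_norm)
    then show ?case using elim by (simp add: field_simps power2_eq_square)
  qed
  then show "(\<lambda>h. norm (G (z + h) - G z - h *\<^sub>C D) / norm h) \<midarrow>0\<rightarrow> 0"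
    using 1 by (rule Lim_null_comparison)
qed

text \<open>The scalar bound with \<open>p = 1\<close> and \<open>N = 2\<close> shows that
  \<open>cderiv F\<close> differs from its linear approximation by a quadratic error; the slope is
  twice the second Taylor coefficient.\<close>

lemma vector_holomorphic_on_cderiv:
  fixes F :: "complex \<Rightarrow> 'a::complex_banach"
  assumes F: "vector_holomorphic_on F U" "open U"
  shows "vector_holomorphic_on (cderiv F) U"
proof (rule vector_holomorphic_onI)
  fix z assume "z \<in> U"
  then obtain R where R: "R > 0" "ball z R \<subseteq> U" using F(2) open_contains_ball by blast
  have FR: "vector_holomorphic_on F (ball z R)" by (rule vector_holomorphic_on_subset[OF F(1) R(2)])
  obtain a :: "nat \<Rightarrow> 'a" where a: "\<And>L m. L \<in> cblinfun \<Longrightarrow> (deriv ^^ m) (\<lambda>w. blinfun_apply L (F w)) z = fact m * blinfun_apply L (a m)"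
    using vector_Taylor_coefficients[OF FR R(1)] by blast
  obtain B where B: "\<And>L w. (\<And>x. cmod (blinfun_apply L x) \<le> 2 * norm x) \<Longrightarrow> w \<in> cball z (R/2) \<Longrightarrow> cmod (blinfun_apply L (F w)) \<le> B"
    using functional_bound[OF FR R(1)] by blast
  have "(cderiv F has_derivative (\<lambda>h. h *\<^sub>C (2 *\<^sub>C a 2))) (at z)"
  proof (rule has_cderiv_quadratic)
    fix w assume w: "w \<in> ball z (R/4)"
    define v where "v = cderiv F w - cderiv F z - (w - z) *\<^sub>C 2 *\<^sub>C a 2"
    obtain L :: "'a \<Rightarrow>\<^sub>L complex" where L: "L \<in> cblinfun" "\<And>x. cmod (blinfun_apply L x) \<le> 2 * norm x" "norm v \<le> cmod (blinfun_apply L v)"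
      using complex_norming_functional by blast
    have der: "deriv (\<lambda>w. blinfun_apply L (F w)) x = blinfun_apply L (cderiv F x)" if "x \<in> ball z R" for x
      by (intro DERIV_imp_deriv has_field_derivative_functional blinfun.bounded_linear_right cblinfun_scale_mult[OF L(1)])
         (use FR that in \<open>auto simp: vector_holomorphic_on_def\<close>)
    have "w \<in> ball z R" using w R by auto
    then have "blinfun_apply L v = (deriv ^^ 1) (\<lambda>w. blinfun_apply L (F w)) w - (\<Sum>i<2. (deriv ^^ (1 + i)) (\<lambda>w. blinfun_apply L (F w)) z * (w - z) ^ i / fact i)"
      using R a[OF L(1), of 2]
      by (simp add: v_def blinfun.diff_right cblinfun_scale_mult[OF L(1)] der numeral_2_eq_2 mult_ac)
    also have "cmod \<dots> \<le> fact (1 + 2) * B / (R/4) ^ (1 + 2) * cmod (w - z) ^ 2"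
      by (rule deriv_Taylor_bound[OF vector_holomorphic_on_cblinfun[OF FR L(1)] R(1) B[OF L(2)]]) (use w in auto)
    finally show "norm (cderiv F w - cderiv F z - (w - z) *\<^sub>C 2 *\<^sub>C a 2) \<le> fact (1 + 2) * B / (R/4) ^ (1 + 2) * cmod (w - z) ^ 2"
      using L(3) unfolding v_def by (rule order_trans[rotated])
  qed (use R in auto)
  then show "\<exists>D. (cderiv F has_derivative (\<lambda>h. h *\<^sub>C D)) (at z)" ..
qed

section \<open>Derivatives of products and inverses of operator families\<close>

lemma scaleC_compose_left: "(c *\<^sub>C S) o\<^sub>L T = c *\<^sub>C (S o\<^sub>L T)"
  by (rule blinfun_eqI) (simp add: scaleC_blinfun.rep_eq)

lemma scaleC_compose_right: "S \<in> cblinfun \<Longrightarrow> S o\<^sub>L (c *\<^sub>C T) = c *\<^sub>C (S o\<^sub>L T)"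
  by (rule blinfun_eqI) (simp add: scaleC_blinfun.rep_eq cblinfun_scaleC)

lemma has_cderiv_compose:
  fixes A :: "complex \<Rightarrow> 'b::complex_normed_vector \<Rightarrow>\<^sub>L 'c::complex_normed_vector"
  assumes "(A has_derivative (\<lambda>h. h *\<^sub>C A')) (at z)" "(B has_derivative (\<lambda>h. h *\<^sub>C B')) (at z)" "A z \<in> cblinfun"
  shows "((\<lambda>w. A w o\<^sub>L B w) has_derivative (\<lambda>h. h *\<^sub>C ((A z o\<^sub>L B') + (A' o\<^sub>L B z)))) (at z)"
  using bounded_bilinear.FDERIV[OF bounded_bilinear_blinfun_compose assms(1,2)]
  by (simp add: scaleC_compose_left scaleC_compose_right[OF assms(3)] scaleC_add_right)

lemma vector_holomorphic_on_compose:
  fixes A :: "complex \<Rightarrow> 'b::complex_normed_vector \<Rightarrow>\<^sub>L 'c::complex_normed_vector"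
  assumes "vector_holomorphic_on A U" "vector_holomorphic_on B U" "\<And>z. z \<in> U \<Longrightarrow> A z \<in> cblinfun"
  shows "vector_holomorphic_on (\<lambda>w. A w o\<^sub>L B w) U"
proof (rule vector_holomorphic_onI)
  fix z assume "z \<in> U"
  then show "\<exists>D. ((\<lambda>w. A w o\<^sub>L B w) has_derivative (\<lambda>h. h *\<^sub>C D)) (at z)"
    using has_cderiv_compose assms unfolding vector_holomorphic_on_def by blast
qed

text \<open>Elements of \<open>blinfun\<close> are only real-linear. Complex linearity of
  \<open>E\<close> near \<open>z\<close> is what allows the scalar \<open>inverse h\<close> to be
  moved past \<open>op_inverse (E (z + h))\<close> in the resolvent identity.\<close>

lemma has_cderiv_op_inverse:
  fixes E :: "complex \<Rightarrow> 'a::complex_banach \<Rightarrow>\<^sub>L 'b::complex_normed_vector"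
  assumes E: "(E has_derivative (\<lambda>h. h *\<^sub>C E')) (at z)" "op_invertible (E z)"
    and lin: "eventually (\<lambda>w. E w \<in> cblinfun) (nhds z)"
  defines "G \<equiv> \<lambda>w. op_inverse (E w)"
  shows "(G has_derivative (\<lambda>h. h *\<^sub>C (- (G z o\<^sub>L E' o\<^sub>L G z)))) (at z)"
  unfolding has_cderiv_iff_quotient
proof -
  have sh: "filtermap (\<lambda>h. z + h) (at 0) = at z"
    using at_to_0[of z] by (simp add: add.commute)
  have "isCont E z" using E(1) by (rule has_derivative_continuous)
  then have Elim: "((\<lambda>h. E (z + h)) \<longlongrightarrow> E z) (at 0)"
    by (simp add: isCont_iff)
  have lin': "eventually (\<lambda>h. E (z + h) \<in> cblinfun) (at 0)"
    using lin by (simp add: eventually_nhds_conv_at eventually_filtermap flip: sh)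
  have quot: "((\<lambda>h. inverse h *\<^sub>C (E (z + h) - E z)) \<longlongrightarrow> E') (at 0)"
    using E(1) unfolding has_cderiv_iff_quotient .
  have Glim: "((\<lambda>h. G (z + h)) \<longlongrightarrow> G z) (at 0)"
    unfolding G_def by (rule tendsto_op_inverse[OF Elim E(2)])
  have "((\<lambda>h. - (G (z + h) o\<^sub>L (inverse h *\<^sub>C (E (z + h) - E z)) o\<^sub>L G z)) \<longlongrightarrow> - (G z o\<^sub>L E' o\<^sub>L G z)) (at 0)"
    by (intro tendsto_minus bounded_bilinear.tendsto[OF bounded_bilinear_blinfun_compose] Glim quot tendsto_const)
  moreover have "eventually (\<lambda>h. - (G (z + h) o\<^sub>L (inverse h *\<^sub>C (E (z + h) - E z)) o\<^sub>L G z) =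
      inverse h *\<^sub>C (G (z + h) - G z)) (at 0)"
    using lin' eventually_op_invertible[OF Elim E(2)]
  proof eventually_elim
    case (elim h)
    have "G (z + h) \<in> cblinfun" unfolding G_def by (rule cblinfun_op_inverse[OF elim(2,1)])
    then show ?case
      using op_inverse_diff[OF E(2) elim(2)]
      by (simp add: G_def scaleC_compose_right scaleC_compose_left scaleC.minus_right)
  qed
  ultimately show "((\<lambda>h. inverse h *\<^sub>C (G (z + h) - G z)) \<longlongrightarrow> - (G z o\<^sub>L E' o\<^sub>L G z)) (at 0)"
    by (rule Lim_transform_eventually)
qed

lemma vector_holomorphic_on_op_inverse:
  fixes E :: "complex \<Rightarrow> 'a::complex_banach \<Rightarrow>\<^sub>L 'b::complex_normed_vector"
  assumes "vector_holomorphic_on E U" "open U" "\<And>z. z \<in> U \<Longrightarrow> E z \<in> cblinfun" "\<And>z. z \<in> U \<Longrightarrow> op_invertible (E z)"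
  shows "vector_holomorphic_on (\<lambda>w. op_inverse (E w)) U"
    and "\<And>z. z \<in> U \<Longrightarrow> cderiv (\<lambda>w. op_inverse (E w)) z = - (op_inverse (E z) o\<^sub>L cderiv E z o\<^sub>L op_inverse (E z))"
proof -
  have *: "((\<lambda>w. op_inverse (E w)) has_derivative (\<lambda>h. h *\<^sub>C (- (op_inverse (E z) o\<^sub>L cderiv E z o\<^sub>L op_inverse (E z))))) (at z)"
    if z: "z \<in> U" for z
  proof (rule has_cderiv_op_inverse)
    show "eventually (\<lambda>w. E w \<in> cblinfun) (nhds z)"
      using eventually_nhds_in_open[OF assms(2) z] by eventually_elim (rule assms(3))
  qed (use assms z in \<open>auto simp: vector_holomorphic_on_def\<close>)
  show "vector_holomorphic_on (\<lambda>w. op_inverse (E w)) U"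
    by (rule vector_holomorphic_onI) (use * in blast)
  show "cderiv (\<lambda>w. op_inverse (E w)) z = - (op_inverse (E z) o\<^sub>L cderiv E z o\<^sub>L op_inverse (E z))" if "z \<in> U" for z
    by (rule cderiv_unique[OF *[OF that]])
qed

subsection \<open>Traces and determinants\<close>

text \<open>Frees the trace from the basis chosen by \<open>SOME\<close>: it can be read off any
  representation as a finite sum of rank one maps. The coefficients are asked only to be linear, so
  that continuity of the residue functionals never has to be established.\<close>

lemma op_trace_eq_sum:
  fixes T :: "'a::complex_normed_vector \<Rightarrow>\<^sub>L 'a"
  assumes fin: "finite I"
    and T: "\<And>x. T x = (\<Sum>i\<in>I. \<phi> i x *\<^sub>C v i)"
    and lin: "\<And>i. i \<in> I \<Longrightarrow> Vector_Spaces.linear (*\<^sub>C) (*\<^sub>C) (\<phi> i)"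
  shows "op_trace T = (\<Sum>i\<in>I. \<phi> i (v i))"
proof -
  have phi_scale: "\<phi> i (c *\<^sub>C x) = c * \<phi> i x" and phi_add: "\<phi> i (x + y) = \<phi> i x + \<phi> i y"
    and phi_sum: "\<phi> i (sum g A) = (\<Sum>a\<in>A. \<phi> i (g a))"
    if "i \<in> I" for i c x y and g :: "'a \<Rightarrow> 'a" and A
    using lin[OF that] unfolding Vector_Spaces.linear_def
    by (auto simp: module_hom.scale module_hom.add module_hom.sum scaleC_complex_def)
  define R where "R = range (blinfun_apply T)"
  define Q where "Q B \<longleftrightarrow> finite B \<and> complex_vector.independent B \<and> complex_vector.span B = R" for B
  have subR: "complex_vector.subspace R"
  proof (rule complex_vector.subspaceI)
    show "0 \<in> R" unfolding R_def by (metis blinfun.zero_right rangeI)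
    show "u + w \<in> R" if uw: "u \<in> R" "w \<in> R" for u w
    proof -
      obtain a b where "u = T a" "w = T b" using uw by (auto simp: R_def)
      then have "u + w = T (a + b)" by (simp add: blinfun.add_right)
      then show ?thesis by (simp add: R_def)
    qed
    show "c *\<^sub>C u \<in> R" if u: "u \<in> R" for c u
    proof -
      obtain a where "u = T a" using u by (auto simp: R_def)
      then have "c *\<^sub>C u = T (c *\<^sub>C a)" by (simp add: T phi_scale complex_vector.scale_sum_right scaleC_scaleC)
      then show ?thesis by (simp add: R_def)
    qed
  qed
  have Rv: "R \<subseteq> complex_vector.span (v ` I)"
  proof
    fix x assume "x \<in> R"
    then obtain u where "x = T u" by (auto simp: R_def)
    then have x: "x = (\<Sum>i\<in>I. \<phi> i u *\<^sub>C v i)" by (simp only: T)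
    show "x \<in> complex_vector.span (v ` I)"
      unfolding x by (intro complex_vector.span_sum complex_vector.span_scale complex_vector.span_base imageI)
  qed
  obtain B0 where B0: "B0 \<subseteq> R" "complex_vector.independent B0" "R \<subseteq> complex_vector.span B0"
    by (rule complex_vector.basis_exists[of R])
  have "finite B0"
    using complex_vector.independent_span_bound[OF finite_imageI[OF fin] B0(2)] B0(1) Rv by blast
  moreover have "complex_vector.span B0 = R"
    using complex_vector.span_minimal[OF B0(1) subR] B0(3) by (rule equalityI)
  ultimately have "Q B0" using B0(2) by (simp add: Q_def)
  define B where "B = (SOME B. Q B)"
  have "Q B" unfolding B_def using \<open>Q B0\<close> by (rule someI)
  then have B: "finite B" "complex_vector.independent B" "complex_vector.span B = R"
    by (auto simp: Q_def)
  \<comment> \<open>The \<open>v i\<close> need not lie in the range of \<open>T\<close>, so the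
    basis is extended until they can be expanded. The added basis vectors contribute nothing to the
    trace, because \<open>T c\<close> has no component along them.\<close>
  obtain C where C: "B \<subseteq> C" "C \<subseteq> B \<union> v ` I" "complex_vector.independent C" "B \<union> v ` I \<subseteq> complex_vector.span C"
    by (rule complex_vector.maximal_independent_subset_extend[of B "B \<union> v ` I", OF Un_upper1 B(2)])
  have finC: "finite C" using C(2) B(1) fin by (meson finite_UnI finite_imageI finite_subset)
  let ?r = "complex_vector.representation C"
  have rep: "?r (T x) = complex_vector.representation B (T x)" for x
    using C(1,3) B(3) by (intro complex_vector.representation_extend) (auto simp: R_def)
  have "op_trace T = (\<Sum>b\<in>B. complex_vector.representation B (T b) b)"
    by (simp add: op_trace_def B_def Q_def[abs_def] R_def)
  also have "\<dots> = (\<Sum>b\<in>B. ?r (T b) b)" by (simp add: rep)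
  also have "\<dots> = (\<Sum>c\<in>C. ?r (T c) c)"
  proof (rule sum.mono_neutral_left[OF finC C(1)], rule ballI)
    fix c assume "c \<in> C - B"
    then show "?r (T c) c = 0" unfolding rep using complex_vector.representation_ne_zero by blast
  qed
  also have "\<dots> = (\<Sum>c\<in>C. \<Sum>i\<in>I. \<phi> i c * ?r (v i) c)"
  proof (rule sum.cong[OF refl])
    fix c
    have vC: "v i \<in> complex_vector.span C" if "i \<in> I" for i using C(4) that by blast
    have "?r (T c) = (\<lambda>c'. \<Sum>i\<in>I. ?r (\<phi> i c *\<^sub>C v i) c')"
      unfolding T using C(3) vC by (intro complex_vector.representation_sum complex_vector.span_scale)
    then show "?r (T c) c = (\<Sum>i\<in>I. \<phi> i c * ?r (v i) c)"
      using vC by (simp add: complex_vector.representation_scale[OF C(3)])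
  qed
  also have "\<dots> = (\<Sum>i\<in>I. \<Sum>c\<in>C. \<phi> i c * ?r (v i) c)" by (rule sum.swap)
  also have "\<dots> = (\<Sum>i\<in>I. \<phi> i (v i))"
  proof (rule sum.cong[OF refl])
    fix i assume i: "i \<in> I"
    have "v i = (\<Sum>c\<in>C. ?r (v i) c *\<^sub>C c)"
      using complex_vector.sum_representation_eq[OF C(3) _ finC subset_refl, of "v i"] C(4) i by auto
    then have "\<phi> i (v i) = \<phi> i (\<Sum>c\<in>C. ?r (v i) c *\<^sub>C c)" by simp
    also have "\<dots> = (\<Sum>c\<in>C. \<phi> i c * ?r (v i) c)"
      using i by (simp add: phi_sum phi_scale mult.commute)
    finally show "(\<Sum>c\<in>C. \<phi> i c * ?r (v i) c) = \<phi> i (v i)" ..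
  qed
  finally show ?thesis .
qed

section \<open>Determinants and adjugates of matrices given as functions of two indices\<close>

definition fun_det :: "nat \<Rightarrow> (nat \<Rightarrow> nat \<Rightarrow> complex) \<Rightarrow> complex" where
  "fun_det n m = Determinant.det (Matrix.mat n n (\<lambda>(i, j). m i j))"

definition fun_adj :: "nat \<Rightarrow> (nat \<Rightarrow> nat \<Rightarrow> complex) \<Rightarrow> nat \<Rightarrow> nat \<Rightarrow> complex" where
  "fun_adj n m i j = adj_mat (Matrix.mat n n (\<lambda>(i, j). m i j)) $$ (i, j)"

lemma permutes_atLeastLessThan: "p permutes {0..<n} \<Longrightarrow> i < n \<Longrightarrow> p i < (n::nat)"
  using permutes_in_image[of p "{0..<n}" i] by simp

lemma fun_det_expand:
  "fun_det n m = (\<Sum>p | p permutes {0..<n}. signof p * (\<Prod>i = 0..<n. m i (p i)))"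
  unfolding fun_det_def
  by (subst det_def') (auto intro!: sum.cong prod.cong simp: permutes_atLeastLessThan)

lemma fun_adj_mult_right:
  assumes "i < n" "j < n"
  shows "(\<Sum>k<n. m i k * fun_adj n m k j) = (if i = j then fun_det n m else 0)"
proof -
  let ?A = "Matrix.mat n n (\<lambda>(i, j). m i j)"
  have A: "?A \<in> carrier_mat n n" by simp
  note adj = adj_mat[OF A]
  have "(?A * adj_mat ?A) $$ (i, j) = (\<Sum>k<n. m i k * fun_adj n m k j)"
    using assms adj(1) by (simp add: scalar_prod_def fun_adj_def atLeast0LessThan)
  moreover have "(?A * adj_mat ?A) $$ (i, j) = (if i = j then fun_det n m else 0)"
    unfolding adj(2) using assms by (simp add: fun_det_def)
  ultimately show ?thesis by (rule trans[OF sym])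
qed

lemma fun_adj_mult_left:
  assumes "i < n" "j < n"
  shows "(\<Sum>k<n. fun_adj n m i k * m k j) = (if i = j then fun_det n m else 0)"
proof -
  let ?A = "Matrix.mat n n (\<lambda>(i, j). m i j)"
  have A: "?A \<in> carrier_mat n n" by simp
  note adj = adj_mat[OF A]
  have "(adj_mat ?A * ?A) $$ (i, j) = (\<Sum>k<n. fun_adj n m i k * m k j)"
    using assms adj(1) by (simp add: scalar_prod_def fun_adj_def atLeast0LessThan)
  moreover have "(adj_mat ?A * ?A) $$ (i, j) = (if i = j then fun_det n m else 0)"
    unfolding adj(3) using assms by (simp add: fun_det_def)
  ultimately show ?thesis by (rule trans[OF sym])
qed

lemma fun_det_eq_0_kernel:
  assumes "fun_det n m = 0"
  obtains c where "\<exists>j<n. c j \<noteq> 0" "\<And>i. i < n \<Longrightarrow> (\<Sum>j<n. m i j * c j) = 0"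
proof -
  let ?A = "Matrix.mat n n (\<lambda>(i, j). m i j)"
  have A: "?A \<in> carrier_mat n n" by simp
  obtain v where v: "v \<in> carrier_vec n" "v \<noteq> 0\<^sub>v n" "?A *\<^sub>v v = 0\<^sub>v n"
    using assms det_0_iff_vec_prod_zero_field[OF A] by (auto simp: fun_det_def)
  show ?thesis
  proof (rule that[of "\<lambda>j. vec_index v j"])
    show "\<exists>j<n. vec_index v j \<noteq> 0"
      using v(1,2) by (metis carrier_vecD eq_vecI index_zero_vec)
    fix i assume i: "i < n"
    have "vec_index (?A *\<^sub>v v) i = (\<Sum>j<n. m i j * vec_index v j)"
      using i v(1) by (simp add: scalar_prod_def atLeast0LessThan)
    then show "(\<Sum>j<n. m i j * vec_index v j) = 0" using v(3) i by simp
  qed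
qed

text \<open>Through this form the adjugate inherits holomorphy from the determinant. Deleting row
  \<open>j\<close> and column \<open>i\<close> shifts the later indices by one, whence the
  conditionals.\<close>

lemma fun_adj_eq_det:
  assumes "i < n" "j < n"
  shows "fun_adj n m i j = (-1) ^ (j + i) *
     fun_det (n - 1) (\<lambda>a b. m (if a < j then a else Suc a) (if b < i then b else Suc b))"
proof -
  have "mat_delete (Matrix.mat n n (\<lambda>(i, j). m i j)) j i =
     Matrix.mat (n - 1) (n - 1) (\<lambda>(a, b). m (if a < j then a else Suc a) (if b < i then b else Suc b))"
    unfolding mat_delete_def by (rule eq_matI) auto
  then show ?thesis
    using assms by (simp add: fun_adj_def adj_mat_def cofactor_def fun_det_def)
qed

lemma holomorphic_on_fun_det:
  assumes "\<And>i j. i < n \<Longrightarrow> j < n \<Longrightarrow> (\<lambda>z. m z i j) holomorphic_on U"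
  shows "(\<lambda>z. fun_det n (m z)) holomorphic_on U"
  unfolding fun_det_expand
  by (intro holomorphic_intros assms) (auto simp: permutes_atLeastLessThan)

lemma continuous_on_fun_det:
  fixes m :: "'t::topological_space \<Rightarrow> nat \<Rightarrow> nat \<Rightarrow> complex"
  assumes "\<And>i j. i < n \<Longrightarrow> j < n \<Longrightarrow> continuous_on U (\<lambda>z. m z i j)"
  shows "continuous_on U (\<lambda>z. fun_det n (m z))"
  unfolding fun_det_expand
  by (intro continuous_intros assms) (auto simp: permutes_atLeastLessThan)

lemma holomorphic_on_fun_adj:
  assumes "\<And>i j. i < n \<Longrightarrow> j < n \<Longrightarrow> (\<lambda>z. m z i j) holomorphic_on U" "i < n" "j < n"
  shows "(\<lambda>z. fun_adj n (m z) i j) holomorphic_on U"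
  unfolding fun_adj_eq_det[OF assms(2,3)]
  by (intro holomorphic_intros holomorphic_on_fun_det assms(1)) auto

text \<open>Laplace expansion along row \<open>i\<close>: its cofactors do not see that row, so they
  are those of the unmodified matrix.\<close>

lemma fun_det_replace_row:
  assumes "i < n"
  shows "fun_det n (m(i := r)) = (\<Sum>j<n. r j * fun_adj n m j i)"
proof -
  let ?A = "Matrix.mat n n (\<lambda>(i', j). (m(i := r)) i' j)"
  have "fun_det n (m(i := r)) = (\<Sum>j<n. ?A $$ (i, j) * cofactor ?A i j)"
    unfolding fun_det_def by (rule laplace_expansion_row) (use assms in auto)
  also have "\<dots> = (\<Sum>j<n. r j * fun_adj n m j i)"
  proof (rule sum.cong[OF refl])
    fix j assume "j \<in> {..<n}"
    then have j: "j < n" by simp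
    have "mat_delete ?A i j = mat_delete (Matrix.mat n n (\<lambda>(i, j). m i j)) i j"
      unfolding mat_delete_def using assms by (intro eq_matI) auto
    then show "?A $$ (i, j) * cofactor ?A i j = r j * fun_adj n m j i"
      using assms j by (simp add: fun_adj_def adj_mat_def cofactor_def)
  qed
  finally show ?thesis .
qed

text \<open>Jacobi's formula, the trace of \<open>m'\<close> times the adjugate. The product rule in
  the Leibniz expansion gives a sum of determinants with one row differentiated. No inverse matrix
  occurs, so the formula also holds at zeros of the determinant.\<close>

lemma has_field_derivative_fun_det:
  assumes "\<And>i j. i < n \<Longrightarrow> j < n \<Longrightarrow> ((\<lambda>z. m z i j) has_field_derivative m' i j) (at z)"
  shows "((\<lambda>z. fun_det n (m z)) has_field_derivative (\<Sum>i<n. \<Sum>j<n. m' i j * fun_adj n (m z) j i)) (at z)"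
proof -
  have "((\<lambda>z. fun_det n (m z)) has_field_derivative
      (\<Sum>p | p permutes {0..<n}. signof p * (\<Sum>i = 0..<n. m' i (p i) * (\<Prod>k\<in>{0..<n} - {i}. m z k (p k))))) (at z)"
    unfolding fun_det_expand
    by (intro DERIV_sum DERIV_cmult has_field_derivative_prod assms) (auto simp: permutes_atLeastLessThan)
  also have "(\<Sum>p | p permutes {0..<n}. signof p * (\<Sum>i = 0..<n. m' i (p i) * (\<Prod>k\<in>{0..<n} - {i}. m z k (p k))))
     = (\<Sum>i = 0..<n. \<Sum>p | p permutes {0..<n}. signof p * (m' i (p i) * (\<Prod>k\<in>{0..<n} - {i}. m z k (p k))))"
    unfolding sum_distrib_left by (rule sum.swap)
  also have "\<dots> = (\<Sum>i = 0..<n. fun_det n ((m z)(i := m' i)))"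
  proof (intro sum.cong refl)
    fix i assume i: "i \<in> {0..<n}"
    have "(\<Prod>k = 0..<n. ((m z)(i := m' i)) k (p k)) = m' i (p i) * (\<Prod>k\<in>{0..<n} - {i}. m z k (p k))" for p
      using i by (simp add: prod.remove[of _ i])
    then show "(\<Sum>p | p permutes {0..<n}. signof p * (m' i (p i) * (\<Prod>k\<in>{0..<n} - {i}. m z k (p k)))) = fun_det n ((m z)(i := m' i))"
      by (simp add: fun_det_expand)
  qed
  also have "\<dots> = (\<Sum>i<n. \<Sum>j<n. m' i j * fun_adj n (m z) j i)"
    by (simp add: fun_det_replace_row atLeast0LessThan)
  finally show ?thesis .
qed

subsection \<open>Reduction to a determinant\<close>

lemma fun_adj_solve:
  assumes "fun_det n m \<noteq> 0" "i < n"
  shows "(\<Sum>j<n. fun_adj n m i j / fun_det n m * (\<Sum>k<n. m j k * z k)) = z i" (is ?A)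
    and "(\<Sum>j<n. m i j * (\<Sum>k<n. fun_adj n m j k / fun_det n m * z k)) = z i" (is ?B)
proof -
  let ?d = "fun_det n m"
  have "(\<Sum>j<n. fun_adj n m i j / ?d * (\<Sum>k<n. m j k * z k)) = (\<Sum>j<n. \<Sum>k<n. fun_adj n m i j * m j k * (z k / ?d))"
    by (simp add: sum_distrib_left mult_ac)
  also have "\<dots> = (\<Sum>k<n. (\<Sum>j<n. fun_adj n m i j * m j k) * (z k / ?d))"
    unfolding sum_distrib_right by (rule sum.swap)
  also have "\<dots> = (\<Sum>k<n. if k = i then z k else 0)"
    by (rule sum.cong) (use assms fun_adj_mult_left[OF assms(2)] in auto)
  finally show ?A using assms(2) by simp
  have "(\<Sum>j<n. m i j * (\<Sum>k<n. fun_adj n m j k / ?d * z k)) = (\<Sum>j<n. \<Sum>k<n. m i j * fun_adj n m j k * (z k / ?d))"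
    by (simp add: sum_distrib_left mult_ac)
  also have "\<dots> = (\<Sum>k<n. (\<Sum>j<n. m i j * fun_adj n m j k) * (z k / ?d))"
    unfolding sum_distrib_right by (rule sum.swap)
  also have "\<dots> = (\<Sum>k<n. if k = i then z k else 0)"
    by (rule sum.cong) (use assms fun_adj_mult_right[OF assms(2)] in auto)
  finally show ?B using assms(2) by simp
qed

text \<open>Put \<open>E = P + F\<close> with \<open>F x = (\<Sum>i<n. f i x *\<^sub>C y i)\<close>. If \<open>E\<close> is invertible, then
  \<open>P = E (1 - E\<inverse> F)\<close>, and \<open>1 - E\<inverse> F\<close> is invertible if and only if the \<open>n \<times> n\<close> matrix
  \<open>\<delta>\<^sub>i\<^sub>j - f i (E\<inverse> (y j))\<close> is.\<close>

definition rank_shift ::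
    "('a::complex_normed_vector \<Rightarrow>\<^sub>L 'b::complex_normed_vector) \<Rightarrow> nat \<Rightarrow> (nat \<Rightarrow> 'a \<Rightarrow>\<^sub>L complex) \<Rightarrow> (nat \<Rightarrow> 'b) \<Rightarrow> 'a \<Rightarrow>\<^sub>L 'b" where
  "rank_shift P n f y = P + (\<Sum>i<n. rank_one (f i) (y i))"

definition reduced_matrix ::
    "('a::complex_normed_vector \<Rightarrow>\<^sub>L 'b::complex_normed_vector) \<Rightarrow> nat \<Rightarrow> (nat \<Rightarrow> 'a \<Rightarrow>\<^sub>L complex) \<Rightarrow> (nat \<Rightarrow> 'b) \<Rightarrow> nat \<Rightarrow> nat \<Rightarrow> complex" where
  "reduced_matrix P n f y i j = (if i = j then 1 else 0) - f i (op_inverse (rank_shift P n f y) (y j))"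

definition reduced_det ::
    "('a::complex_normed_vector \<Rightarrow>\<^sub>L 'b::complex_normed_vector) \<Rightarrow> nat \<Rightarrow> (nat \<Rightarrow> 'a \<Rightarrow>\<^sub>L complex) \<Rightarrow> (nat \<Rightarrow> 'b) \<Rightarrow> complex" where
  "reduced_det P n f y = fun_det n (reduced_matrix P n f y)"

lemma op_ker_invertible: "op_invertible T \<Longrightarrow> op_ker T = {0}"
  unfolding op_ker_def using op_inverse_apply(1)[of T] by (auto) (metis blinfun.zero_right)

lemma rank_shift_apply: "rank_shift P n f y x = P x + (\<Sum>i<n. f i x *\<^sub>C y i)"
  by (simp add: rank_shift_def blinfun.add_left blinfun.sum_left rank_one.rep_eq)

lemma cblinfun_rank_shift: "P \<in> cblinfun \<Longrightarrow> (\<And>i. i < n \<Longrightarrow> f i \<in> cblinfun) \<Longrightarrow> rank_shift P n f y \<in> cblinfun"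
  unfolding rank_shift_def by (intro cblinfun_add cblinfun_sum cblinfun_rank_one) auto

text \<open>A kernel vector \<open>c\<close> of the matrix lifts to the combination \<open>x\<close>
  of the vectors \<open>G (y j)\<close> with coefficients \<open>c j\<close>. The kernel equations
  say \<open>f i x = c i\<close>, so the finite rank part applied to \<open>x\<close> equals
  \<open>E x\<close>, and \<open>P x = 0\<close>.\<close>

lemma reduced_det_eq_0_imp_kernel:
  assumes f: "\<And>i. i < n \<Longrightarrow> f i \<in> cblinfun" and P: "P \<in> cblinfun"
    and E: "op_invertible (rank_shift P n f y)" and d: "reduced_det P n f y = 0"
  shows "op_ker P \<noteq> {0}"
proof -
  define G where "G = op_inverse (rank_shift P n f y)"
  have G: "G \<in> cblinfun" unfolding G_def by (intro cblinfun_op_inverse E cblinfun_rank_shift P f)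
  obtain c where c: "\<exists>j<n. c j \<noteq> 0" "\<And>i. i < n \<Longrightarrow> (\<Sum>j<n. reduced_matrix P n f y i j * c j) = 0"
    using fun_det_eq_0_kernel d unfolding reduced_det_def by blast
  define x where "x = (\<Sum>j<n. c j *\<^sub>C G (y j))"
  have fx: "f i x = c i" if "i < n" for i
  proof -
    have "f i x = (\<Sum>j<n. c j * f i (G (y j)))"
      by (simp add: x_def blinfun.sum_right cblinfun_scale_mult[OF f[OF that]])
    also have "\<dots> = (\<Sum>j<n. (if j = i then c j else 0) - reduced_matrix P n f y i j * c j)"
      by (rule sum.cong) (auto simp: reduced_matrix_def G_def algebra_simps)
    also have "\<dots> = c i" using c(2)[OF that] that by (simp add: sum_subtractf)
    finally show ?thesis .
  qed
  have "rank_shift P n f y x = (\<Sum>j<n. c j *\<^sub>C y j)"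
    by (simp add: x_def blinfun.sum_right cblinfun_scaleC[OF cblinfun_rank_shift[OF P f]] G_def op_inverse_apply(2)[OF E])
  then have "P x = 0" by (simp add: rank_shift_apply fx)
  moreover have "x \<noteq> 0" using c(1) fx by force
  ultimately show ?thesis by (auto simp: op_ker_def)
qed

text \<open>If \<open>P x = u\<close>, then \<open>x\<close> is \<open>G u\<close> plus the
  combination of the \<open>G (y i)\<close> with coefficients \<open>f i x\<close>. Applying the
  \<open>f j\<close> gives a linear system with matrix \<open>m\<close> for these coefficients,
  which the adjugate solves; the resulting operator \<open>S\<close> is then verified as a two-sided
  inverse.\<close>

lemma reduced_det_neq_0_imp_invertible:
  assumes f: "\<And>i. i < n \<Longrightarrow> f i \<in> cblinfun" and P: "P \<in> cblinfun"
    and E: "op_invertible (rank_shift P n f y)" and d: "reduced_det P n f y \<noteq> 0"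
  defines "G \<equiv> op_inverse (rank_shift P n f y)" and "m \<equiv> reduced_matrix P n f y"
  shows "op_invertible P"
    and "op_inverse P u = G u + (\<Sum>i<n. (\<Sum>j<n. fun_adj n m i j / reduced_det P n f y * f j (G u)) *\<^sub>C G (y i))"
proof -
  have G: "G \<in> cblinfun" unfolding G_def by (intro cblinfun_op_inverse E cblinfun_rank_shift P f)
  have d': "fun_det n m \<noteq> 0" using d by (simp add: reduced_det_def m_def)
  define S where "S = G + (\<Sum>i<n. rank_one (\<Sum>j<n. (fun_adj n m i j / fun_det n m) *\<^sub>C (f j o\<^sub>L G)) (G (y i)))"
  have S: "S u = G u + (\<Sum>i<n. (\<Sum>j<n. fun_adj n m i j / fun_det n m * f j (G u)) *\<^sub>C G (y i))" for u
    by (simp add: S_def blinfun.add_left blinfun.sum_left rank_one.rep_eq scaleC_blinfun.rep_eq scaleC_complex_def)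
  have PG: "P (G u) = u - (\<Sum>k<n. f k (G u) *\<^sub>C y k)" for u
    using op_inverse_apply(2)[OF E, of u] unfolding rank_shift_apply G_def by (simp add: algebra_simps)
  have PGy: "P (G (y i)) = (\<Sum>k<n. m k i *\<^sub>C y k)" if "i < n" for i
  proof -
    have "(\<Sum>k<n. m k i *\<^sub>C y k) = (\<Sum>k<n. (if k = i then y k else 0) - f k (G (y i)) *\<^sub>C y k)"
      by (rule sum.cong) (auto simp: m_def reduced_matrix_def G_def scaleC.diff_left)
    then show ?thesis using that by (simp add: PG sum_subtractf)
  qed
  have PS: "P (S u) = u" for u
  proof -
    let ?c = "\<lambda>i. \<Sum>j<n. fun_adj n m i j / fun_det n m * f j (G u)"
    have "P (S u) = P (G u) + (\<Sum>i<n. ?c i *\<^sub>C (\<Sum>k<n. m k i *\<^sub>C y k))"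
      by (simp add: S blinfun.add_right blinfun.sum_right cblinfun_scaleC[OF P] PGy)
    also have "(\<Sum>i<n. ?c i *\<^sub>C (\<Sum>k<n. m k i *\<^sub>C y k)) = (\<Sum>i<n. \<Sum>k<n. (m k i * ?c i) *\<^sub>C y k)"
      by (simp add: scaleC_sum_right scaleC_scaleC mult.commute)
    also have "\<dots> = (\<Sum>k<n. (\<Sum>i<n. m k i * ?c i) *\<^sub>C y k)"
      unfolding scaleC_sum_left by (rule sum.swap)
    also have "\<dots> = (\<Sum>k<n. f k (G u) *\<^sub>C y k)"
      by (rule sum.cong[OF refl], subst fun_adj_solve(2)[OF d']) auto
    finally show ?thesis by (simp add: PG)
  qed
  have GP: "G (P x) = x - (\<Sum>k<n. f k x *\<^sub>C G (y k))" for x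
  proof -
    have "x = G (P x + (\<Sum>k<n. f k x *\<^sub>C y k))"
      using op_inverse_apply(1)[OF E, of x] unfolding rank_shift_apply G_def by simp
    then show ?thesis by (simp add: blinfun.add_right blinfun.sum_right cblinfun_scaleC[OF G] algebra_simps)
  qed
  have SP: "S (P x) = x" for x
  proof -
    have "f j (G (P x)) = (\<Sum>k<n. m j k * f k x)" if "j < n" for j
    proof -
      have "(\<Sum>k<n. m j k * f k x) = (\<Sum>k<n. (if k = j then f k x else 0) - f k x * f j (G (y k)))"
        by (rule sum.cong) (auto simp: m_def reduced_matrix_def G_def algebra_simps)
      then show ?thesis using that
        by (simp add: GP blinfun.diff_right blinfun.sum_right cblinfun_scale_mult[OF f[OF that]] sum_subtractf)
    qed
    then have "S (P x) = G (P x) + (\<Sum>i<n. (\<Sum>j<n. fun_adj n m i j / fun_det n m * (\<Sum>k<n. m j k * f k x)) *\<^sub>C G (y i))"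
      by (simp add: S)
    also have "\<dots> = G (P x) + (\<Sum>i<n. f i x *\<^sub>C G (y i))"
      by (intro arg_cong2[of _ _ _ _ "(+)"] refl sum.cong, subst fun_adj_solve(1)[OF d']) auto
    finally show ?thesis by (simp add: GP)
  qed
  have inv: "S o\<^sub>L P = id_blinfun" "P o\<^sub>L S = id_blinfun"
    by (auto intro!: blinfun_eqI simp: PS SP)
  then show "op_invertible P" by (auto simp: op_invertible_def)
  show "op_inverse P u = G u + (\<Sum>i<n. (\<Sum>j<n. fun_adj n m i j / reduced_det P n f y * f j (G u)) *\<^sub>C G (y i))"
    unfolding op_inverse_unique[OF inv] S reduced_det_def m_def ..
qed

subsection \<open>The multiplicity as the order of a zero\<close>

lemma residue_bounded:
  assumes g: "g holomorphic_on ball k \<rho> - {k}" and "\<rho> > 0" and B: "\<And>z. z \<in> ball k \<rho> - {k} \<Longrightarrow> cmod (g z) \<le> B"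
  shows "residue g k = 0"
proof -
  have ev: "eventually (\<lambda>z. z \<in> ball k \<rho> - {k}) (at k)"
    using assms(2) by (intro eventually_at_in_open) auto
  then have "eventually (\<lambda>z. cmod (g z) \<le> B) (at k)"
    by eventually_elim (rule B)
  moreover have "k \<in> interior (ball k \<rho>)" using assms(2) by simp
  ultimately obtain h where h: "h holomorphic_on ball k \<rho>" "\<And>z. z \<in> ball k \<rho> - {k} \<Longrightarrow> h z = g z"
    using holomorphic_on_extend_bounded[OF g] by blast
  have "residue g k = residue h k"
    by (rule residue_cong) (use eventually_mono[OF ev] h(2) in force)+
  also have "\<dots> = 0" by (rule residue_holo[OF _ _ h(1)]) (use assms(2) in auto)
  finally show ?thesis .
qed

lemma residue_sum:
  assumes "open s" "z \<in> s" "\<And>i. i \<in> A \<Longrightarrow> F i holomorphic_on s - {z}"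
  shows "residue (\<lambda>w. \<Sum>i\<in>A. F i w) z = (\<Sum>i\<in>A. residue (F i) z)"
  using assms(3)
proof (induction A rule: infinite_finite_induct)
  case (insert a A)
  then show ?case
    by (simp add: residue_add[OF assms(1,2)] holomorphic_on_sum)
qed (simp_all add: residue_const)

lemma residue_logderiv:
  assumes d: "d holomorphic_on S" and S: "open S" "connected S" "k \<in> S" and nz: "\<exists>w\<in>S. d w \<noteq> 0"
  shows "residue (\<lambda>z. deriv d z / d z) k = of_int (zorder d k)"
proof -
  define N where "N = nat (zorder d k)"
  define g where "g = zor_poly d k"
  obtain r where r: "if d k = 0 then zorder d k > 0 else zorder d k = 0" "r > 0" "cball k r \<subseteq> S" "g holomorphic_on cball k r"
     "\<And>w. w \<in> cball k r \<Longrightarrow> d w = g w * (w - k) ^ N \<and> g w \<noteq> 0"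
    using zorder_exist_zero[OF d S nz] unfolding g_def N_def by blast
  \<comment> \<open>\<open>F\<close> is \<open>(w - k)\<close> times the logarithmic derivative,
    extended holomorphically to \<open>k\<close> with the value \<open>N\<close>.\<close>
  define F where "F w = of_nat N + (w - k) * deriv g w / g w" for w
  have g: "g holomorphic_on ball k r" using r(4) by (rule holomorphic_on_subset) auto
  have F: "F holomorphic_on ball k r"
    unfolding F_def using r(5) g by (intro holomorphic_intros) auto
  have "eventually (\<lambda>z. z \<in> ball k r - {k}) (at k)"
    using r(2) by (intro eventually_at_in_open) auto
  then have "eventually (\<lambda>z. deriv d z / d z = F z / (z - k)) (at k)"
  proof eventually_elim
    case (elim z)
    then have z: "z \<in> ball k r" "z \<noteq> k" by auto
    have "(g has_field_derivative deriv g z) (at z)"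
      using holomorphic_derivI[OF g] z by auto
    then have "((\<lambda>w. g w * (w - k) ^ N) has_field_derivative deriv g z * (z - k) ^ N + g z * (of_nat N * (z - k) ^ (N - 1))) (at z)"
      by (auto intro!: derivative_eq_intros)
    moreover have "eventually (\<lambda>w. g w * (w - k) ^ N = d w) (nhds z)"
      using eventually_nhds_in_open[OF open_ball z(1)] by eventually_elim (use r(5) in auto)
    ultimately have "(d has_field_derivative deriv g z * (z - k) ^ N + g z * (of_nat N * (z - k) ^ (N - 1))) (at z)"
      by (subst (asm) DERIV_cong_ev[OF refl _ refl]) auto
    then have "deriv d z = deriv g z * (z - k) ^ N + g z * (of_nat N * (z - k) ^ (N - 1))"
      by (rule DERIV_imp_deriv)
    moreover have "d z = g z * (z - k) ^ N" "g z \<noteq> 0" using r(5)[of z] z by auto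
    moreover define t where "t = z - k"
    moreover have "t \<noteq> 0" using z by (simp add: t_def)
    ultimately show ?case
      unfolding F_def t_def[symmetric] by (cases N) (auto simp: divide_simps algebra_simps)
  qed
  then have "residue (\<lambda>z. deriv d z / d z) k = residue (\<lambda>z. F z / (z - k)) k"
    by (rule residue_cong) simp
  also have "\<dots> = F k" by (rule residue_simple[OF open_ball _ F]) (use r(2) in auto)
  also have "\<dots> = of_int (zorder d k)"
    using r(1) by (auto simp: F_def N_def split: if_splits)
  finally show ?thesis .
qed

text \<open>Only the Taylor polynomial of \<open>v\<close> below the pole order contributes to the residue, which
  is therefore of finite rank.\<close>

lemma finite_rank_residue:
  fixes v :: "complex \<Rightarrow> 'a::complex_banach" and \<phi> :: "complex \<Rightarrow> 'a \<Rightarrow> complex"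
  assumes v: "vector_holomorphic_on v (ball k \<rho>)" and \<rho>: "\<rho> > 0"
    and hol: "\<And>x. (\<lambda>z. \<phi> z x) holomorphic_on ball k \<rho> - {k}"
    and holv: "(\<lambda>z. \<phi> z (v z)) holomorphic_on ball k \<rho> - {k}"
    and lin: "\<And>z. z \<in> ball k \<rho> - {k} \<Longrightarrow> Vector_Spaces.linear (*\<^sub>C) (*\<^sub>C) (\<phi> z)"
    and bound: "\<And>z x. z \<in> ball k \<rho> - {k} \<Longrightarrow> cmod (\<phi> z x) * cmod (z - k) ^ N \<le> B * norm x"
  obtains a :: "nat \<Rightarrow> 'a" where
    "\<And>L x. L \<in> cblinfun \<Longrightarrow> residue (\<lambda>z. \<phi> z x * blinfun_apply L (v z)) k =
       (\<Sum>m<N. residue (\<lambda>z. \<phi> z x * (z - k) ^ m) k * blinfun_apply L (a m))"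
    and "residue (\<lambda>z. \<phi> z (v z)) k = (\<Sum>m<N. residue (\<lambda>z. \<phi> z (a m) * (z - k) ^ m) k)"
proof -
  obtain a C r where r: "r > 0" "ball k r \<subseteq> ball k \<rho>"
    and a: "\<And>w. w \<in> ball k r \<Longrightarrow> norm (v w - (\<Sum>m<N. (w - k) ^ m *\<^sub>C a m)) \<le> C * cmod (w - k) ^ N"
    using vector_Taylor[OF v open_ball, of k N] \<rho> by (metis centre_in_ball)
  define R where "R w = v w - (\<Sum>m<N. (w - k) ^ m *\<^sub>C a m)" for w
  have hol': "(\<lambda>z. \<phi> z x) holomorphic_on ball k r - {k}" for x
    using hol by (rule holomorphic_on_subset) (use r(2) in auto)
  have holv': "(\<lambda>z. \<phi> z (v z)) holomorphic_on ball k r - {k}"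
    using holv by (rule holomorphic_on_subset) (use r(2) in auto)
  have v': "vector_holomorphic_on v (ball k r)" by (rule vector_holomorphic_on_subset[OF v r(2)])
  have holm: "(\<lambda>z. \<phi> z x * (z - k) ^ m) holomorphic_on ball k r - {k}" for x m
    by (intro holomorphic_intros hol')
  have ev: "eventually (\<lambda>z. z \<in> ball k r - {k}) (at k)"
    using r(1) by (intro eventually_at_in_open) auto
  show ?thesis
  proof (rule that[of a])
    fix L x assume L: "L \<in> (cblinfun :: ('a \<Rightarrow>\<^sub>L complex) set)"
    have Lv: "(\<lambda>z. blinfun_apply L (v z)) holomorphic_on ball k r - {k}"
      using vector_holomorphic_on_cblinfun[OF v' L] by (rule holomorphic_on_subset) auto
    have eq: "\<phi> z x * blinfun_apply L (v z) = (\<Sum>m<N. blinfun_apply L (a m) * (\<phi> z x * (z - k) ^ m)) + \<phi> z x * blinfun_apply L (R z)" for z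
      by (simp add: R_def blinfun.diff_right blinfun.sum_right cblinfun_scale_mult[OF L] algebra_simps sum_distrib_left)
    have holR: "(\<lambda>z. \<phi> z x * blinfun_apply L (R z)) holomorphic_on ball k r - {k}"
      unfolding R_def blinfun.diff_right blinfun.sum_right cblinfun_scale_mult[OF L]
      by (intro holomorphic_intros hol' Lv)
    \<comment> \<open>The remainder is of order \<open>N\<close>, which compensates the pole of
      \<open>\<phi>\<close> allowed by \<open>bound\<close>; the product is bounded near
      \<open>k\<close>.\<close>
    have "residue (\<lambda>z. \<phi> z x * blinfun_apply L (R z)) k = 0"
    proof (rule residue_bounded[OF holR r(1)])
      fix z assume z: "z \<in> ball k r - {k}"
      have "cmod (\<phi> z x * blinfun_apply L (R z)) \<le> cmod (\<phi> z x) * (norm L * norm (R z))"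
        unfolding norm_mult by (intro mult_left_mono norm_blinfun) auto
      also have "\<dots> \<le> cmod (\<phi> z x) * (norm L * (C * cmod (z - k) ^ N))"
        using a[of z] z by (intro mult_left_mono) (auto simp: R_def)
      also have "\<dots> = norm L * (cmod (\<phi> z x) * cmod (z - k) ^ N * C)" by (simp add: mult_ac)
      also have "\<dots> \<le> norm L * (cmod (\<phi> z x) * cmod (z - k) ^ N * \<bar>C\<bar>)"
        by (intro mult_left_mono) auto
      also have "\<dots> \<le> norm L * (B * norm x * \<bar>C\<bar>)"
        using bound[of z x] z r(2) by (intro mult_left_mono mult_right_mono) auto
      finally show "cmod (\<phi> z x * blinfun_apply L (R z)) \<le> norm L * (B * norm x * \<bar>C\<bar>)" .
    qed
    moreover have "residue (\<lambda>z. \<Sum>m<N. blinfun_apply L (a m) * (\<phi> z x * (z - k) ^ m)) k =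
        (\<Sum>m<N. residue (\<lambda>z. blinfun_apply L (a m) * (\<phi> z x * (z - k) ^ m)) k)"
      by (rule residue_sum[of "ball k r"]) (use r(1) in \<open>auto intro!: holomorphic_intros hol'\<close>)
    moreover have "\<dots> = (\<Sum>m<N. blinfun_apply L (a m) * residue (\<lambda>z. \<phi> z x * (z - k) ^ m) k)"
      by (intro sum.cong refl residue_lmul[of "ball k r"] holm) (use r(1) in auto)
    ultimately show "residue (\<lambda>z. \<phi> z x * blinfun_apply L (v z)) k =
        (\<Sum>m<N. residue (\<lambda>z. \<phi> z x * (z - k) ^ m) k * blinfun_apply L (a m))"
      unfolding eq using r(1) holR
      by (subst residue_add[of "ball k r"]) (auto intro!: holomorphic_intros hol' simp: mult.commute)
  next
    have lin': "\<phi> z (x - y) = \<phi> z x - \<phi> z y" "\<phi> z (c *\<^sub>C x) = c * \<phi> z x" "\<phi> z (sum h A) = (\<Sum>i\<in>A. \<phi> z (h i))"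
      if z: "z \<in> ball k r - {k}" for z x y c A and h :: "nat \<Rightarrow> 'a"
    proof -
      have "Vector_Spaces.linear (*\<^sub>C) (*\<^sub>C) (\<phi> z)" using z r(2) by (intro lin) auto
      then show "\<phi> z (x - y) = \<phi> z x - \<phi> z y" "\<phi> z (c *\<^sub>C x) = c * \<phi> z x" "\<phi> z (sum h A) = (\<Sum>i\<in>A. \<phi> z (h i))"
        unfolding Vector_Spaces.linear_def
        by (auto simp: module_hom.scale module_hom.diff module_hom.sum scaleC_complex_def)
    qed
    have eqR: "\<phi> z (R z) = \<phi> z (v z) - (\<Sum>m<N. \<phi> z (a m) * (z - k) ^ m)" if "z \<in> ball k r - {k}" for z
      by (simp add: R_def lin'[OF that] mult.commute)
    have holR: "(\<lambda>z. \<phi> z (v z) - (\<Sum>m<N. \<phi> z (a m) * (z - k) ^ m)) holomorphic_on ball k r - {k}"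
      by (intro holomorphic_intros hol' holv')
    \<comment> \<open>The argument of \<open>\<phi> z\<close> now moves with \<open>z\<close>, so no
      fixed functional \<open>L\<close> can be factored out; \<open>bound\<close> is applied to the
      vector \<open>R z\<close> itself.\<close>
    have "residue (\<lambda>z. \<phi> z (v z) - (\<Sum>m<N. \<phi> z (a m) * (z - k) ^ m)) k = 0"
    proof (rule residue_bounded[OF holR r(1)])
      fix z assume z: "z \<in> ball k r - {k}"
      have "cmod (\<phi> z (R z)) * cmod (z - k) ^ N \<le> B * norm (R z)"
        using bound[of z "R z"] z r(2) by auto
      also have "\<dots> \<le> \<bar>B\<bar> * (C * cmod (z - k) ^ N)"
        using a[of z] z by (intro mult_mono) (auto simp: R_def)
      finally have "cmod (\<phi> z (R z)) * cmod (z - k) ^ N \<le> (\<bar>B\<bar> * C) * cmod (z - k) ^ N" by (simp add: mult.assoc)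
      then have "cmod (\<phi> z (R z)) \<le> \<bar>B\<bar> * C" using z by (subst (asm) mult_le_cancel_right) auto
      then show "cmod (\<phi> z (v z) - (\<Sum>m<N. \<phi> z (a m) * (z - k) ^ m)) \<le> \<bar>B\<bar> * C"
        by (simp only: eqR[OF z])
    qed
    moreover have "residue (\<lambda>z. \<phi> z (v z) - (\<Sum>m<N. \<phi> z (a m) * (z - k) ^ m)) k =
        residue (\<lambda>z. \<phi> z (v z)) k - (\<Sum>m<N. residue (\<lambda>z. \<phi> z (a m) * (z - k) ^ m) k)"
      using r(1) holm holv'
      by (subst residue_diff[of "ball k r"])
         (auto intro!: holomorphic_intros hol' simp: residue_sum[of "ball k r"])
    ultimately show "residue (\<lambda>z. \<phi> z (v z)) k = (\<Sum>m<N. residue (\<lambda>z. \<phi> z (a m) * (z - k) ^ m) k)"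
      by simp
  qed
qed

section \<open>Matrix elements of operator families and holomorphy of the reduced
  determinant\<close>

lemma eval_functional:
  assumes "f \<in> cblinfun"
  shows "bounded_linear (\<lambda>S :: 'a::complex_normed_vector \<Rightarrow>\<^sub>L 'b::complex_normed_vector. blinfun_apply f (blinfun_apply S x))"
    and "blinfun_apply f (blinfun_apply (c *\<^sub>C S) x) = c * blinfun_apply f (blinfun_apply S x)"
  by (auto intro: bounded_linear_compose[OF blinfun.bounded_linear_right blinfun.bounded_linear_left]
      simp: scaleC_blinfun.rep_eq cblinfun_scale_mult[OF assms])

lemma vector_holomorphic_on_eval:
  fixes F :: "complex \<Rightarrow> 'a::complex_normed_vector \<Rightarrow>\<^sub>L 'b::complex_normed_vector"
  assumes "vector_holomorphic_on F U" "f \<in> cblinfun"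
  shows "(\<lambda>z. blinfun_apply f (blinfun_apply (F z) x)) holomorphic_on U"
  by (rule vector_holomorphic_on_functional[OF assms(1)]) (rule eval_functional[OF assms(2)])+

lemma vector_holomorphic_on_apply:
  fixes F :: "complex \<Rightarrow> 'a::complex_normed_vector \<Rightarrow>\<^sub>L 'b::complex_normed_vector"
  assumes "vector_holomorphic_on F U"
  shows "vector_holomorphic_on (\<lambda>z. F z x) U"
proof (rule vector_holomorphic_onI)
  fix z assume "z \<in> U"
  then have "(F has_derivative (\<lambda>h. h *\<^sub>C cderiv F z)) (at z)"
    using assms by (simp add: vector_holomorphic_on_def)
  then have "((\<lambda>w. F w x) has_derivative (\<lambda>h. (h *\<^sub>C cderiv F z) x)) (at z)"
    by (rule bounded_linear.has_derivative[OF blinfun.bounded_linear_left])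
  then show "\<exists>D. ((\<lambda>w. F w x) has_derivative (\<lambda>h. h *\<^sub>C D)) (at z)"
    by (auto simp: scaleC_blinfun.rep_eq)
qed

lemma cderiv_in_cblinfun:
  fixes P :: "complex \<Rightarrow> 'a::complex_normed_vector \<Rightarrow>\<^sub>L 'b::complex_normed_vector"
  assumes "vector_holomorphic_on P U" "z \<in> U" "\<And>w. P w \<in> cblinfun"
  shows "cderiv P z \<in> cblinfun"
proof (rule cblinfunI)
  fix c x
  define q where "q h = inverse h *\<^sub>C (P (z + h) - P z)" for h
  have q: "(q \<longlongrightarrow> cderiv P z) (at 0)"
    using assms(1,2) unfolding vector_holomorphic_on_def has_cderiv_iff_quotient q_def by blast
  have ap: "((\<lambda>h. q h u) \<longlongrightarrow> cderiv P z u) (at 0)" for u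
    by (intro blinfun.tendsto q tendsto_const)
  have "q h (c *\<^sub>C x) = c *\<^sub>C q h x" for h
    unfolding q_def using assms(3) by (intro cblinfun_scaleC cblinfun_scaleC_left cblinfun_diff)
  then have "((\<lambda>h. c *\<^sub>C q h x) \<longlongrightarrow> cderiv P z (c *\<^sub>C x)) (at 0)"
    using ap[of "c *\<^sub>C x"] by simp
  moreover have "((\<lambda>h. c *\<^sub>C q h x) \<longlongrightarrow> c *\<^sub>C cderiv P z x) (at 0)"
    by (intro scaleC.tendsto tendsto_const ap)
  ultimately show "cderiv P z (c *\<^sub>C x) = c *\<^sub>C cderiv P z x"
    by (rule tendsto_unique[rotated]) simp
qed

lemma linear_scaleCI:
  fixes g :: "'a::complex_normed_vector \<Rightarrow> complex"
  assumes "\<And>x y. g (x + y) = g x + g y" "\<And>c x. g (c *\<^sub>C x) = c * g x"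
  shows "Vector_Spaces.linear (*\<^sub>C) (*\<^sub>C) g"
  by unfold_locales (simp_all add: assms scaleC_complex_def algebra_simps)

lemma rank_shift_has_cderiv:
  assumes "(P has_derivative (\<lambda>h. h *\<^sub>C D)) (at z)"
  shows "((\<lambda>w. rank_shift (P w) n f y) has_derivative (\<lambda>h. h *\<^sub>C D)) (at z)"
  unfolding rank_shift_def using has_derivative_add[OF assms has_derivative_const] by simp

lemma vector_holomorphic_on_rank_shift:
  assumes "vector_holomorphic_on P U"
  shows "vector_holomorphic_on (\<lambda>w. rank_shift (P w) n f y) U"
    and "z \<in> U \<Longrightarrow> cderiv (\<lambda>w. rank_shift (P w) n f y) z = cderiv P z"
  using assms rank_shift_has_cderiv unfolding vector_holomorphic_on_def
  by (metis cderiv_unique)+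

text \<open>The constant finite rank shift leaves the derivative of \<open>P\<close> unchanged, and
  the minus sign from differentiating the inverse cancels the one in
  \<open>reduced_matrix\<close>.\<close>

lemma reduced_matrix_has_derivative:
  fixes P :: "complex \<Rightarrow> 'a::complex_banach \<Rightarrow>\<^sub>L 'b::complex_banach"
  assumes P: "vector_holomorphic_on P U" "\<And>z. z \<in> U \<Longrightarrow> P z \<in> cblinfun" and U: "open U" "z \<in> U"
    and f: "\<And>i. i < n \<Longrightarrow> f i \<in> cblinfun"
    and E: "\<And>z. z \<in> U \<Longrightarrow> op_invertible (rank_shift (P z) n f y)" and "i < n"
  defines "G \<equiv> \<lambda>z. op_inverse (rank_shift (P z) n f y)"
  shows "((\<lambda>z. reduced_matrix (P z) n f y i j) has_field_derivative f i (G z (cderiv P z (G z (y j))))) (at z)"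
proof -
  note S = vector_holomorphic_on_rank_shift[OF P(1), where n = n and f = f and y = y]
  have lin: "rank_shift (P z) n f y \<in> cblinfun" if "z \<in> U" for z
    by (intro cblinfun_rank_shift P f that)
  have "vector_holomorphic_on G U"
    unfolding G_def by (rule vector_holomorphic_on_op_inverse(1)[OF S(1) U(1)]) (auto intro: lin E)
  then have D: "(G has_derivative (\<lambda>h. h *\<^sub>C cderiv G z)) (at z)"
    using U(2) by (simp add: vector_holomorphic_on_def)
  have eq: "cderiv G z = - (G z o\<^sub>L cderiv P z o\<^sub>L G z)"
    unfolding G_def S(2)[OF U(2), symmetric]
    by (rule vector_holomorphic_on_op_inverse(2)[OF S(1) U(1)]) (auto intro: lin E U)
  from has_field_derivative_functional[OF D[unfolded eq] eval_functional[OF f[OF \<open>i < n\<close>]], of "y j"]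
  have "((\<lambda>w. f i (G w (y j))) has_field_derivative - f i (G z (cderiv P z (G z (y j))))) (at z)"
    by (simp add: blinfun.minus_left blinfun.minus_right)
  then show ?thesis
    unfolding reduced_matrix_def G_def[symmetric] by (auto intro!: derivative_eq_intros simp: G_def)
qed

lemma holomorphic_on_reduced_matrix:
  fixes P :: "complex \<Rightarrow> 'a::complex_banach \<Rightarrow>\<^sub>L 'b::complex_banach"
  assumes "vector_holomorphic_on P U" "\<And>z. z \<in> U \<Longrightarrow> P z \<in> cblinfun" and "open U"
    and "\<And>i. i < n \<Longrightarrow> f i \<in> cblinfun"
    and "\<And>z. z \<in> U \<Longrightarrow> op_invertible (rank_shift (P z) n f y)" and "i < n"
  shows "(\<lambda>z. reduced_matrix (P z) n f y i j) holomorphic_on U"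
  unfolding holomorphic_on_def field_differentiable_def
  using reduced_matrix_has_derivative[OF assms(1,2,3) _ assms(4,5,6)] by (meson has_field_derivative_at_within)

lemma holomorphic_on_reduced_det:
  fixes P :: "complex \<Rightarrow> 'a::complex_banach \<Rightarrow>\<^sub>L 'b::complex_banach"
  assumes "vector_holomorphic_on P U" "\<And>z. z \<in> U \<Longrightarrow> P z \<in> cblinfun" and "open U"
    and "\<And>i. i < n \<Longrightarrow> f i \<in> cblinfun"
    and "\<And>z. z \<in> U \<Longrightarrow> op_invertible (rank_shift (P z) n f y)"
  shows "(\<lambda>z. reduced_det (P z) n f y) holomorphic_on U"
  unfolding reduced_det_def by (intro holomorphic_on_fun_det holomorphic_on_reduced_matrix assms)

lemma open_op_invertible:
  fixes P :: "'t::t2_space \<Rightarrow> 'a::banach \<Rightarrow>\<^sub>L 'b::real_normed_vector"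
  assumes "continuous_on U P" "open U"
  shows "open {z \<in> U. op_invertible (P z)}"
proof (subst open_subopen, rule ballI)
  fix z assume z: "z \<in> {z \<in> U. op_invertible (P z)}"
  have "isCont P z"
    using assms z by (simp add: continuous_on_eq_continuous_at)
  then have "(P \<longlongrightarrow> P z) (at z)"
    by (simp add: isCont_def)
  then have "(P \<longlongrightarrow> P z) (nhds z)"
    by (simp add: tendsto_nhds_iff)
  then have "eventually (\<lambda>w. op_invertible (P w)) (nhds z)"
    using z by (intro eventually_op_invertible) auto
  moreover have "eventually (\<lambda>w. w \<in> U) (nhds z)"
    using z assms(2) by (intro eventually_nhds_in_open) auto
  ultimately have "eventually (\<lambda>w. w \<in> {z \<in> U. op_invertible (P z)}) (nhds z)"
    by eventually_elim simp
  then show "\<exists>T. open T \<and> z \<in> T \<and> T \<subseteq> {z \<in> U. op_invertible (P z)}"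
    unfolding eventually_nhds by blast
qed

text \<open>The circle need not be small: the integral is moved into the region where the local
  reduction is available by the residue theorem.\<close>

lemma contour_integral_isolating_disc:
  fixes P :: "complex \<Rightarrow> 'a::complex_banach \<Rightarrow>\<^sub>L 'b::complex_banach"
  assumes P: "vector_holomorphic_on P UNIV" "\<And>z. P z \<in> cblinfun"
    and disc: "isolating_disc P k (c, r)" and L: "L \<in> cblinfun"
  defines "F \<equiv> \<lambda>z. op_inverse (P z) o\<^sub>L cderiv P z"
  shows "blinfun_apply L ((vec_contour_integral (circlepath c r) F) x) = 2 * of_real pi * \<i> * residue (\<lambda>z. blinfun_apply L (F z x)) k"
proof -
  have k: "k \<in> ball c r" and inv: "\<And>z. z \<in> cball c r - {k} \<Longrightarrow> op_invertible (P z)"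
    using disc by (auto simp: isolating_disc_def)
  have r: "r > 0" using k by (auto intro: le_less_trans[OF zero_le_dist])
  define V where "V = {z. op_invertible (P z)}"
  have V: "open V"
    using open_op_invertible[OF vector_holomorphic_on_imp_continuous_on[OF P(1)]] by (simp add: V_def)
  have "vector_holomorphic_on (\<lambda>z. op_inverse (P z)) V"
    by (rule vector_holomorphic_on_op_inverse(1)[OF vector_holomorphic_on_subset[OF P(1)] V P(2)]) (auto simp: V_def)
  moreover have "vector_holomorphic_on (cderiv P) V"
    by (rule vector_holomorphic_on_subset[OF vector_holomorphic_on_cderiv[OF P(1)]]) auto
  ultimately have F: "vector_holomorphic_on F V"
    unfolding F_def using P(2) by (intro vector_holomorphic_on_compose cblinfun_op_inverse) (auto simp: V_def)
  \<comment> \<open>A connected open set containing the closed disc, as the residue theorem demands.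
    Passing to the component of \<open>c\<close> discards the other parts of \<open>V\<close>; apart
    from \<open>k\<close>, it still consists of points where \<open>P\<close> is invertible.\<close>
  define S where "S = connected_component_set (V \<union> ball c r) c"
  have cb: "cball c r \<subseteq> V \<union> ball c r"
  proof
    fix z assume "z \<in> cball c r"
    then show "z \<in> V \<union> ball c r" using inv[of z] k by (cases "z = k") (auto simp: V_def)
  qed
  have S: "open S" "connected S" "cball c r \<subseteq> S" "S \<subseteq> V \<union> ball c r"
    unfolding S_def
    subgoal using V by (intro open_connected_component open_Un open_ball)
    subgoal by (rule connected_connected_component)
    subgoal using r cb by (intro connected_component_maximal connected_cball) auto
    subgoal by (rule connected_component_subset)
    done
  have SV: "S - {k} \<subseteq> V"
  proof
    fix z assume "z \<in> S - {k}"
    then show "z \<in> V" using S(4) inv[of z] by (auto simp: V_def)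
  qed
  have img: "path_image (circlepath c r) \<subseteq> S - {k}"
    using S(3) k r by (auto simp: subset_iff)
  note E = eval_functional[OF L, where x = x]
  have "blinfun_apply L ((vec_contour_integral (circlepath c r) F) x) = contour_integral (circlepath c r) (\<lambda>z. blinfun_apply L (F z x))"
    by (rule vec_contour_integral_functional[OF _ E])
       (use vector_holomorphic_on_imp_continuous_on[OF F] img SV in \<open>blast intro: continuous_on_subset\<close>)
  also have "\<dots> = of_real (2 * pi) * \<i> * (\<Sum>p\<in>{k}. winding_number (circlepath c r) p * residue (\<lambda>z. blinfun_apply L (F z x)) p)"
  proof (rule Residue_theorem[OF S(1,2)])
    show "(\<lambda>z. blinfun_apply L (F z x)) holomorphic_on S - {k}"
      using vector_holomorphic_on_eval[OF F L] SV by (rule holomorphic_on_subset)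
    show "\<forall>z. z \<notin> S \<longrightarrow> winding_number (circlepath c r) z = 0"
    proof (intro allI impI)
      fix z assume "z \<notin> S"
      then have "z \<notin> cball c r" using S(3) by blast
      then show "winding_number (circlepath c r) z = 0"
        using r by (intro winding_number_zero_outside[of _ "cball c r"]) auto
    qed
  qed (use img in auto)
  also have "\<dots> = 2 * of_real pi * \<i> * residue (\<lambda>z. blinfun_apply L (F z x)) k"
    using winding_number_circlepath[of k c r] k by (simp add: dist_norm norm_minus_commute)
  finally show ?thesis .
qed

text \<open>The numbers \<open>\<phi> i z (G z (y i))\<close> add up to the logarithmic derivative
  of \<open>d\<close>, but the trace may be evaluated only once the integral is a finite sum of rank
  one maps. Both facts must refer to the same Taylor coefficients \<open>a i m\<close>, which is why
  \<open>finite_rank_residue\<close> delivers its two conclusions for one sequence.\<close>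

lemma op_trace_logderiv:
  fixes P :: "complex \<Rightarrow> 'a::complex_banach \<Rightarrow>\<^sub>L 'b::complex_banach"
  assumes P: "vector_holomorphic_on P UNIV" "\<And>z. P z \<in> cblinfun"
    and disc: "isolating_disc P k (c, r)"
    and U: "open U" "k \<in> U" and f: "\<And>i. i < n \<Longrightarrow> f i \<in> cblinfun"
    and E: "\<And>z. z \<in> U \<Longrightarrow> op_invertible (rank_shift (P z) n f y)"
  shows "op_trace (vec_contour_integral (circlepath c r) (\<lambda>z. op_inverse (P z) o\<^sub>L cderiv P z))
    = 2 * of_real pi * \<i> * of_int (zorder (\<lambda>z. reduced_det (P z) n f y) k)"
proof -
  define d where "d z = reduced_det (P z) n f y" for z
  define G where "G z = op_inverse (rank_shift (P z) n f y)" for z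
  define H where "H z = G z o\<^sub>L cderiv P z" for z
  define A where "A z i j = fun_adj n (reduced_matrix (P z) n f y) i j" for z i j
  \<comment> \<open>The coefficient of \<open>G z (y i)\<close> in the Woodbury formula for
    \<open>op_inverse (P z)\<close> applied to \<open>cderiv P z x\<close>. Near \<open>k\<close>
    its only singularity comes from the denominator \<open>d z\<close>.\<close>
  define \<phi> where "\<phi> i z x = (\<Sum>j<n. A z i j / d z * f j (H z x))" for i z x
  define F where "F z = op_inverse (P z) o\<^sub>L cderiv P z" for z
  define T where "T = vec_contour_integral (circlepath c r) F"
  have k: "k \<in> ball c r" and inv: "\<And>z. z \<in> cball c r - {k} \<Longrightarrow> op_invertible (P z)"
    using disc by (auto simp: isolating_disc_def)
  obtain \<rho>1 where \<rho>1: "\<rho>1 > 0" "ball k \<rho>1 \<subseteq> U \<inter> ball c r"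
    using U k by (meson IntI open_Int open_ball open_contains_ball)
  have PU: "vector_holomorphic_on P U" using P(1) by (rule vector_holomorphic_on_subset) simp
  have lin: "rank_shift (P z) n f y \<in> cblinfun" for z
    by (intro cblinfun_rank_shift P f)
  have G: "vector_holomorphic_on G U" "\<And>z. z \<in> U \<Longrightarrow> G z \<in> cblinfun"
    unfolding G_def using E
    by (auto intro!: vector_holomorphic_on_op_inverse(1) vector_holomorphic_on_rank_shift PU U lin cblinfun_op_inverse)
  have P': "vector_holomorphic_on (cderiv P) U"
    by (rule vector_holomorphic_on_cderiv[OF PU U(1)])
  have H: "vector_holomorphic_on H U"
    unfolding H_def by (rule vector_holomorphic_on_compose[OF G(1) P' G(2)])
  have M: "(\<lambda>z. reduced_matrix (P z) n f y i j) holomorphic_on U" if "i < n" for i j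
    by (rule holomorphic_on_reduced_matrix[OF PU P(2) U(1) f E that])
  have d: "d holomorphic_on U"
    unfolding d_def by (rule holomorphic_on_reduced_det[OF PU P(2) U(1) f E])
  have A: "(\<lambda>z. A z i j) holomorphic_on U" if "i < n" "j < n" for i j
    unfolding A_def by (rule holomorphic_on_fun_adj[OF M that])
  have d_nz: "d z \<noteq> 0" if "z \<in> ball k \<rho>1 - {k}" for z
  proof
    assume "d z = 0"
    then have "op_ker (P z) \<noteq> {0}"
      unfolding d_def by (intro reduced_det_eq_0_imp_kernel[OF f P(2) E]) (use that \<rho>1 in auto)
    moreover have "op_invertible (P z)" using that \<rho>1 by (intro inv) auto
    ultimately show False using op_ker_invertible by blast
  qed
  have "k + of_real (\<rho>1/2) \<in> ball k \<rho>1 - {k}" using \<rho>1(1) by (auto simp: dist_norm)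
  then have nz: "\<exists>w\<in>ball k \<rho>1. d w \<noteq> 0" using d_nz by blast
  have dB: "d holomorphic_on ball k \<rho>1" using d by (rule holomorphic_on_subset) (use \<rho>1 in auto)
  \<comment> \<open>The order of the zero of \<open>d\<close> at \<open>k\<close> bounds the order
    of the pole of every \<open>\<phi> i\<close>, hence the number of Taylor coefficients to be
    kept.\<close>
  define N where "N = nat (zorder d k)"
  define g where "g = zor_poly d k"
  have kB: "k \<in> ball k \<rho>1" using \<rho>1 by simp
  obtain \<rho> where \<rho>: "\<rho> > 0" "cball k \<rho> \<subseteq> ball k \<rho>1" "g holomorphic_on cball k \<rho>"
     "\<And>w. w \<in> cball k \<rho> \<Longrightarrow> d w = g w * (w - k) ^ N \<and> g w \<noteq> 0"
    using zorder_exist_zero[OF dB open_ball connected_ball kB nz] unfolding g_def N_def by blast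
  have "cball k \<rho> \<subseteq> U" using \<rho>(2) \<rho>1(2) by blast
  then have sub: "ball k \<rho> - {k} \<subseteq> U" "ball k \<rho> \<subseteq> U" "cball k \<rho> \<subseteq> U" "ball k \<rho> - {k} \<subseteq> ball k \<rho>1 - {k}"
    using ball_subset_cball[of k \<rho>] \<rho>(2) by blast+
  have Fx: "F z x = H z x + (\<Sum>i<n. \<phi> i z x *\<^sub>C G z (y i))" if z: "z \<in> ball k \<rho> - {k}" for z x
  proof -
    have "F z x = op_inverse (P z) (cderiv P z x)" by (simp add: F_def)
    also have "\<dots> = H z x + (\<Sum>i<n. \<phi> i z x *\<^sub>C G z (y i))"
      unfolding H_def \<phi>_def A_def d_def G_def blinfun_apply_blinfun_compose
      by (rule reduced_det_neq_0_imp_invertible(2)[OF f P(2) E]) (use d_nz[of z] z sub in \<open>auto simp: d_def\<close>)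
    finally show ?thesis .
  qed
  have \<phi>_hol: "(\<lambda>z. \<phi> i z x) holomorphic_on ball k \<rho> - {k}" if "i < n" for i x
    unfolding \<phi>_def using that d_nz sub f
    by (intro holomorphic_intros holomorphic_on_subset[OF A] holomorphic_on_subset[OF d]
        holomorphic_on_subset[OF vector_holomorphic_on_eval[OF H]]) auto
  have H_lin: "H z \<in> cblinfun" if "z \<in> U" for z
    unfolding H_def by (intro cblinfun_compose G(2) that cderiv_in_cblinfun[OF PU that P(2)])
  have HG: "vector_holomorphic_on (\<lambda>z. H z o\<^sub>L G z) U"
    by (rule vector_holomorphic_on_compose[OF H G(1) H_lin])
  have \<phi>G_hol: "(\<lambda>z. \<phi> i z (G z (y i))) holomorphic_on ball k \<rho> - {k}" if "i < n" for i
  proof -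
    have "(\<lambda>z. \<Sum>j<n. A z i j / d z * f j ((H z o\<^sub>L G z) (y i))) holomorphic_on ball k \<rho> - {k}"
      using that d_nz sub f
      by (intro holomorphic_intros holomorphic_on_subset[OF A] holomorphic_on_subset[OF d]
          holomorphic_on_subset[OF vector_holomorphic_on_eval[OF HG]]) auto
    then show ?thesis by (simp add: \<phi>_def)
  qed
  have \<phi>_add: "\<phi> i z (x + x') = \<phi> i z x + \<phi> i z x'" for i z x x'
    by (simp add: \<phi>_def blinfun.add_right distrib_left sum.distrib)
  have \<phi>_scale: "\<phi> i z (c *\<^sub>C x) = c * \<phi> i z x" if "z \<in> U" for i z c x
    by (simp add: \<phi>_def cblinfun_scaleC[OF H_lin[OF that]] cblinfun_scale_mult[OF f] sum_distrib_left mult_ac)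
  have \<phi>_lin: "Vector_Spaces.linear (*\<^sub>C) (*\<^sub>C) (\<phi> i z)" if "z \<in> ball k \<rho> - {k}" for i z
    using that sub by (intro linear_scaleCI \<phi>_add \<phi>_scale) auto
  \<comment> \<open>Multiplication by \<open>(z - k) ^ N\<close> replaces the denominator
    \<open>d\<close> by the zero-free \<open>g\<close>, and compactness of the closed disc bounds
    the remaining factors independently of \<open>x\<close>.\<close>
  have \<phi>_bound: "\<exists>B. \<forall>z\<in>ball k \<rho> - {k}. \<forall>x. cmod (\<phi> i z x) * cmod (z - k) ^ N \<le> B * norm x" if i: "i < n" for i
  proof -
    define b where "b z = (\<Sum>j<n. cmod (A z i j) / cmod (g z) * (norm (f j) * norm (H z)))" for z
    have "continuous_on (cball k \<rho>) b"
      unfolding b_def using i \<rho>(4) sub(3)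
      by (intro continuous_intros continuous_on_subset[OF holomorphic_on_imp_continuous_on[OF A]]
          holomorphic_on_imp_continuous_on[OF \<rho>(3)]
          continuous_on_subset[OF vector_holomorphic_on_imp_continuous_on[OF H]]) auto
    then have "compact (b ` cball k \<rho>)" by (intro compact_continuous_image compact_cball)
    then obtain B where B: "\<And>z. z \<in> cball k \<rho> \<Longrightarrow> norm (b z) \<le> B"
      by (meson bounded_iff compact_imp_bounded imageI)
    have "cmod (\<phi> i z x) * cmod (z - k) ^ N \<le> B * norm x" if z: "z \<in> ball k \<rho> - {k}" for z x
    proof -
      have dz: "d z = g z * (z - k) ^ N" "g z \<noteq> 0" using \<rho>(4)[of z] z by auto
      have "cmod (\<phi> i z x) * cmod (z - k) ^ N \<le> (\<Sum>j<n. cmod (A z i j / d z * f j (H z x))) * cmod (z - k) ^ N"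
        unfolding \<phi>_def by (intro mult_right_mono norm_sum) auto
      also have "\<dots> = (\<Sum>j<n. cmod (A z i j) / cmod (g z) * cmod (f j (H z x)))"
        unfolding sum_distrib_right using dz z by (intro sum.cong) (auto simp: norm_mult norm_divide norm_power)
      also have "\<dots> \<le> (\<Sum>j<n. cmod (A z i j) / cmod (g z) * (norm (f j) * (norm (H z) * norm x)))"
        by (intro sum_mono mult_left_mono order_trans[OF norm_blinfun] norm_blinfun) auto
      also have "\<dots> = b z * norm x" 
        unfolding b_def sum_distrib_right by (intro sum.cong refl) simp
      also have "\<dots> \<le> B * norm x" using B[of z] z by (intro mult_right_mono) auto
      finally show ?thesis .
    qed
    then show ?thesis by blast
  qed
  define Q where "Q i a \<longleftrightarrow> (\<forall>L\<in>cblinfun. \<forall>x. residue (\<lambda>z. \<phi> i z x * blinfun_apply L (G z (y i))) k =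
          (\<Sum>m<N. residue (\<lambda>z. \<phi> i z x * (z - k) ^ m) k * blinfun_apply L (a m))) \<and>
      residue (\<lambda>z. \<phi> i z (G z (y i))) k = (\<Sum>m<N. residue (\<lambda>z. \<phi> i z (a m) * (z - k) ^ m) k)"
    for i a
  have "\<exists>a. Q i a" if i: "i < n" for i
  proof -
    obtain B where B: "\<And>z x. z \<in> ball k \<rho> - {k} \<Longrightarrow> cmod (\<phi> i z x) * cmod (z - k) ^ N \<le> B * norm x"
      using \<phi>_bound[OF i] by blast
    have v: "vector_holomorphic_on (\<lambda>z. G z (y i)) (ball k \<rho>)"
      by (rule vector_holomorphic_on_apply[OF vector_holomorphic_on_subset[OF G(1) sub(2)]])
    show ?thesis
      apply (rule finite_rank_residue[OF v \<rho>(1) \<phi>_hol[OF i] \<phi>G_hol[OF i] \<phi>_lin B])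
        apply assumption+
      subgoal premises prems for a
        unfolding Q_def by (rule exI[of _ a]) (simp add: prems)
      done
  qed
  then have "\<exists>a. \<forall>i\<in>{..<n}. Q i (a i)" by (intro bchoice) simp
  then obtain a where a: "\<And>i L x. i < n \<Longrightarrow> L \<in> cblinfun \<Longrightarrow> residue (\<lambda>z. \<phi> i z x * blinfun_apply L (G z (y i))) k =
          (\<Sum>m<N. residue (\<lambda>z. \<phi> i z x * (z - k) ^ m) k * blinfun_apply L (a i m))"
      "\<And>i. i < n \<Longrightarrow> residue (\<lambda>z. \<phi> i z (G z (y i))) k = (\<Sum>m<N. residue (\<lambda>z. \<phi> i z (a i m) * (z - k) ^ m) k)"
    unfolding Q_def by blast
  define \<psi> where "\<psi> i m x = residue (\<lambda>z. \<phi> i z x * (z - k) ^ m) k" for i m x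
  have ev: "eventually (\<lambda>z. z \<in> ball k \<rho> - {k}) (at k)"
    using \<rho>(1) by (intro eventually_at_in_open) auto
  have kr: "k \<in> ball k \<rho>" using \<rho>(1) by simp
  have \<psi>_lin: "Vector_Spaces.linear (*\<^sub>C) (*\<^sub>C) (\<lambda>x. 2 * of_real pi * \<i> * \<psi> i m x)" if i: "i < n" for i m
  proof (rule linear_scaleCI)
    have hol: "(\<lambda>z. \<phi> i z x * (z - k) ^ m) holomorphic_on ball k \<rho> - {k}" for x
      by (intro holomorphic_intros \<phi>_hol i)
    have "\<psi> i m (x + x') = \<psi> i m x + \<psi> i m x'" for x x'
      unfolding \<psi>_def \<phi>_add distrib_right by (rule residue_add[OF open_ball kr hol hol])
    then show "2 * of_real pi * \<i> * \<psi> i m (x + x') = 2 * of_real pi * \<i> * \<psi> i m x + 2 * of_real pi * \<i> * \<psi> i m x'" for x x'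
      by (simp add: distrib_left)
    have "\<psi> i m (c *\<^sub>C x) = residue (\<lambda>z. c * (\<phi> i z x * (z - k) ^ m)) k" for c x
      unfolding \<psi>_def
      by (rule residue_cong[OF eventually_mono[OF ev] refl]) (use sub \<phi>_scale in auto)
    then have "\<psi> i m (c *\<^sub>C x) = c * \<psi> i m x" for c x
      unfolding \<psi>_def using residue_lmul[OF open_ball kr hol] by simp
    then show "2 * of_real pi * \<i> * \<psi> i m (c *\<^sub>C x) = c * (2 * of_real pi * \<i> * \<psi> i m x)" for c x
      by simp
  qed
  \<comment> \<open>Tested against a functional, the integral becomes \<open>2 \<pi> \<i>\<close>
    times a residue. The summand \<open>H z x\<close> is holomorphic at \<open>k\<close> and drops
    out; the others are finite combinations of the fixed vectors \<open>a i m\<close>, which is the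
    finite rank form that \<open>op_trace_eq_sum\<close> wants.\<close>
  have T: "T x = (\<Sum>p\<in>{..<n} \<times> {..<N}. (2 * of_real pi * \<i> * \<psi> (fst p) (snd p) x) *\<^sub>C a (fst p) (snd p))" for x
  proof (rule functional_separates)
    fix L :: "'a \<Rightarrow>\<^sub>L complex" assume L: "L \<in> cblinfun"
    have LG: "(\<lambda>z. blinfun_apply L (G z (y i))) holomorphic_on ball k \<rho> - {k}" for i
      by (rule holomorphic_on_subset[OF vector_holomorphic_on_eval[OF G(1) L] sub(1)])
    have LH: "(\<lambda>z. blinfun_apply L (H z x)) holomorphic_on U"
      by (rule vector_holomorphic_on_eval[OF H L])
    have "blinfun_apply L (T x) = 2 * of_real pi * \<i> * residue (\<lambda>z. blinfun_apply L (F z x)) k"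
      unfolding T_def F_def by (rule contour_integral_isolating_disc[OF P disc L])
    also have "residue (\<lambda>z. blinfun_apply L (F z x)) k =
        residue (\<lambda>z. blinfun_apply L (H z x) + (\<Sum>i<n. \<phi> i z x * blinfun_apply L (G z (y i)))) k"
      by (rule residue_cong[OF eventually_mono[OF ev] refl])
         (simp add: Fx blinfun.add_right blinfun.sum_right cblinfun_scale_mult[OF L])
    also have "\<dots> = residue (\<lambda>z. blinfun_apply L (H z x)) k + residue (\<lambda>z. \<Sum>i<n. \<phi> i z x * blinfun_apply L (G z (y i))) k"
      by (rule residue_add[OF open_ball kr])
         (use sub in \<open>auto intro!: holomorphic_intros LG \<phi>_hol holomorphic_on_subset[OF LH]\<close>)
    also have "residue (\<lambda>z. blinfun_apply L (H z x)) k = 0"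
      by (rule residue_holo[OF U LH])
    also have "residue (\<lambda>z. \<Sum>i<n. \<phi> i z x * blinfun_apply L (G z (y i))) k = (\<Sum>i<n. residue (\<lambda>z. \<phi> i z x * blinfun_apply L (G z (y i))) k)"
      by (rule residue_sum[OF open_ball kr]) (auto intro!: holomorphic_intros LG \<phi>_hol)
    also have "\<dots> = (\<Sum>i<n. \<Sum>m<N. \<psi> i m x * blinfun_apply L (a i m))"
      by (intro sum.cong refl) (simp add: a(1)[OF _ L] \<psi>_def)
    also have "2 * of_real pi * \<i> * (0 + (\<Sum>i<n. \<Sum>m<N. \<psi> i m x * blinfun_apply L (a i m)))
      = blinfun_apply L (\<Sum>p\<in>{..<n} \<times> {..<N}. (2 * of_real pi * \<i> * \<psi> (fst p) (snd p) x) *\<^sub>C a (fst p) (snd p))"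
      by (simp add: blinfun.sum_right cblinfun_scale_mult[OF L] sum.cartesian_product sum_distrib_left case_prod_beta mult.assoc)
    finally show "blinfun_apply L (T x) = \<dots>" .
  qed
  \<comment> \<open>Jacobi's formula pairs the derivative of the matrix entry \<open>(i, j)\<close>
    with the adjugate entry \<open>(j, i)\<close>; after exchanging the sums this is exactly
    \<open>d z\<close> times the sum of the \<open>\<phi> j z (G z (y j))\<close>.\<close>
  have logd: "(\<Sum>i<n. \<phi> i z (G z (y i))) = deriv d z / d z" if z: "z \<in> ball k \<rho> - {k}" for z
  proof -
    have zU: "z \<in> U" using z sub by auto
    have "(d has_field_derivative (\<Sum>i<n. \<Sum>j<n. f i (G z (cderiv P z (G z (y j)))) * fun_adj n (reduced_matrix (P z) n f y) j i)) (at z)"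
      unfolding d_def reduced_det_def G_def
      by (intro has_field_derivative_fun_det reduced_matrix_has_derivative[OF PU P(2) U(1) zU f E])
    then have "deriv d z = (\<Sum>i<n. \<Sum>j<n. f i (H z (G z (y j))) * A z j i)"
      unfolding A_def H_def by (simp add: DERIV_imp_deriv)
    also have "\<dots> = (\<Sum>j<n. \<Sum>i<n. f i (H z (G z (y j))) * A z j i)" by (rule sum.swap)
    finally show ?thesis by (simp add: \<phi>_def sum_divide_distrib mult.commute)
  qed
  have "op_trace T = (\<Sum>p\<in>{..<n} \<times> {..<N}. 2 * of_real pi * \<i> * \<psi> (fst p) (snd p) (a (fst p) (snd p)))"
    by (rule op_trace_eq_sum[OF _ T]) (use \<psi>_lin in auto)
  also have "\<dots> = 2 * of_real pi * \<i> * (\<Sum>i<n. \<Sum>m<N. \<psi> i m (a i m))"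
    by (simp add: sum.cartesian_product sum_distrib_left case_prod_beta)
  also have "(\<Sum>i<n. \<Sum>m<N. \<psi> i m (a i m)) = (\<Sum>i<n. residue (\<lambda>z. \<phi> i z (G z (y i))) k)"
    by (intro sum.cong refl) (simp add: a(2) \<psi>_def)
  also have "\<dots> = residue (\<lambda>z. \<Sum>i<n. \<phi> i z (G z (y i))) k"
    by (rule residue_sum[OF open_ball kr, symmetric]) (use \<phi>G_hol in auto)
  also have "\<dots> = residue (\<lambda>z. deriv d z / d z) k"
    by (rule residue_cong[OF eventually_mono[OF ev] refl]) (rule logd)
  also have "\<dots> = of_int (zorder d k)"
    by (rule residue_logderiv[OF dB open_ball connected_ball kB nz])
  finally show ?thesis unfolding T_def F_def d_def[abs_def] .
qed

subsection \<open>Lattices\<close>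

lemma int_multiple_in_group:
  fixes G :: "complex set"
  assumes "0 \<in> G" "\<And>x y. x \<in> G \<Longrightarrow> y \<in> G \<Longrightarrow> x + y \<in> G" "\<And>x. x \<in> G \<Longrightarrow> - x \<in> G" "x \<in> G"
  shows "of_int n * x \<in> G"
proof -
  have nat: "of_nat k * x \<in> G" for k
    by (induction k) (use assms in \<open>auto simp: distrib_right\<close>)
  show ?thesis
  proof (cases n rule: int_cases2)
    case (nonneg k) then show ?thesis using nat[of k] by simp
  next
    case (nonpos k) then show ?thesis using assms(3)[OF nat[of k]] by simp
  qed
qed

text \<open>Rank 2 provides two elements independent over the integers, and discreteness makes them
  independent over the reals: if \<open>b\<close> were a real multiple of \<open>a\<close>,
  Dirichlet's approximation theorem would give nonzero integer combinations of arbitrarily small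
  modulus. Rounding down real coordinates then leaves a bounded remainder.\<close>

lemma complex_lattice_cocompact:
  assumes "complex_lattice \<Gamma>"
  obtains R where "\<And>z. \<exists>\<gamma>\<in>\<Gamma>. cmod (z - \<gamma>) \<le> R"
proof -
  have grp: "0 \<in> \<Gamma>" "\<And>x y. x \<in> \<Gamma> \<Longrightarrow> y \<in> \<Gamma> \<Longrightarrow> x + y \<in> \<Gamma>" "\<And>x. x \<in> \<Gamma> \<Longrightarrow> - x \<in> \<Gamma>"
    and disc: "discrete \<Gamma>" and rank: "has_int_rank \<Gamma> 2"
    using assms by (auto simp: complex_lattice_def)
  obtain B where B: "B \<subseteq> \<Gamma>" "card B = 2" "int_independent B"
    using rank by (auto simp: has_int_rank_def)
  obtain a b where ab: "B = {a, b}" "a \<noteq> b" using B(2) by (auto simp: card_2_iff)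
  then have G: "a \<in> \<Gamma>" "b \<in> \<Gamma>" using B(1) by auto
  have indep: "m = 0 \<and> n = 0" if "of_int m * a + of_int n * b = 0" for m n :: int
  proof (rule ccontr)
    assume "\<not> (m = 0 \<and> n = 0)"
    then have "\<exists>v\<in>B. (if v = a then m else n) \<noteq> 0" using ab by auto
    moreover have "(\<Sum>v\<in>B. of_int (if v = a then m else n) * v) = 0" using that ab by simp
    ultimately have "module.dependent (\<lambda>(n::int) (z::complex). of_int n * z) B"
      unfolding module.dependent_explicit[OF module_int_complex]
      by (intro exI[of _ B] exI[of _ "\<lambda>v. if v = a then m else n"]) (simp add: ab(1))
    then show False using B(3) by (simp add: int_independent_def)
  qed
  have a0: "a \<noteq> 0" using indep[of 1 0] by auto
  have mem: "of_int m * a + of_int n * b \<in> \<Gamma>" for m n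
    by (intro grp(2) int_multiple_in_group grp G)
  have "Im (b / a) \<noteq> 0"
  proof
    assume "Im (b / a) = 0"
    define \<theta> where "\<theta> = Re (b / a)"
    have "b / a = of_real \<theta>" using \<open>Im (b / a) = 0\<close> by (simp add: complex_eq_iff \<theta>_def)
    then have b: "b = of_real \<theta> * a" using a0 by (simp add: field_simps)
    obtain e where e: "e > 0" "\<And>y. y \<in> \<Gamma> \<Longrightarrow> dist 0 y < e \<Longrightarrow> y = 0"
      using discreteD[OF disc grp(1)] unfolding isolated_in_dist_Ex_iff by blast
    \<comment> \<open>With this \<open>N\<close>, an approximation error below \<open>1 / N\<close>
      makes the combination shorter than \<open>e\<close>, the radius in which 0 is the only element
      of the lattice.\<close>
    obtain N :: nat where N: "cmod a / e < real N" using reals_Archimedean2 by blast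
    have "0 \<le> cmod a / e" using e(1) by simp
    then have N0: "N > 0" using N by (metis gr0I le_less_trans less_irrefl of_nat_0)
    obtain h k where hk: "0 < k" "\<bar>of_int k * \<theta> - of_int h\<bar> < 1 / real N"
      using Dirichlet_approx[OF N0, of \<theta>] by blast
    define y where "y = of_int (- h) * a + of_int k * b"
    have "y = of_real (of_int k * \<theta> - of_int h) * a"
      by (simp add: y_def b algebra_simps)
    then have "cmod y = \<bar>of_int k * \<theta> - of_int h\<bar> * cmod a"
      by (simp only: norm_mult norm_of_real)
    also have "\<dots> < 1 / real N * cmod a" using hk(2) a0 by (intro mult_strict_right_mono) auto
    also have "\<dots> < e" using N N0 e(1) by (simp add: field_simps)
    finally have "y = 0" using mem[of "- h" k] by (intro e(2)) (simp_all add: y_def)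
    then show False using indep[of "- h" k] hk(1) by (simp add: y_def)
  qed
  show ?thesis
  proof (rule that[of "cmod a + cmod b"])
    fix z
    define t where "t = Im (z / a) / Im (b / a)"
    define s where "s = Re (z / a) - t * Re (b / a)"
    have "\<zeta> = of_real (Re \<zeta> - Im \<zeta> / Im w * Re w) + of_real (Im \<zeta> / Im w) * w" if "Im w \<noteq> 0" for \<zeta> w
      using that by (simp add: complex_eq_iff)
    from this[OF \<open>Im (b / a) \<noteq> 0\<close>, of "z / a"] have "z / a = of_real s + of_real t * (b / a)"
      unfolding s_def t_def .
    then have z: "z = of_real s * a + of_real t * b" using a0 by (simp add: field_simps)
    define \<gamma> where "\<gamma> = of_int \<lfloor>s\<rfloor> * a + of_int \<lfloor>t\<rfloor> * b"
    have "z - \<gamma> = of_real (frac s) * a + of_real (frac t) * b"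
      by (simp add: z \<gamma>_def frac_def algebra_simps)
    also have "cmod \<dots> \<le> frac s * cmod a + frac t * cmod b"
      by (rule order_trans[OF norm_triangle_ineq]) (simp add: norm_mult)
    also have "\<dots> \<le> 1 * cmod a + 1 * cmod b"
      by (intro add_mono mult_right_mono) (auto simp: frac_lt_1 less_imp_le)
    finally have "cmod (z - \<gamma>) \<le> cmod a + cmod b" by simp
    moreover have "\<gamma> \<in> \<Gamma>" unfolding \<gamma>_def by (rule mem)
    ultimately show "\<exists>\<gamma>\<in>\<Gamma>. cmod (z - \<gamma>) \<le> cmod a + cmod b" by blast
  qed
qed

subsection \<open>Families with two parameters\<close>

text \<open>Analytic Fredholm theory by connectedness: near each point non-invertibility is the
  vanishing of a holomorphic determinant, so \<open>V\<close> either contains a whole neighbourhood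
  or misses one. The domain is general because the lemma is applied in \<open>k\<close> with
  \<open>\<alpha>\<close> fixed and also in \<open>\<alpha>\<close> with \<open>k\<close>
  fixed.\<close>

lemma eventually_invertible_punctured:
  fixes P :: "complex \<Rightarrow> 'a::complex_banach \<Rightarrow>\<^sub>L 'b::complex_banach"
  assumes P: "vector_holomorphic_on P U" "\<And>z. z \<in> U \<Longrightarrow> P z \<in> cblinfun"
    and fr: "\<And>z. z \<in> U \<Longrightarrow> fredholm (P z) \<and> fredholm_index (P z) = 0"
    and U: "open U" "connected U" and z0: "z0 \<in> U" "op_invertible (P z0)" and z: "z \<in> U"
  shows "eventually (\<lambda>w. op_invertible (P w)) (at z)"
proof -
  define V where "V = {z \<in> U. eventually (\<lambda>w. op_invertible (P w)) (at z)}"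
  have dich: "\<exists>T. open T \<and> w \<in> T \<and> T \<subseteq> U \<and> (T \<subseteq> V \<or> T \<inter> V = {})" if w: "w \<in> U" for w
  proof -
    obtain n and f :: "nat \<Rightarrow> 'a \<Rightarrow>\<^sub>L complex" and y where f: "\<And>i. i < n \<Longrightarrow> f i \<in> cblinfun"
        and inv: "op_invertible (rank_shift (P w) n f y)"
      unfolding rank_shift_def using fredholm_invertible_perturbation[OF P(2)[OF w]] fr[OF w] by metis
    define W where "W = {z \<in> U. op_invertible (rank_shift (P z) n f y)}"
    have "open W"
      unfolding W_def using U(1)
      by (rule open_op_invertible[rotated])
         (rule vector_holomorphic_on_imp_continuous_on[OF vector_holomorphic_on_rank_shift(1)[OF P(1)]])
    moreover have "w \<in> W" using inv w by (simp add: W_def)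
    ultimately obtain \<rho> where \<rho>: "\<rho> > 0" "ball w \<rho> \<subseteq> W" by (meson open_contains_ball)
    have sub: "ball w \<rho> \<subseteq> U" using \<rho>(2) by (auto simp: W_def)
    define d where "d z = reduced_det (P z) n f y" for z
    have d: "d holomorphic_on ball w \<rho>"
      unfolding d_def
      by (rule holomorphic_on_reduced_det[OF vector_holomorphic_on_subset[OF P(1) sub] _ open_ball f])
         (use \<rho>(2) sub P(2) in \<open>auto simp: W_def\<close>)
    have inv_iff: "op_invertible (P z) \<longleftrightarrow> d z \<noteq> 0" if "z \<in> ball w \<rho>" for z
    proof -
      have "op_invertible (rank_shift (P z) n f y)" "P z \<in> cblinfun" using that \<rho>(2) sub P(2) by (auto simp: W_def)
      note inv = this(2,1)
      show ?thesis
      proof (cases "d z = 0")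
        case True
        then have "op_ker (P z) \<noteq> {0}"
          unfolding d_def using reduced_det_eq_0_imp_kernel[OF f inv] by blast
        then show ?thesis using True op_ker_invertible by blast
      next
        case False
        then have "op_invertible (P z)"
          unfolding d_def using reduced_det_neq_0_imp_invertible(1)[OF f inv] by blast
        then show ?thesis using False by blast
      qed
    qed
    show ?thesis
    proof (cases "\<forall>z\<in>ball w \<rho>. d z = 0")
      case True
      have "ball w \<rho> \<inter> V = {}"
      proof (rule equals0I)
        fix z assume z: "z \<in> ball w \<rho> \<inter> V"
        then have "eventually (\<lambda>u. u \<in> ball w \<rho>) (at z)"
          by (intro eventually_at_in_open') auto
        moreover have "eventually (\<lambda>u. op_invertible (P u)) (at z)" using z by (simp add: V_def)
        ultimately have "eventually (\<lambda>u. False) (at z)"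
          by eventually_elim (use inv_iff True in blast)
        then show False by simp
      qed
      then show ?thesis using \<rho>(1) sub by (intro exI[of _ "ball w \<rho>"]) auto
    next
      case False
      then obtain \<beta> where \<beta>: "\<beta> \<in> ball w \<rho>" "d \<beta> \<noteq> 0" by blast
      have "ball w \<rho> \<subseteq> V"
      proof
        fix z assume z: "z \<in> ball w \<rho>"
        have "eventually (\<lambda>u. d u \<noteq> 0 \<and> u \<in> ball w \<rho>) (at z)"
          by (rule non_zero_neighbour_alt[OF d open_ball connected_ball z \<beta>])
        then have "eventually (\<lambda>u. op_invertible (P u)) (at z)"
          by eventually_elim (use inv_iff in blast)
        then show "z \<in> V" using z sub by (auto simp: V_def)
      qed
      then show ?thesis using \<rho>(1) sub by (intro exI[of _ "ball w \<rho>"]) auto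
    qed
  qed
  have VU: "V \<subseteq> U" by (auto simp: V_def)
  have "open V"
  proof (subst open_subopen, rule ballI)
    fix w assume w: "w \<in> V"
    then obtain T where "open T" "w \<in> T" "T \<subseteq> V \<or> T \<inter> V = {}" using dich[of w] VU by auto
    then show "\<exists>T. open T \<and> w \<in> T \<and> T \<subseteq> V" using w by auto
  qed
  moreover have "open (U - V)"
  proof (subst open_subopen, rule ballI)
    fix w assume w: "w \<in> U - V"
    then obtain T where "open T" "w \<in> T" "T \<subseteq> U" "T \<subseteq> V \<or> T \<inter> V = {}" using dich[of w] by auto
    then show "\<exists>T. open T \<and> w \<in> T \<and> T \<subseteq> U - V" using w by auto
  qed
  ultimately have "V \<inter> U = {} \<or> (U - V) \<inter> U = {}"
    by (intro connectedD[OF U(2)]) auto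
  moreover have "z0 \<in> V"
  proof -
    have "open {z \<in> U. op_invertible (P z)}"
      by (rule open_op_invertible[OF vector_holomorphic_on_imp_continuous_on[OF P(1)] U(1)])
    then have "eventually (\<lambda>w. w \<in> {z \<in> U. op_invertible (P z)}) (at z0)"
      using z0 by (intro eventually_at_in_open') auto
    then show ?thesis using z0(1) by (auto simp: V_def elim: eventually_mono)
  qed
  ultimately show ?thesis using z by (auto simp: V_def)
qed

text \<open>To be applied with \<open>B\<close> a disc and \<open>\<mu>\<close> the orders of zeros:
  if the point \<open>k\<close> alone accounts for the whole total, nothing is left for the other
  points. The sum is restricted to the support since \<open>B\<close> is infinite.\<close>

lemma nonneg_sum_concentrated:
  fixes \<mu> :: "'a \<Rightarrow> int"
  assumes fin: "finite {p \<in> B. \<mu> p \<noteq> 0}" and nn: "\<And>p. p \<in> B \<Longrightarrow> \<mu> p \<ge> 0"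
    and k: "k \<in> B" and le: "(\<Sum>p | p \<in> B \<and> \<mu> p \<noteq> 0. \<mu> p) \<le> \<mu> k"
  shows "(\<Sum>p | p \<in> B \<and> \<mu> p \<noteq> 0. \<mu> p) = \<mu> k" and "p \<in> B \<Longrightarrow> p \<noteq> k \<Longrightarrow> \<mu> p = 0"
proof -
  define S where "S = {p \<in> B. \<mu> p \<noteq> 0}"
  have S: "finite S" "S \<subseteq> B" using fin by (auto simp: S_def)
  have "sum \<mu> S = sum \<mu> (insert k S)"
    using S k by (intro sum.mono_neutral_left) (auto simp: S_def)
  also have "\<dots> = \<mu> k + sum \<mu> (S - {k})" using S(1) by (rule sum.insert_remove)
  finally have eq: "sum \<mu> S = \<mu> k + sum \<mu> (S - {k})" .
  have "0 \<le> sum \<mu> (S - {k})" using S nn by (intro sum_nonneg) auto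
  then have zero: "sum \<mu> (S - {k}) = 0" using le eq by (simp add: S_def)
  then show "(\<Sum>p | p \<in> B \<and> \<mu> p \<noteq> 0. \<mu> p) = \<mu> k" using eq by (simp add: S_def)
  have "\<forall>p\<in>S - {k}. \<mu> p = 0"
    using zero S nn by (subst (asm) sum_nonneg_eq_0_iff) auto
  then show "\<mu> p = 0" if "p \<in> B" "p \<noteq> k" using that by (auto simp: S_def)
qed

text \<open>Connectedness of \<open>\<Omega>\<close> and the lattice stay outside: the facts derived
  here are local in the parameter or concern a single one.\<close>

locale fredholm_family =
  fixes Q :: "complex \<times> complex \<Rightarrow> ('x::complex_banach \<Rightarrow>\<^sub>L 'y::complex_banach)" and \<Omega> :: "complex set"
  assumes op: "open \<Omega>" and lin: "\<And>\<alpha> k. \<alpha> \<in> \<Omega> \<Longrightarrow> Q (\<alpha>, k) \<in> cblinfun"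
    and hol: "holomorphic2_on Q (\<Omega> \<times> UNIV)"
    and fred: "\<And>\<alpha> k. \<alpha> \<in> \<Omega> \<Longrightarrow> fredholm (Q (\<alpha>, k)) \<and> fredholm_index (Q (\<alpha>, k)) = 0"
begin

lemma open_dom: "open (\<Omega> \<times> (UNIV :: complex set))"
  by (intro open_Times op) simp

lemma has_derivative2:
  assumes "\<alpha> \<in> \<Omega>"
  obtains A B where "(Q has_derivative (\<lambda>h. fst h *\<^sub>C A + snd h *\<^sub>C B)) (at (\<alpha>, k))"
proof -
  have p: "(\<alpha>, k) \<in> \<Omega> \<times> UNIV" using assms by simp
  then obtain A B where "(Q has_derivative (\<lambda>h. fst h *\<^sub>C A + snd h *\<^sub>C B)) (at (\<alpha>, k) within \<Omega> \<times> UNIV)"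
    using hol unfolding holomorphic2_on_def by blast
  then show thesis unfolding at_within_open[OF p open_dom] by (rule that)
qed

lemma continuous_on_Q: "continuous_on (\<Omega> \<times> UNIV) Q"
proof (rule continuous_at_imp_continuous_on, rule ballI)
  fix p assume "p \<in> \<Omega> \<times> (UNIV :: complex set)"
  then obtain \<alpha> k where p: "p = (\<alpha>, k)" "\<alpha> \<in> \<Omega>" by auto
  obtain A B where "(Q has_derivative (\<lambda>h. fst h *\<^sub>C A + snd h *\<^sub>C B)) (at (\<alpha>, k))"
    by (rule has_derivative2[OF p(2)])
  then show "isCont Q p" unfolding p(1) by (rule has_derivative_continuous)
qed

lemma holomorphic_snd:
  assumes "\<alpha> \<in> \<Omega>"
  shows "vector_holomorphic_on (\<lambda>k. Q (\<alpha>, k)) UNIV"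
proof (rule vector_holomorphic_onI)
  fix k
  obtain A B where Q: "(Q has_derivative (\<lambda>h. fst h *\<^sub>C A + snd h *\<^sub>C B)) (at (\<alpha>, k))"
    by (rule has_derivative2[OF assms])
  have "((\<lambda>k. (\<alpha>, k)) has_derivative (\<lambda>h. (0, h))) (at k)"
    by (intro has_derivative_Pair has_derivative_const has_derivative_ident)
  from has_derivative_compose[OF this Q] show "\<exists>D. ((\<lambda>k. Q (\<alpha>, k)) has_derivative (\<lambda>h. h *\<^sub>C D)) (at k)" by auto
qed

lemma holomorphic_fst: "vector_holomorphic_on (\<lambda>\<alpha>. Q (\<alpha>, k)) \<Omega>"
proof (rule vector_holomorphic_onI)
  fix \<alpha> assume "\<alpha> \<in> \<Omega>"
  then obtain A B where Q: "(Q has_derivative (\<lambda>h. fst h *\<^sub>C A + snd h *\<^sub>C B)) (at (\<alpha>, k))"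
    by (rule has_derivative2)
  have "((\<lambda>\<alpha>. (\<alpha>, k)) has_derivative (\<lambda>h. (h, 0))) (at \<alpha>)"
    by (intro has_derivative_Pair has_derivative_const has_derivative_ident)
  from has_derivative_compose[OF this Q] show "\<exists>D. ((\<lambda>\<alpha>. Q (\<alpha>, k)) has_derivative (\<lambda>h. h *\<^sub>C D)) (at \<alpha>)" by auto
qed

text \<open>The finite rank shift is chosen at the one point \<open>(\<alpha>, k)\<close>, and joint
  continuity keeps it valid on a product of discs. With the same \<open>f\<close> and
  \<open>y\<close> for all nearby parameters, the determinants become comparable, as Rouche's
  theorem requires.\<close>

lemma local_reduction:
  assumes "\<alpha> \<in> \<Omega>"
  obtains n and f :: "nat \<Rightarrow> 'x \<Rightarrow>\<^sub>L complex" and y and \<delta> \<rho> :: real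
  where "\<delta> > 0" "\<rho> > 0" "ball \<alpha> \<delta> \<subseteq> \<Omega>" "\<And>i. i < n \<Longrightarrow> f i \<in> cblinfun"
    "\<And>\<alpha>' k'. \<alpha>' \<in> ball \<alpha> \<delta> \<Longrightarrow> k' \<in> ball k \<rho> \<Longrightarrow> op_invertible (rank_shift (Q (\<alpha>', k')) n f y)"
proof -
  obtain n and f :: "nat \<Rightarrow> 'x \<Rightarrow>\<^sub>L complex" and y where f: "\<And>i. i < n \<Longrightarrow> f i \<in> cblinfun"
      and inv: "op_invertible (rank_shift (Q (\<alpha>, k)) n f y)"
    unfolding rank_shift_def using fredholm_invertible_perturbation[OF lin[OF assms]] fred[OF assms] by metis
  define W where "W = {p \<in> \<Omega> \<times> UNIV. op_invertible (rank_shift (Q p) n f y)}"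
  have "open W"
    unfolding W_def rank_shift_def
    by (intro open_op_invertible open_dom continuous_intros continuous_on_Q)
  moreover have "(\<alpha>, k) \<in> W" using inv assms by (simp add: W_def)
  ultimately obtain A B where AB: "open A" "open B" "\<alpha> \<in> A" "k \<in> B" "A \<times> B \<subseteq> W"
    by (auto elim!: open_prod_elim)
  obtain \<delta> where \<delta>: "\<delta> > 0" "ball \<alpha> \<delta> \<subseteq> A" using AB by (meson open_contains_ball)
  obtain \<rho> where \<rho>: "\<rho> > 0" "ball k \<rho> \<subseteq> B" using AB by (meson open_contains_ball)
  have W: "(\<alpha>', k') \<in> W" if "\<alpha>' \<in> ball \<alpha> \<delta>" "k' \<in> ball k \<rho>" for \<alpha>' k'
    using that \<delta> \<rho> AB(5) by blast
  show ?thesis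
  proof (rule that[OF \<delta>(1) \<rho>(1) _ f])
    show "ball \<alpha> \<delta> \<subseteq> \<Omega>"
      using W[of _ k] \<rho>(1) by (auto simp: W_def)
    show "op_invertible (rank_shift (Q (\<alpha>', k')) n f y)" if "\<alpha>' \<in> ball \<alpha> \<delta>" "k' \<in> ball k \<rho>" for \<alpha>' k'
      using W[OF that] by (simp add: W_def)
  qed
qed

definition regular :: "complex \<Rightarrow> bool" where
  "regular \<alpha> \<longleftrightarrow> (\<exists>k. op_invertible (Q (\<alpha>, k)))"

text \<open>Reconciles the definition of the multiplicity, which speaks of trivial kernels, with
  invertibility: at index 0 a trivial kernel makes the reduced determinant nonzero.\<close>

lemma op_ker_iff_invertible:
  assumes "\<alpha> \<in> \<Omega>"
  shows "op_ker (Q (\<alpha>, k)) = {0} \<longleftrightarrow> op_invertible (Q (\<alpha>, k))"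
proof -
  obtain n and f :: "nat \<Rightarrow> 'x \<Rightarrow>\<^sub>L complex" and y where f: "\<And>i. i < n \<Longrightarrow> f i \<in> cblinfun"
      and inv: "op_invertible (rank_shift (Q (\<alpha>, k)) n f y)"
    unfolding rank_shift_def using fredholm_invertible_perturbation[OF lin[OF assms]] fred[OF assms] by metis
  have "op_invertible (Q (\<alpha>, k))" if "op_ker (Q (\<alpha>, k)) = {0}"
  proof (rule reduced_det_neq_0_imp_invertible(1)[OF f lin[OF assms] inv])
    show "reduced_det (Q (\<alpha>, k)) n f y \<noteq> 0"
      using reduced_det_eq_0_imp_kernel[OF f lin[OF assms] inv] that by blast
  qed
  then show ?thesis using op_ker_invertible by blast
qed

lemma regular_iff: "\<alpha> \<in> \<Omega> \<Longrightarrow> regular \<alpha> \<longleftrightarrow> multiplicity_at Q \<alpha> k \<noteq> Pinf"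
proof -
  obtain c r where "(SOME D. isolating_disc (\<lambda>\<zeta>. Q (\<alpha>, \<zeta>)) k D) = (c, r)" by fastforce
  then show "\<alpha> \<in> \<Omega> \<Longrightarrow> ?thesis"
    by (simp add: regular_def multiplicity_at_def Let_def op_ker_iff_invertible)
qed

lemma eventually_invertible:
  assumes "\<alpha> \<in> \<Omega>" "regular \<alpha>"
  shows "eventually (\<lambda>w. op_invertible (Q (\<alpha>, w))) (at k)"
proof -
  obtain k0 where "op_invertible (Q (\<alpha>, k0))" using assms(2) by (auto simp: regular_def)
  then show ?thesis
    by (intro eventually_invertible_punctured[OF holomorphic_snd[OF assms(1)], of k0])
       (simp_all add: lin fred assms(1) connected_UNIV)
qed

text \<open>The multiplicity does not refer to a reduction, so every reduction near \<open>k\<close>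
  gives the same order of vanishing. This freedom is what the translation by lattice elements
  exploits.\<close>

lemma multiplicity_eq_zorder:
  assumes \<alpha>: "\<alpha> \<in> \<Omega>" "regular \<alpha>" and U: "open U" "k \<in> U" and f: "\<And>i. i < n \<Longrightarrow> f i \<in> cblinfun"
    and E: "\<And>z. z \<in> U \<Longrightarrow> op_invertible (rank_shift (Q (\<alpha>, z)) n f y)"
  shows "multiplicity_at Q \<alpha> k = Fin (of_int (zorder (\<lambda>z. reduced_det (Q (\<alpha>, z)) n f y) k))"
proof -
  let ?P = "\<lambda>z. Q (\<alpha>, z)"
  obtain r where r: "r > 0" "\<And>w. w \<noteq> k \<Longrightarrow> dist w k < r \<Longrightarrow> op_invertible (?P w)"
    using eventually_invertible[OF \<alpha>, of k] unfolding eventually_at by blast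
  \<comment> \<open>Half the radius, because the isolating condition concerns the closed
    disc.\<close>
  have "isolating_disc ?P k (k, r/2)"
    using r(1) by (auto simp: isolating_disc_def dist_commute intro!: r(2))
  then have D: "isolating_disc ?P k (SOME D. isolating_disc ?P k D)"
    by (rule someI)
  obtain c s where cs: "(SOME D. isolating_disc ?P k D) = (c, s)" by fastforce
  have "op_trace (vec_contour_integral (circlepath c s) (\<lambda>z. op_inverse (?P z) o\<^sub>L cderiv ?P z))
      = 2 * of_real pi * \<i> * of_int (zorder (\<lambda>z. reduced_det (?P z) n f y) k)"
    by (rule op_trace_logderiv[OF holomorphic_snd[OF \<alpha>(1)] lin[OF \<alpha>(1)] D[unfolded cs] U f E])
  moreover have "\<exists>k0. op_ker (?P k0) = {0}"
    using \<alpha> by (simp add: op_ker_iff_invertible regular_def)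
  ultimately show ?thesis
    by (simp add: multiplicity_at_def Let_def cs)
qed

text \<open>Rouche's theorem, applied to the determinants of a local reduction.\<close>

lemma multiplicity_stable:
  assumes \<alpha>: "\<alpha> \<in> \<Omega>" "regular \<alpha>" and r0: "r0 > 0"
  obtains r \<delta> where "r > 0" "r \<le> r0" "\<delta> > 0" "ball \<alpha> \<delta> \<subseteq> \<Omega>"
    "\<And>\<alpha>'. \<alpha>' \<in> ball \<alpha> \<delta> \<Longrightarrow> regular \<alpha>' \<and> (\<exists>\<mu> :: complex \<Rightarrow> int.
        (\<forall>p\<in>ball k r. multiplicity_at Q \<alpha>' p = Fin (of_int (\<mu> p)) \<and> \<mu> p \<ge> 0) \<and>
        finite {p \<in> ball k r. \<mu> p \<noteq> 0} \<and>
        multiplicity_at Q \<alpha> k = Fin (of_int (\<Sum>p | p \<in> ball k r \<and> \<mu> p \<noteq> 0. \<mu> p)))"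
proof -
  obtain n and f :: "nat \<Rightarrow> 'x \<Rightarrow>\<^sub>L complex" and y and \<delta> \<rho> :: real
    where red: "\<delta> > 0" "\<rho> > 0" "ball \<alpha> \<delta> \<subseteq> \<Omega>" "\<And>i. i < n \<Longrightarrow> f i \<in> cblinfun"
    "\<And>\<alpha>' k'. \<alpha>' \<in> ball \<alpha> \<delta> \<Longrightarrow> k' \<in> ball k \<rho> \<Longrightarrow> op_invertible (rank_shift (Q (\<alpha>', k')) n f y)"
    by (rule local_reduction[OF \<alpha>(1), of k], rule that)
  define d where "d p = reduced_det (Q p) n f y" for p
  have lin': "Q (\<alpha>', z) \<in> cblinfun" if "\<alpha>' \<in> ball \<alpha> \<delta>" for \<alpha>' z using red(3) that lin by blast
  have d_hol: "(\<lambda>z. d (\<alpha>', z)) holomorphic_on ball k \<rho>" if "\<alpha>' \<in> ball \<alpha> \<delta>" for \<alpha>'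
    unfolding d_def
    by (rule holomorphic_on_reduced_det[OF vector_holomorphic_on_subset[OF holomorphic_snd subset_UNIV] lin' open_ball red(4)])
       (use that red(3,5) in auto)
  have d_inv: "d (\<alpha>', z) \<noteq> 0 \<longleftrightarrow> op_invertible (Q (\<alpha>', z))" if "\<alpha>' \<in> ball \<alpha> \<delta>" "z \<in> ball k \<rho>" for \<alpha>' z
    unfolding d_def
    using reduced_det_eq_0_imp_kernel[OF red(4) lin'[OF that(1)] red(5)[OF that]] op_ker_invertible[of "Q (\<alpha>', z)"]
      reduced_det_neq_0_imp_invertible(1)[OF red(4) lin'[OF that(1)] red(5)[OF that]] by blast
  have d_cont: "continuous_on (ball \<alpha> \<delta> \<times> ball k \<rho>) d"
  proof -
    have Qc: "continuous_on (ball \<alpha> \<delta> \<times> ball k \<rho>) Q"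
      using continuous_on_Q by (rule continuous_on_subset) (use red(3) in auto)
    have "continuous_on (ball \<alpha> \<delta> \<times> ball k \<rho>) (\<lambda>p. op_inverse (rank_shift (Q p) n f y))"
      unfolding continuous_on_def rank_shift_def
      by (intro ballI tendsto_op_inverse tendsto_intros Qc[unfolded continuous_on_def, rule_format])
         (use red(5) in \<open>auto simp: rank_shift_def\<close>)
    then show ?thesis
      unfolding d_def reduced_det_def reduced_matrix_def
      by (intro continuous_on_fun_det continuous_intros)
  qed
  have ev: "eventually (\<lambda>w. op_invertible (Q (\<alpha>, w))) (at k)" by (rule eventually_invertible[OF \<alpha>])
  then obtain \<rho>1 where \<rho>1: "\<rho>1 > 0" "\<And>w. w \<noteq> k \<Longrightarrow> dist w k < \<rho>1 \<Longrightarrow> op_invertible (Q (\<alpha>, w))"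
    unfolding eventually_at by blast
  \<comment> \<open>Within \<open>R\<close>, the reduction is valid and
    \<open>Q (\<alpha>, z)\<close> is invertible except possibly at \<open>k\<close>. The circle has
    radius \<open>r = R / 2\<close>, so that it lies inside the open disc on which Rouche's theorem
    is applied.\<close>
  define R where "R = min (min \<rho> \<rho>1) r0 / 2"
  define r where "r = R / 2"
  have R: "R > 0" "R < \<rho>" "R < \<rho>1" "R < r0" using red(2) \<rho>1(1) r0 by (auto simp: R_def)
  have r: "r > 0" "r < R" using R(1) by (auto simp: r_def)
  have \<alpha>in: "\<alpha> \<in> ball \<alpha> \<delta>" using red(1) by simp
  have d_nz: "d (\<alpha>, z) \<noteq> 0" if "z \<in> cball k R" "z \<noteq> k" for z
    using that R by (subst d_inv[OF \<alpha>in]) (auto intro!: \<rho>1(2) simp: dist_commute)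
  have sphere: "compact (sphere k r)" "sphere k r \<noteq> {}" "sphere k r \<subseteq> ball k \<rho>"
    using r R by auto
  have "continuous_on (sphere k r) (\<lambda>z. cmod (d (\<alpha>, z)))"
    by (intro continuous_intros continuous_on_subset[OF holomorphic_on_imp_continuous_on[OF d_hol[OF \<alpha>in]] sphere(3)])
  \<comment> \<open>The minimum of the modulus on the circle is the tolerance for the perturbation;
    uniform continuity of \<open>d\<close> on a compact product then gives one
    \<open>\<delta>'\<close> for all points of the circle.\<close>
  then obtain z0 where z0: "z0 \<in> sphere k r" "\<And>z. z \<in> sphere k r \<Longrightarrow> cmod (d (\<alpha>, z0)) \<le> cmod (d (\<alpha>, z))"
    using continuous_attains_inf[OF sphere(1,2)] by blast
  have m: "cmod (d (\<alpha>, z0)) > 0" using d_nz[of z0] z0(1) r by auto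
  have "compact (cball \<alpha> (\<delta>/2) \<times> sphere k r)" by (intro compact_Times compact_cball sphere(1))
  moreover have sub2: "cball \<alpha> (\<delta>/2) \<times> sphere k r \<subseteq> ball \<alpha> \<delta> \<times> ball k \<rho>"
    using red(1) sphere(3) by auto
  ultimately have "uniformly_continuous_on (cball \<alpha> (\<delta>/2) \<times> sphere k r) d"
    by (intro compact_uniformly_continuous continuous_on_subset[OF d_cont])
  then obtain e where e: "e > 0" "\<And>p q. p \<in> cball \<alpha> (\<delta>/2) \<times> sphere k r \<Longrightarrow> q \<in> cball \<alpha> (\<delta>/2) \<times> sphere k r \<Longrightarrow> dist q p < e \<Longrightarrow> dist (d q) (d p) < cmod (d (\<alpha>, z0))"
    unfolding uniformly_continuous_on_def using m by metis
  define \<delta>' where "\<delta>' = min (\<delta>/2) e"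
  have \<delta>': "\<delta>' > 0" "\<delta>' \<le> \<delta>/2" "\<delta>' \<le> e" using red(1) e(1) by (auto simp: \<delta>'_def)
  show ?thesis
  proof (rule that[of r \<delta>'])
    show "r > 0" "r \<le> r0" "\<delta>' > 0" using r R \<delta>' by auto
    have bsub: "ball \<alpha> \<delta>' \<subseteq> ball \<alpha> \<delta>" using \<delta>' red(1) by auto
    then show "ball \<alpha> \<delta>' \<subseteq> \<Omega>" using red(3) by blast
    fix \<beta> assume \<beta>: "\<beta> \<in> ball \<alpha> \<delta>'"
    have \<beta>in: "\<beta> \<in> ball \<alpha> \<delta>" using \<beta> bsub by blast
    have close: "cmod (d (\<beta>, z) - d (\<alpha>, z)) < cmod (d (\<alpha>, z))" if z: "z \<in> sphere k r" for z
    proof -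
      have "dist (d (\<beta>, z)) (d (\<alpha>, z)) < cmod (d (\<alpha>, z0))"
        using \<beta> \<delta>' z red(1) by (intro e(2)) (auto simp: dist_Pair_Pair dist_commute)
      then show ?thesis using z0(2)[OF z] by (simp add: dist_norm)
    qed
    \<comment> \<open>One point of the circle where the perturbed determinant is nonzero shows that
      \<open>\<beta>\<close> is regular and that \<open>D\<close> does not vanish
      identically.\<close>
    have "k + of_real r \<in> sphere k r" using r by (simp add: dist_norm)
    then have nz: "d (\<beta>, k + of_real r) \<noteq> 0" using close by fastforce
    have kr: "k + of_real r \<in> ball k R" using r by (simp add: dist_norm)
    have reg: "regular \<beta>"
      using nz d_inv[OF \<beta>in, of "k + of_real r"] kr R by (auto simp: regular_def)
    define D where "D z = d (\<beta>, z)" for z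
    define g where "g z = d (\<beta>, z) - d (\<alpha>, z)" for z
    have bR: "ball k R \<subseteq> ball k \<rho>" "cball k R \<subseteq> ball k \<rho>" using R by auto
    have mult: "multiplicity_at Q \<gamma> p = Fin (of_int (zorder (\<lambda>z. d (\<gamma>, z)) p))"
      if "\<gamma> \<in> ball \<alpha> \<delta>" "regular \<gamma>" "p \<in> ball k \<rho>" for \<gamma> p
      unfolding d_def
      by (rule multiplicity_eq_zorder[OF _ that(2) open_ball that(3) red(4)]) (use that red in auto)
    have ord: "if D p = 0 then zorder D p > 0 else zorder D p = 0" if "p \<in> ball k R" for p
      using zorder_exist_zero[OF holomorphic_on_subset[OF d_hol[OF \<beta>in] bR(1)] open_ball connected_ball that] nz kr
      unfolding D_def by blast
    have fin: "finite {p \<in> ball k R. D p = 0}"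
    proof (cases "{p \<in> ball k R. D p = 0} = {}")
      case False
      then obtain p where "p \<in> ball k R" "D p = 0" by blast
      moreover have "D (k + of_real r) \<noteq> 0" using nz by (simp add: D_def)
      ultimately have "\<not> D constant_on ball k \<rho>"
        unfolding constant_on_def using kr bR(1) by (metis subsetD)
      then have "finite {p \<in> cball k R. D p = 0}"
        using d_hol[OF \<beta>in] bR(2) unfolding D_def
        by (intro holomorphic_compact_finite_zeros[of _ "ball k \<rho>"]) auto
      then show ?thesis by (rule rev_finite_subset) auto
    next
      case True
      then show ?thesis by (simp only: finite.emptyI)
    qed
    have zeros\<alpha>: "{p \<in> ball k R. d (\<alpha>, p) = 0} \<subseteq> {k}"
    proof
      fix p assume "p \<in> {p \<in> ball k R. d (\<alpha>, p) = 0}"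
      then show "p \<in> {k}" using d_nz[of p] by (cases "p = k") auto
    qed
    have rou: "(\<Sum>p\<in>{p \<in> ball k R. d (\<alpha>, p) + g p = 0}. winding_number (circlepath k r) p * of_int (zorder (\<lambda>p. d (\<alpha>, p) + g p) p))
        = (\<Sum>p\<in>{p \<in> ball k R. d (\<alpha>, p) = 0}. winding_number (circlepath k r) p * of_int (zorder (\<lambda>z. d (\<alpha>, z)) p))"
    proof (rule Rouche_theorem[OF open_ball connected_ball])
      show "finite {p \<in> ball k R. d (\<alpha>, p) + g p = 0}" using fin by (simp add: g_def D_def)
      show "finite {p \<in> ball k R. d (\<alpha>, p) = 0}" using zeros\<alpha> by (rule finite_subset) simp
      show "(\<lambda>z. d (\<alpha>, z)) holomorphic_on ball k R" by (rule holomorphic_on_subset[OF d_hol[OF \<alpha>in] bR(1)])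
      show "g holomorphic_on ball k R"
        unfolding g_def
        by (intro holomorphic_intros holomorphic_on_subset[OF d_hol[OF \<alpha>in] bR(1)] holomorphic_on_subset[OF d_hol[OF \<beta>in] bR(1)])
      show "path_image (circlepath k r) \<subseteq> ball k R" using r by auto
      show "\<forall>z\<in>path_image (circlepath k r). cmod (g z) < cmod (d (\<alpha>, z))"
        using close r by (auto simp: g_def)
      show "\<forall>z. z \<notin> ball k R \<longrightarrow> winding_number (circlepath k r) z = 0"
        using r by (intro allI impI winding_number_zero_outside[of _ "cball k r"]) auto
    qed auto
    define \<mu> where "\<mu> p = zorder D p" for p
    \<comment> \<open>Zeros of \<open>D\<close> in the annulus outside the circle have winding
      number 0, and none lies on the circle. The alternative \<open>p = k\<close> serves the sum for
      \<open>\<alpha>\<close>, where \<open>k\<close> is the only possible zero.\<close>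
    have w1: "winding_number (circlepath k r) p = (if p \<in> ball k r then 1 else 0)" if "p \<in> ball k R" "D p = 0 \<or> p = k" for p
    proof (cases "p \<in> ball k r")
      case True then show ?thesis by (simp add: winding_number_circlepath dist_norm norm_minus_commute)
    next
      case False
      have "D z \<noteq> 0" if "z \<in> sphere k r" for z using close[OF that] unfolding D_def by auto
      then have "p \<notin> sphere k r" using that(2) r by auto
      then have "winding_number (circlepath k r) p = 0"
        using False r by (intro winding_number_zero_outside[of _ "cball k r"]) auto
      then show ?thesis using False by simp
    qed
    have brR: "ball k r \<subseteq> ball k R" using r by auto
    have subS: "{p \<in> ball k r. \<mu> p \<noteq> 0} \<subseteq> {p \<in> ball k R. D p = 0}"
    proof
      fix p assume p: "p \<in> {p \<in> ball k r. \<mu> p \<noteq> 0}"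
      then have "p \<in> ball k R" using brR by blast
      then show "p \<in> {p \<in> ball k R. D p = 0}" using ord[of p] p by (auto simp: \<mu>_def split: if_splits)
    qed
    have "(\<Sum>p\<in>{p \<in> ball k R. d (\<alpha>, p) + g p = 0}. winding_number (circlepath k r) p * of_int (zorder (\<lambda>p. d (\<alpha>, p) + g p) p))
        = (\<Sum>p\<in>{p \<in> ball k R. D p = 0}. if p \<in> ball k r then of_int (\<mu> p) else 0)"
      using w1 by (intro sum.cong) (auto simp: g_def \<mu>_def D_def[abs_def])
    also have "\<dots> = (\<Sum>p\<in>{p \<in> ball k r. \<mu> p \<noteq> 0}. of_int (\<mu> p))"
      using subS by (intro sum.mono_neutral_cong_right[OF fin]) (auto simp: \<mu>_def)
    finally have s1: "(\<Sum>p\<in>{p \<in> ball k R. d (\<alpha>, p) + g p = 0}. winding_number (circlepath k r) p * of_int (zorder (\<lambda>p. d (\<alpha>, p) + g p) p))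
        = (\<Sum>p\<in>{p \<in> ball k r. \<mu> p \<noteq> 0}. of_int (\<mu> p))" .
    have kR: "k \<in> ball k R" "k \<in> ball k r" "k \<in> ball k \<rho>" using R r by auto
    \<comment> \<open>If \<open>d (\<alpha>, k)\<close> is nonzero, the sum is empty, which agrees
      with the order being 0.\<close>
    have s2: "(\<Sum>p\<in>{p \<in> ball k R. d (\<alpha>, p) = 0}. winding_number (circlepath k r) p * of_int (zorder (\<lambda>z. d (\<alpha>, z)) p))
        = of_int (zorder (\<lambda>z. d (\<alpha>, z)) k)"
    proof (cases "d (\<alpha>, k) = 0")
      case True
      then have "{p \<in> ball k R. d (\<alpha>, p) = 0} = {k}" using zeros\<alpha> kR by blast
      then show ?thesis using w1[OF kR(1)] kR(2) by simp
    next
      case False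
      then have none: "{p \<in> ball k R. d (\<alpha>, p) = 0} = {}" using zeros\<alpha> by blast
      have "zorder (\<lambda>z. d (\<alpha>, z)) k = 0"
      proof -
        have "\<exists>w\<in>ball k \<rho>. d (\<alpha>, w) \<noteq> 0" using False kR(3) by blast
        from zorder_exist_zero[OF d_hol[OF \<alpha>in] open_ball connected_ball kR(3) this] False show ?thesis
          by simp
      qed
      then show ?thesis unfolding none by simp
    qed
    show "regular \<beta> \<and> (\<exists>\<mu> :: complex \<Rightarrow> int.
        (\<forall>p\<in>ball k r. multiplicity_at Q \<beta> p = Fin (of_int (\<mu> p)) \<and> \<mu> p \<ge> 0) \<and>
        finite {p \<in> ball k r. \<mu> p \<noteq> 0} \<and>
        multiplicity_at Q \<alpha> k = Fin (of_int (\<Sum>p | p \<in> ball k r \<and> \<mu> p \<noteq> 0. \<mu> p)))"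
    proof (intro conjI exI[of _ \<mu>] ballI reg)
      fix p assume p: "p \<in> ball k r"
      then have pR: "p \<in> ball k R" using brR by blast
      show "multiplicity_at Q \<beta> p = Fin (of_int (\<mu> p))"
        unfolding \<mu>_def D_def[abs_def] using pR bR by (intro mult \<beta>in reg) auto
      show "0 \<le> \<mu> p" using ord[OF pR] by (auto simp: \<mu>_def split: if_splits)
    next
      show "finite {p \<in> ball k r. \<mu> p \<noteq> 0}"
        by (rule finite_subset[OF subS fin])
      show "multiplicity_at Q \<alpha> k = Fin (of_int (\<Sum>p | p \<in> ball k r \<and> \<mu> p \<noteq> 0. \<mu> p))"
        unfolding mult[OF \<alpha>in \<alpha>(2) kR(3)] using rou[unfolded s1 s2] by simp
    qed
  qed
qed

text \<open>For \<open>\<beta>\<close> near \<open>\<alpha>\<close>, the multiplicities in a small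
  disc about \<open>k\<close> add up to that of \<open>\<alpha>\<close> at \<open>k\<close>, and by
  minimality \<open>k\<close> alone contributes at least this much. So everything sits at
  \<open>k\<close>. Since \<open>\<alpha>\<close> is one of these parameters, the values also agree
  at the other points of the disc.\<close>

lemma multiplicity_locally_constant:
  assumes \<alpha>: "\<alpha> \<in> \<Omega>" "regular \<alpha>" and min: "\<And>\<beta> k. \<beta> \<in> \<Omega> \<Longrightarrow> multiplicity_at Q \<alpha> k \<le> multiplicity_at Q \<beta> k"
  shows "\<exists>r>0. \<exists>\<delta>>0. \<forall>\<beta>\<in>ball \<alpha> \<delta>. \<forall>p\<in>ball k r. multiplicity_at Q \<beta> p = multiplicity_at Q \<alpha> p"
proof -
  have one: "(0::real) < 1" by simp
  obtain r \<delta> where r: "r > 0" "r \<le> 1" "\<delta> > 0" "ball \<alpha> \<delta> \<subseteq> \<Omega>"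
    and st: "\<And>\<beta>. \<beta> \<in> ball \<alpha> \<delta> \<Longrightarrow> regular \<beta> \<and> (\<exists>\<mu> :: complex \<Rightarrow> int.
        (\<forall>p\<in>ball k r. multiplicity_at Q \<beta> p = Fin (of_int (\<mu> p)) \<and> \<mu> p \<ge> 0) \<and>
        finite {p \<in> ball k r. \<mu> p \<noteq> 0} \<and>
        multiplicity_at Q \<alpha> k = Fin (of_int (\<Sum>p | p \<in> ball k r \<and> \<mu> p \<noteq> 0. \<mu> p)))"
    by (rule multiplicity_stable[OF \<alpha> one, of k], rule that)
  have kr: "k \<in> ball k r" using r(1) by simp
  have main: "multiplicity_at Q \<beta> p = (if p = k then multiplicity_at Q \<alpha> k else Fin 0)"
    if \<beta>: "\<beta> \<in> ball \<alpha> \<delta>" and p: "p \<in> ball k r" for \<beta> p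
  proof -
    obtain \<mu> :: "complex \<Rightarrow> int" where \<mu>: "\<And>p. p \<in> ball k r \<Longrightarrow> multiplicity_at Q \<beta> p = Fin (of_int (\<mu> p)) \<and> \<mu> p \<ge> 0"
        "finite {p \<in> ball k r. \<mu> p \<noteq> 0}"
        "multiplicity_at Q \<alpha> k = Fin (of_int (\<Sum>p | p \<in> ball k r \<and> \<mu> p \<noteq> 0. \<mu> p))"
      using st[OF \<beta>] by blast
    have "multiplicity_at Q \<alpha> k \<le> multiplicity_at Q \<beta> k" using \<beta> r(4) by (intro min) auto
    then have "(\<Sum>p | p \<in> ball k r \<and> \<mu> p \<noteq> 0. \<mu> p) \<le> \<mu> k"
      using \<mu>(1)[OF kr] by (simp add: \<mu>(3) less_eq_complex_def del: of_int_sum)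
    note c = nonneg_sum_concentrated[OF \<mu>(2) _ kr this]
    have "(\<Sum>p | p \<in> ball k r \<and> \<mu> p \<noteq> 0. \<mu> p) = \<mu> k" "p \<noteq> k \<Longrightarrow> \<mu> p = 0"
      using c \<mu>(1) p by blast+
    then show ?thesis using \<mu>(1)[OF p] by (auto simp: \<mu>(3))
  qed
  have "\<alpha> \<in> ball \<alpha> \<delta>" using r(3) by simp
  then show ?thesis using main r(1,3) by metis
qed

text \<open>In a disc where \<open>\<alpha>0\<close> has no multiplicity outside \<open>k\<close>, a
  nearby \<open>\<beta>\<close> with the multiplicities of \<open>\<alpha>0\<close> would have total
  \<open>multiplicity_at Q \<alpha>0 k\<close>. But the total is that of \<open>\<alpha>\<close> at
  \<open>k\<close>, which differs.\<close>

lemma multiplicity_neq_near: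
  assumes \<alpha>: "\<alpha> \<in> \<Omega>" "regular \<alpha>" and \<alpha>0: "\<alpha>0 \<in> \<Omega>" "regular \<alpha>0"
    and min: "\<And>\<beta> k. \<beta> \<in> \<Omega> \<Longrightarrow> multiplicity_at Q \<alpha>0 k \<le> multiplicity_at Q \<beta> k"
    and ne: "multiplicity_at Q \<alpha> k \<noteq> multiplicity_at Q \<alpha>0 k"
  shows "\<exists>\<delta>>0. \<forall>\<beta>\<in>ball \<alpha> \<delta>. \<exists>p. multiplicity_at Q \<beta> p \<noteq> multiplicity_at Q \<alpha>0 p"
proof -
  have one: "(0::real) < 1" by simp
  obtain r0 \<delta>0 where r0: "r0 > 0" "\<delta>0 > 0"
    and st0: "\<And>\<beta>. \<beta> \<in> ball \<alpha>0 \<delta>0 \<Longrightarrow> regular \<beta> \<and> (\<exists>\<mu> :: complex \<Rightarrow> int.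
        (\<forall>p\<in>ball k r0. multiplicity_at Q \<beta> p = Fin (of_int (\<mu> p)) \<and> \<mu> p \<ge> 0) \<and>
        finite {p \<in> ball k r0. \<mu> p \<noteq> 0} \<and>
        multiplicity_at Q \<alpha>0 k = Fin (of_int (\<Sum>p | p \<in> ball k r0 \<and> \<mu> p \<noteq> 0. \<mu> p)))"
    by (rule multiplicity_stable[OF \<alpha>0 one, of k], rule that)
  have kr0: "k \<in> ball k r0" using r0(1) by simp
  have zero: "multiplicity_at Q \<alpha>0 p = Fin 0" if p: "p \<in> ball k r0" "p \<noteq> k" for p
  proof -
    \<comment> \<open>Stability is used with the unperturbed parameter itself: the total over the
      disc is the contribution of \<open>k\<close>, so the other points contribute nothing.\<close>
    have "\<alpha>0 \<in> ball \<alpha>0 \<delta>0" using r0(2) by simp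
    from st0[OF this] obtain \<mu> :: "complex \<Rightarrow> int" where \<mu>: "\<And>p. p \<in> ball k r0 \<Longrightarrow> multiplicity_at Q \<alpha>0 p = Fin (of_int (\<mu> p)) \<and> \<mu> p \<ge> 0"
        "finite {p \<in> ball k r0. \<mu> p \<noteq> 0}"
        "multiplicity_at Q \<alpha>0 k = Fin (of_int (\<Sum>p | p \<in> ball k r0 \<and> \<mu> p \<noteq> 0. \<mu> p))"
      by blast
    have "(\<Sum>p | p \<in> ball k r0 \<and> \<mu> p \<noteq> 0. \<mu> p) \<le> \<mu> k"
      using \<mu>(1)[OF kr0] by (simp add: \<mu>(3) del: of_int_sum)
    note c = nonneg_sum_concentrated(2)[OF \<mu>(2) _ kr0 this]
    have "\<mu> p = 0" using c \<mu>(1) p by blast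
    then show ?thesis using \<mu>(1)[OF p(1)] by simp
  qed
  obtain r \<delta> where r: "r > 0" "r \<le> r0" "\<delta> > 0" "ball \<alpha> \<delta> \<subseteq> \<Omega>"
    and st: "\<And>\<beta>. \<beta> \<in> ball \<alpha> \<delta> \<Longrightarrow> regular \<beta> \<and> (\<exists>\<mu> :: complex \<Rightarrow> int.
        (\<forall>p\<in>ball k r. multiplicity_at Q \<beta> p = Fin (of_int (\<mu> p)) \<and> \<mu> p \<ge> 0) \<and>
        finite {p \<in> ball k r. \<mu> p \<noteq> 0} \<and>
        multiplicity_at Q \<alpha> k = Fin (of_int (\<Sum>p | p \<in> ball k r \<and> \<mu> p \<noteq> 0. \<mu> p)))"
    by (rule multiplicity_stable[OF \<alpha> r0(1), of k], rule that)
  have kr: "k \<in> ball k r" using r(1) by simp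
  have "\<exists>p. multiplicity_at Q \<beta> p \<noteq> multiplicity_at Q \<alpha>0 p" if \<beta>: "\<beta> \<in> ball \<alpha> \<delta>" for \<beta>
  proof (rule ccontr)
    assume "\<not> ?thesis"
    then have eq: "multiplicity_at Q \<beta> p = multiplicity_at Q \<alpha>0 p" for p by blast
    obtain \<mu> :: "complex \<Rightarrow> int" where \<mu>: "\<And>p. p \<in> ball k r \<Longrightarrow> multiplicity_at Q \<beta> p = Fin (of_int (\<mu> p)) \<and> \<mu> p \<ge> 0"
        "finite {p \<in> ball k r. \<mu> p \<noteq> 0}"
        "multiplicity_at Q \<alpha> k = Fin (of_int (\<Sum>p | p \<in> ball k r \<and> \<mu> p \<noteq> 0. \<mu> p))"
      using st[OF \<beta>] by blast
    have "\<mu> p = 0" if p: "p \<in> ball k r" "p \<noteq> k" for p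
      using \<mu>(1)[OF p(1)] zero[of p] p r(2) by (simp add: eq)
    then have S: "{p \<in> ball k r. \<mu> p \<noteq> 0} \<subseteq> {k}" by blast
    have "(\<Sum>p | p \<in> ball k r \<and> \<mu> p \<noteq> 0. \<mu> p) = (\<Sum>p\<in>{k}. \<mu> p)"
      using S kr by (intro sum.mono_neutral_left) auto
    then have "multiplicity_at Q \<alpha> k = Fin (of_int (\<mu> k))" using \<mu>(3) by simp
    also have "\<dots> = multiplicity_at Q \<alpha>0 k" using \<mu>(1)[OF kr] by (simp add: eq)
    finally show False using ne by simp
  qed
  then show ?thesis using r(3) by blast
qed

text \<open>A reduction at \<open>k\<close> is carried to one at \<open>k + \<gamma>\<close> by
  composing the functionals with \<open>WX\<close> and applying \<open>op_inverse WY\<close> to the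
  vectors. The conjugating operators cancel in \<open>f i (op_inverse E (y j))\<close>, so the two
  determinants agree up to translation.\<close>

lemma multiplicity_translate:
  assumes \<alpha>: "\<alpha> \<in> \<Omega>"
    and WX: "WX \<in> cblinfun" "op_invertible WX" and WY: "WY \<in> cblinfun" "op_invertible WY"
    and eq: "\<And>k. Q (\<alpha>, k + \<gamma>) = op_inverse WY o\<^sub>L Q (\<alpha>, k) o\<^sub>L WX"
  shows "multiplicity_at Q \<alpha> (k + \<gamma>) = multiplicity_at Q \<alpha> k"
proof (cases "regular \<alpha>")
  case False
  then show ?thesis using regular_iff[OF \<alpha>] by metis
next
  case True
  obtain n and f :: "nat \<Rightarrow> 'x \<Rightarrow>\<^sub>L complex" and y and \<delta> \<rho> :: real
    where red: "\<delta> > 0" "\<rho> > 0" "ball \<alpha> \<delta> \<subseteq> \<Omega>" "\<And>i. i < n \<Longrightarrow> f i \<in> cblinfun"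
    "\<And>\<alpha>' k'. \<alpha>' \<in> ball \<alpha> \<delta> \<Longrightarrow> k' \<in> ball k \<rho> \<Longrightarrow> op_invertible (rank_shift (Q (\<alpha>', k')) n f y)"
    by (rule local_reduction[OF \<alpha>, of k], rule that)
  have inv: "op_invertible (rank_shift (Q (\<alpha>, z)) n f y)" if "z \<in> ball k \<rho>" for z
    using red(1,5) that by simp
  define f' where "f' i = f i o\<^sub>L WX" for i
  define y' where "y' i = op_inverse WY (y i)" for i
  have f': "f' i \<in> cblinfun" if "i < n" for i
    unfolding f'_def by (intro cblinfun_compose red(4) that WX)
  have WY': "op_inverse WY \<in> cblinfun" by (rule cblinfun_op_inverse[OF WY(2,1)])
  have sh: "rank_shift (Q (\<alpha>, z + \<gamma>)) n f' y' = op_inverse WY o\<^sub>L rank_shift (Q (\<alpha>, z)) n f y o\<^sub>L WX" for z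
    by (rule blinfun_eqI)
       (simp add: rank_shift_apply eq f'_def y'_def blinfun.add_right blinfun.sum_right cblinfun_scaleC[OF WY'])
  define S where "S z = op_inverse WX o\<^sub>L op_inverse (rank_shift (Q (\<alpha>, z)) n f y) o\<^sub>L WY" for z
  have S: "S z o\<^sub>L rank_shift (Q (\<alpha>, z + \<gamma>)) n f' y' = id_blinfun" "rank_shift (Q (\<alpha>, z + \<gamma>)) n f' y' o\<^sub>L S z = id_blinfun"
    if "z \<in> ball k \<rho>" for z
    unfolding sh S_def
    by (auto intro!: blinfun_eqI simp: op_inverse_apply[OF WX(2)] op_inverse_apply[OF WY(2)] op_inverse_apply[OF inv[OF that]])
  have inv': "op_invertible (rank_shift (Q (\<alpha>, z)) n f' y')" if "z \<in> ball (k + \<gamma>) \<rho>" for z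
  proof -
    have "z - \<gamma> \<in> ball k \<rho>" using that by (simp add: dist_norm algebra_simps)
    from S[OF this] show ?thesis by (auto simp: op_invertible_def)
  qed
  have det: "reduced_det (Q (\<alpha>, z + \<gamma>)) n f' y' = reduced_det (Q (\<alpha>, z)) n f y" if "z \<in> ball k \<rho>" for z
  proof -
    have "reduced_matrix (Q (\<alpha>, z + \<gamma>)) n f' y' = reduced_matrix (Q (\<alpha>, z)) n f y"
      unfolding reduced_matrix_def op_inverse_unique[OF S[OF that]]
      by (simp add: S_def f'_def y'_def op_inverse_apply[OF WX(2)] op_inverse_apply[OF WY(2)])
    then show ?thesis by (simp add: reduced_det_def)
  qed
  have kk: "k \<in> ball k \<rho>" "k + \<gamma> \<in> ball (k + \<gamma>) \<rho>" using red(2) by auto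
  have "zorder (\<lambda>z. reduced_det (Q (\<alpha>, z)) n f' y') (k + \<gamma>) = zorder (\<lambda>u. reduced_det (Q (\<alpha>, u + (k + \<gamma>))) n f' y') 0"
    by (rule zorder_shift)
  also have "\<dots> = zorder (\<lambda>u. reduced_det (Q (\<alpha>, u + k)) n f y) 0"
  proof (rule zorder_cong[OF _ refl])
    have "eventually (\<lambda>u::complex. u \<in> ball 0 \<rho>) (at 0)"
      using red(2) by (intro eventually_at_in_open') auto
    then show "eventually (\<lambda>u. reduced_det (Q (\<alpha>, u + (k + \<gamma>))) n f' y' = reduced_det (Q (\<alpha>, u + k)) n f y) (at 0)"
    proof eventually_elim
      case (elim u)
      then have "u + k \<in> ball k \<rho>" by (simp add: dist_norm)
      from det[OF this] show ?case by (simp add: add.assoc)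
    qed
  qed
  also have "\<dots> = zorder (\<lambda>z. reduced_det (Q (\<alpha>, z)) n f y) k"
    by (rule zorder_shift[symmetric])
  finally show ?thesis
    using multiplicity_eq_zorder[OF \<alpha> True open_ball kk(1) red(4) inv]
      multiplicity_eq_zorder[OF \<alpha> True open_ball kk(2) f' inv'] by simp
qed

end

theorem theorem1:
  fixes emb :: "'x::complex_banach \<Rightarrow> 'y::complex_banach"
    and \<Omega> \<Gamma> :: "complex set"
    and Q :: "complex \<times> complex \<Rightarrow> ('x \<Rightarrow>\<^sub>L 'y)"
    and W\<^sub>X :: "complex \<Rightarrow> ('x \<Rightarrow>\<^sub>L 'x)"
    and W\<^sub>Y :: "complex \<Rightarrow> ('y \<Rightarrow>\<^sub>L 'y)"
    and \<alpha>\<^sub>0 :: complex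
  assumes "Vector_Spaces.linear (*\<^sub>C) (*\<^sub>C) emb" and "inj emb"
    and "open \<Omega>" and "connected \<Omega>"
    and "\<And>\<alpha> k. \<alpha> \<in> \<Omega> \<Longrightarrow> Q (\<alpha>, k) \<in> cblinfun"
    and "holomorphic2_on Q (\<Omega> \<times> UNIV)"
    and "\<And>\<alpha> k. \<alpha> \<in> \<Omega> \<Longrightarrow> fredholm (Q (\<alpha>, k)) \<and> fredholm_index (Q (\<alpha>, k)) = 0"
    and "complex_lattice \<Gamma>"
    and "\<And>\<gamma>. \<gamma> \<in> \<Gamma> \<Longrightarrow> W\<^sub>X \<gamma> \<in> cblinfun \<and> op_invertible (W\<^sub>X \<gamma>)"
    and "\<And>\<gamma>. \<gamma> \<in> \<Gamma> \<Longrightarrow> W\<^sub>Y \<gamma> \<in> cblinfun \<and> op_invertible (W\<^sub>Y \<gamma>)"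
    and "\<And>\<alpha> k \<gamma>. \<alpha> \<in> \<Omega> \<Longrightarrow> \<gamma> \<in> \<Gamma> \<Longrightarrow>
           Q (\<alpha>, k + \<gamma>) = op_inverse (W\<^sub>Y \<gamma>) o\<^sub>L Q (\<alpha>, k) o\<^sub>L W\<^sub>X \<gamma>"
    and "\<alpha>\<^sub>0 \<in> \<Omega>"
    and "\<And>\<alpha> k. \<alpha> \<in> \<Omega> \<Longrightarrow>
           multiplicity_at Q \<alpha> k \<ge> multiplicity_at Q \<alpha>\<^sub>0 k \<and> multiplicity_at Q \<alpha>\<^sub>0 k \<noteq> Pinf"
  shows "\<exists>A. A \<subseteq> \<Omega> \<and> A sparse_in \<Omega> \<and>
           (\<forall>k. \<forall>\<alpha>\<in>\<Omega>. multiplicity_at Q \<alpha> k =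
              (if \<alpha> \<in> A then Pinf else multiplicity_at Q \<alpha>\<^sub>0 k))"
proof -
  note op = assms(3) and conn = assms(4) and lat = assms(8) and \<alpha>0 = \<open>\<alpha>\<^sub>0 \<in> \<Omega>\<close>
  interpret fredholm_family Q \<Omega>
    by (rule fredholm_family.intro) (fact assms)+
  let ?m = "multiplicity_at Q"
  have min: "?m \<alpha>\<^sub>0 k \<le> ?m \<alpha> k" and fin0: "?m \<alpha>\<^sub>0 k \<noteq> Pinf" if "\<alpha> \<in> \<Omega>" for \<alpha> k
    using assms(13)[OF that] by auto
  have trans: "?m \<alpha> (k + \<gamma>) = ?m \<alpha> k" if "\<alpha> \<in> \<Omega>" "\<gamma> \<in> \<Gamma>" for \<alpha> k \<gamma>
    using assms(9,10)[OF that(2)] assms(11)[OF that]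
    by (intro multiplicity_translate[OF that(1), of "W\<^sub>X \<gamma>" "W\<^sub>Y \<gamma>"]) auto
  define A where "A = {\<alpha> \<in> \<Omega>. \<not> regular \<alpha>}"
  have reg0: "regular \<alpha>\<^sub>0" using regular_iff[OF \<alpha>0] fin0[OF \<alpha>0] by blast
  \<comment> \<open>\<open>k0\<close> is a point where \<open>Q (\<alpha>\<^sub>0, k0)\<close> is
    invertible. With \<open>k0\<close> fixed, the Fredholm argument runs in the parameter, using
    that \<open>\<Omega>\<close> is connected; the exceptional parameters at this single
    \<open>k0\<close> already include all of \<open>A\<close>.\<close>
  have sparse: "A sparse_in \<Omega>"
    unfolding sparse_in_eventually_iff[OF op]
  proof
    obtain k0 where k0: "op_invertible (Q (\<alpha>\<^sub>0, k0))" using reg0 by (auto simp: regular_def)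
    fix \<alpha> assume "\<alpha> \<in> \<Omega>"
    then have "eventually (\<lambda>w. op_invertible (Q (w, k0))) (at \<alpha>)"
      by (intro eventually_invertible_punctured[OF holomorphic_fst lin fred op conn \<alpha>0 k0])
    then show "eventually (\<lambda>w. w \<notin> A) (at \<alpha>)"
      by eventually_elim (auto simp: A_def regular_def)
  qed
  define X where "X = \<Omega> - A"
  have X: "\<alpha> \<in> X \<longleftrightarrow> \<alpha> \<in> \<Omega> \<and> regular \<alpha>" for \<alpha> by (auto simp: X_def A_def)
  \<comment> \<open>A sparse set does not disconnect an open connected subset of the plane.\<close>
  have connX: "connected X"
    unfolding X_def by (rule sparse_imp_connected[OF _ conn op sparse]) simp
  define good where "good = {\<alpha> \<in> X. \<forall>k. ?m \<alpha> k = ?m \<alpha>\<^sub>0 k}"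
  obtain R where R: "\<And>z. \<exists>\<gamma>\<in>\<Gamma>. cmod (z - \<gamma>) \<le> R"
    using complex_lattice_cocompact[OF lat] by blast
  have "open good"
  proof (subst open_subopen, rule ballI)
    fix \<alpha> assume \<alpha>: "\<alpha> \<in> good"
    then have \<alpha>': "\<alpha> \<in> \<Omega>" "regular \<alpha>" "\<And>k. ?m \<alpha> k = ?m \<alpha>\<^sub>0 k" by (auto simp: good_def X)
    \<comment> \<open>A good parameter has the multiplicities of \<open>\<alpha>\<^sub>0\<close>, so
      the minimality assumed for \<open>\<alpha>\<^sub>0\<close> holds for it too and local
      constancy applies.\<close>
    have "\<forall>k. \<exists>r>0. \<exists>\<delta>>0. \<forall>\<beta>\<in>ball \<alpha> \<delta>. \<forall>p\<in>ball k r. ?m \<beta> p = ?m \<alpha> p"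
      using min by (intro allI multiplicity_locally_constant[OF \<alpha>'(1,2)]) (simp add: \<alpha>'(3))
    then obtain r \<delta> where r: "\<And>k. r k > 0" and \<delta>: "\<And>k. \<delta> k > 0"
      and loc: "\<And>k \<beta> p. \<beta> \<in> ball \<alpha> (\<delta> k) \<Longrightarrow> p \<in> ball k (r k) \<Longrightarrow> ?m \<beta> p = ?m \<alpha> p"
      by metis
    \<comment> \<open>Every point is congruent modulo \<open>\<Gamma>\<close> to one in this compact
      disc, so finitely many of the radii \<open>\<delta> k\<close> control all \<open>k\<close>
      simultaneously.\<close>
    have "cball 0 R \<subseteq> (\<Union>k\<in>cball 0 R. ball k (r k))"
      using r by force
    then obtain C where C: "C \<subseteq> cball 0 R" "finite C" "cball 0 R \<subseteq> (\<Union>k\<in>C. ball k (r k))"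
      by (rule compactE_image[OF compact_cball open_ball])
    define T where "T = \<Omega> \<inter> (\<Inter>k\<in>C. ball \<alpha> (\<delta> k))"
    have "open T" unfolding T_def using C(2) op by (intro open_Int open_INT) auto
    moreover have "\<alpha> \<in> T" using \<alpha>'(1) \<delta> by (auto simp: T_def)
    moreover have "T \<subseteq> good"
    proof
      fix \<beta> assume \<beta>: "\<beta> \<in> T"
      then have \<beta>\<Omega>: "\<beta> \<in> \<Omega>" by (simp add: T_def)
      have m: "?m \<beta> z = ?m \<alpha>\<^sub>0 z" for z
      proof -
        obtain \<gamma> where \<gamma>: "\<gamma> \<in> \<Gamma>" "cmod (z - \<gamma>) \<le> R" using R by blast
        then have "z - \<gamma> \<in> cball 0 R" by simp
        then obtain k where "k \<in> C" "z - \<gamma> \<in> ball k (r k)" using C(3) by blast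
        then have "?m \<beta> (z - \<gamma>) = ?m \<alpha> (z - \<gamma>)" using \<beta> by (intro loc) (auto simp: T_def)
        then show ?thesis
          using trans[OF \<beta>\<Omega> \<gamma>(1), of "z - \<gamma>"] trans[OF \<alpha>'(1) \<gamma>(1), of "z - \<gamma>"] by (simp add: \<alpha>'(3))
      qed
      have "regular \<beta>" unfolding regular_iff[OF \<beta>\<Omega>, of 0] m using fin0[OF \<alpha>0] .
      then show "\<beta> \<in> good" using \<beta>\<Omega> m by (auto simp: good_def X)
    qed
    ultimately show "\<exists>T. open T \<and> \<alpha> \<in> T \<and> T \<subseteq> good" by blast
  qed
  moreover have "open (X - good)"
  proof (subst open_subopen, rule ballI)
    fix \<alpha> assume \<alpha>: "\<alpha> \<in> X - good"
    then obtain k where k: "?m \<alpha> k \<noteq> ?m \<alpha>\<^sub>0 k" by (auto simp: good_def)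
    have \<alpha>': "\<alpha> \<in> \<Omega>" "regular \<alpha>" using \<alpha> by (auto simp: X)
    obtain \<delta> where \<delta>: "\<delta> > 0" "\<And>\<beta>. \<beta> \<in> ball \<alpha> \<delta> \<Longrightarrow> \<exists>p. ?m \<beta> p \<noteq> ?m \<alpha>\<^sub>0 p"
      using multiplicity_neq_near[OF \<alpha>' \<alpha>0 reg0 min k] by blast
    have "X = (\<Union>k. {\<alpha> \<in> \<Omega>. op_invertible (Q (\<alpha>, k))})" by (auto simp: X regular_def)
    moreover have "open {\<alpha> \<in> \<Omega>. op_invertible (Q (\<alpha>, k))}" for k
      by (rule open_op_invertible[OF vector_holomorphic_on_imp_continuous_on[OF holomorphic_fst] op])
    ultimately have "open X" by auto
    then have "open (X \<inter> ball \<alpha> \<delta>)" by (intro open_Int open_ball)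
    moreover have "X \<inter> ball \<alpha> \<delta> \<subseteq> X - good" using \<delta>(2) unfolding good_def by blast
    moreover have "\<alpha> \<in> X \<inter> ball \<alpha> \<delta>" using \<alpha> \<delta>(1) by auto
    ultimately show "\<exists>T. open T \<and> \<alpha> \<in> T \<and> T \<subseteq> X - good" by blast
  qed
  ultimately have "good \<inter> X = {} \<or> (X - good) \<inter> X = {}"
    by (intro connectedD[OF connX]) auto
  moreover have "\<alpha>\<^sub>0 \<in> good" using \<alpha>0 reg0 by (auto simp: good_def X)
  ultimately have XG: "X \<subseteq> good" by (auto simp: good_def)
  have "?m \<alpha> k = (if \<alpha> \<in> A then Pinf else ?m \<alpha>\<^sub>0 k)" if \<alpha>: "\<alpha> \<in> \<Omega>" for \<alpha> k
  proof (cases "\<alpha> \<in> A")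
    case True
    then show ?thesis using regular_iff[OF \<alpha>, of k] by (simp add: A_def)
  next
    case False
    then have "\<alpha> \<in> good" using XG \<alpha> by (auto simp: X_def)
    then show ?thesis using False by (simp add: good_def)
  qed
  then show ?thesis using sparse by (intro exI[of _ A]) (auto simp: A_def)
qed

end
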